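(* Let $(M^n,g)$ be a compact Riemannian $\mathrm{Spin^c}$ manifold of dimension $n\geqslant 2$, and denote by $i\Omega$ the curvature form of the connection $A$ on the $\mathbb{S}^1$-principal bundle $\mathbb{S}^1M$ of the $\mathrm{Spin^c}$ structure. Then for any eigenvalue $\lambda$ of the Dirac operator $D$ and any eigenspinor $\psi\not\equiv 0$ with $D\psi=\lambda\psi$, $$\lambda^2\ \geqslant\ \inf_M\Big(\frac14 S_g-\frac{c_n}{4}|\Omega|_g+|\ell^\psi|^2+|q^\psi|^2\Big),$$ where $c_n=2[\frac n2]^{1/2}$ and the infimum is taken over the points of $M$ where $\psi\neq 0$.
   Context: $M$ is compact, connected, oriented, without boundary, of dimension $n\ge 2$. A $\mathrm{Spin^c}$ structure on $(M^n,g)$ is a $\mathrm{Spin}^c_n$-principal bundle $\mathrm{Spin^c}M$ and an $\mathbb S^1$-principal bundle $\mathbb S^1M$ over $M$ together with a double covering $\theta:\mathrm{Spin^c}M\to SOM\times_M\mathbb S^1M$ with $\theta(ua)=\theta(u)\xi(a)$ for all $u\in\mathrm{Spin^c}M$, $a\in\mathrm{Spin}^c_n$, where $SOM$ is the bundle of positively oriented orthonormal frames and $\xi:\mathrm{Spin}^c_n\to SO_n\times\mathbb S^1$ is the 2-fold covering. $\Sigma^cM$ is the associated complex spinor bundle (complex rank $2^{[n/2]}$), with Hermitian product $\langle\cdot,\cdot\rangle$ and Clifford multiplication $X\cdot\psi$, for which $X\cdot X\cdot\psi=-|X|^2\psi$ and $\langle X\cdot\psi,\varphi\rangle=-\langle\psi,X\cdot\varphi\rangle$.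 A connection 1-form $A:T(\mathbb S^1M)\to i\mathbb R$ on $\mathbb S^1M$ is fixed; its curvature is $F_A=dA=i\Omega$, with $\Omega$ regarded as a real 2-form on $M$ ($i\Omega$ is the curvature of the associated line bundle). With the Levi-Civita connection $\nabla^M$ it induces the covariant derivative $\nabla$ on $\Sigma^cM$: locally, for $\psi=[b,\sigma]$, $\nabla_{e_i}\psi=[b,\,e_i(\sigma)+\frac14\sum_j e_j\cdot\nabla^M_{e_i}e_j\cdot\sigma+\frac12A(s_*(e_i))\sigma]$, where $s$ is a local section of $\mathbb S^1M$. The Dirac operator is $D\psi=\sum_i e_i\cdot\nabla_{e_i}\psi$ for a local orthonormal frame $(e_i)$. $S_g$ is the scalar curvature of $g$, and $|\Omega|_g^2=\sum_{i<j}\Omega(e_i,e_j)^2$. For a spinor field $\phi$, on the complement of its zero set, $\ell^\phi$ is the symmetric endomorphism field with $g(\ell^\phi(X),Y)=\frac12\mathrm{Re}\langle X\cdot\nabla_Y\phi+Y\cdot\nabla_X\phi,\frac{\phi}{|\phi|^2}\rangle$, and $q^\phi$ is the skew-symmetric endomorphism field with $g(q^\phi(X),Y)=\frac12\mathrm{Re}\langle Y\cdot\nabla_X\phi-X\cdot\nabla_Y\phi,\frac{\phi}{|\phi|^2}\rangle$. The norms are $|E|^2=\sum_i g(E(e_i),E(e_i))$. *)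

theory Defs
  imports "HOL-Analysis.Analysis"
begin

section \<open>Smooth maps and smooth manifolds\<close>

primrec Ck_on :: "nat \<Rightarrow> 'a::euclidean_space set \<Rightarrow> ('a \<Rightarrow> 'b::real_normed_vector) \<Rightarrow> bool" where
  "Ck_on 0 = (\<lambda>S f. continuous_on S f)"
| "Ck_on (Suc k) = (\<lambda>S f. (\<forall>x\<in>S. f differentiable (at x)) \<and>
     (\<forall>v. Ck_on k S (\<lambda>x. frechet_derivative f (at x) v)))"

definition smooth_on :: "'a::euclidean_space set \<Rightarrow> ('a \<Rightarrow> 'b::real_normed_vector) \<Rightarrow> bool" where
  "smooth_on S f \<longleftrightarrow> open S \<and> (\<forall>k. Ck_on k S f)"

text \<open>A chart is its domain together with its coordinate map. Manifolds are types of class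
  \<open>{t2_space, second_countable_topology}\<close> with an atlas of charts into a Euclidean space.\<close>

type_synonym ('a, 'e) chart = "'a set \<times> ('a \<Rightarrow> 'e)"

abbreviation cdom :: "('a, 'e) chart \<Rightarrow> 'a set" where "cdom c \<equiv> fst c"
abbreviation cmap :: "('a, 'e) chart \<Rightarrow> 'a \<Rightarrow> 'e" where "cmap c \<equiv> snd c"

definition cinv :: "('a, 'e) chart \<Rightarrow> 'e \<Rightarrow> 'a" where
  "cinv c = inv_into (cdom c) (cmap c)"

definition smooth_atlas :: "('a::topological_space, 'e::euclidean_space) chart set \<Rightarrow> bool" where
  "smooth_atlas \<A> \<longleftrightarrow>
     (\<Union>c\<in>\<A>. cdom c) = UNIV \<and>
     (\<forall>c\<in>\<A>. open (cdom c) \<and> open (cmap c ` cdom c) \<and>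
        homeomorphism (cdom c) (cmap c ` cdom c) (cmap c) (cinv c)) \<and>
     (\<forall>c\<in>\<A>. \<forall>d\<in>\<A>. smooth_on (cmap c ` (cdom c \<inter> cdom d)) (cmap d \<circ> cinv c))"

definition smooth_map :: "('a::topological_space, 'e::euclidean_space) chart set \<Rightarrow>
    ('b::topological_space, 'f::euclidean_space) chart set \<Rightarrow> 'a set \<Rightarrow> ('a \<Rightarrow> 'b) \<Rightarrow> bool" where
  "smooth_map \<A> \<B> U f \<longleftrightarrow> open U \<and> continuous_on U f \<and>
     (\<forall>c\<in>\<A>. \<forall>d\<in>\<B>. smooth_on (cmap c ` (cdom c \<inter> U \<inter> f -` cdom d)) (cmap d \<circ> f \<circ> cinv c))"

definition smooth_fun :: "('a::topological_space, 'e::euclidean_space) chart set \<Rightarrow> 'a set \<Rightarrow>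
    ('a \<Rightarrow> 'v::real_normed_vector) \<Rightarrow> bool" where
  "smooth_fun \<A> U f \<longleftrightarrow> open U \<and> (\<forall>c\<in>\<A>. smooth_on (cmap c ` (cdom c \<inter> U)) (f \<circ> cinv c))"

definition chart_at :: "('a, 'e) chart set \<Rightarrow> 'a \<Rightarrow> ('a, 'e) chart" where
  "chart_at \<A> x = (SOME c. c \<in> \<A> \<and> x \<in> cdom c)"

section \<open>Tangent vectors and differential forms\<close>

text \<open>A tangent vector at \<open>x\<close> is the family of its coordinate vectors in all charts around \<open>x\<close>,
  which transform by the Jacobians of the coordinate changes; entries belonging to other
  charts are set to 0. The vector space operations are pointwise.\<close>

type_synonym ('a, 'e) tvec = "('a, 'e) chart \<Rightarrow> 'e"

definition chart_jac :: "('a, 'e::euclidean_space) chart \<Rightarrow> ('a, 'e) chart \<Rightarrow> 'a \<Rightarrow> 'e \<Rightarrow> 'e" where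
  "chart_jac c d x = frechet_derivative (cmap d \<circ> cinv c) (at (cmap c x))"

definition tangent_space :: "('a, 'e::euclidean_space) chart set \<Rightarrow> 'a \<Rightarrow> ('a, 'e) tvec set" where
  "tangent_space \<A> x = {v.
     (\<forall>c. \<not> (c \<in> \<A> \<and> x \<in> cdom c) \<longrightarrow> v c = 0) \<and>
     (\<forall>c\<in>\<A>. \<forall>d\<in>\<A>. x \<in> cdom c \<inter> cdom d \<longrightarrow> v d = chart_jac c d x (v c))}"

text \<open>The tangent vector at \<open>x\<close> with coordinate vector \<open>w\<close> in the chart \<open>c\<close>.\<close>

definition tvec_of :: "('a, 'e::euclidean_space) chart set \<Rightarrow> 'a \<Rightarrow> ('a, 'e) chart \<Rightarrow> 'e \<Rightarrow> ('a, 'e) tvec" where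
  "tvec_of \<A> x c w = (\<lambda>d. if d \<in> \<A> \<and> x \<in> cdom d then chart_jac c d x w else 0)"

definition dir_deriv :: "('a, 'e::euclidean_space) chart set \<Rightarrow> 'a \<Rightarrow> ('a, 'e) tvec \<Rightarrow>
    ('a \<Rightarrow> 'v::real_normed_vector) \<Rightarrow> 'v" where
  "dir_deriv \<A> x v f =
     (let c = chart_at \<A> x in frechet_derivative (f \<circ> cinv c) (at (cmap c x)) (v c))"

definition pushforward :: "('a, 'e::euclidean_space) chart set \<Rightarrow> ('b, 'f::euclidean_space) chart set \<Rightarrow>
    ('a \<Rightarrow> 'b) \<Rightarrow> 'a \<Rightarrow> ('a, 'e) tvec \<Rightarrow> ('b, 'f) tvec" where
  "pushforward \<A> \<B> f x v =
     (\<lambda>d. if d \<in> \<B> \<and> f x \<in> cdom d then dir_deriv \<A> x v (cmap d \<circ> f) else 0)"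

definition velocity :: "('b, 'f::euclidean_space) chart set \<Rightarrow> (real \<Rightarrow> 'b) \<Rightarrow> real \<Rightarrow> ('b, 'f) tvec" where
  "velocity \<B> \<gamma> t =
     (\<lambda>d. if d \<in> \<B> \<and> \<gamma> t \<in> cdom d then vector_derivative (cmap d \<circ> \<gamma>) (at t) else 0)"

text \<open>\<open>d\<alpha>(v,w) = V(\<alpha>(W)) - W(\<alpha>(V))\<close> for the extensions \<open>V\<close>, \<open>W\<close> of \<open>v\<close>, \<open>w\<close> that are constant in
  a chart (so that \<open>[V,W] = 0\<close>).\<close>

definition ext_deriv :: "('a, 'e::euclidean_space) chart set \<Rightarrow> ('a \<Rightarrow> ('a, 'e) tvec \<Rightarrow> complex) \<Rightarrow>
    'a \<Rightarrow> ('a, 'e) tvec \<Rightarrow> ('a, 'e) tvec \<Rightarrow> complex" where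
  "ext_deriv \<A> \<alpha> x v w =
     (let c = chart_at \<A> x;
          comp = (\<lambda>z y. \<alpha> y (tvec_of \<A> y c z))
      in dir_deriv \<A> x v (comp (w c)) - dir_deriv \<A> x w (comp (v c)))"

section \<open>Oriented Riemannian manifolds\<close>

type_synonym ('m, 'n) mchart = "('m, real^'n) chart"
type_synonym ('m, 'n) mtvec = "('m, real^'n) tvec"

definition oriented_atlas :: "('m::topological_space, 'n::finite) mchart set \<Rightarrow> bool" where
  "oriented_atlas \<A> \<longleftrightarrow> smooth_atlas \<A> \<and>
     (\<forall>c\<in>\<A>. \<forall>d\<in>\<A>. \<forall>x\<in>cdom c \<inter> cdom d. det (matrix (chart_jac c d x)) > 0)"

type_synonym 'n rmat = "real^'n^'n"
type_synonym ('m, 'n) metric_field = "'m \<Rightarrow> ('m, 'n) mtvec \<Rightarrow> ('m, 'n) mtvec \<Rightarrow> real"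

definition riemannian_metric :: "('m::topological_space, 'n::finite) mchart set \<Rightarrow> ('m, 'n) metric_field \<Rightarrow> bool" where
  "riemannian_metric \<A> g \<longleftrightarrow>
     (\<forall>x. \<forall>v\<in>tangent_space \<A> x. \<forall>w\<in>tangent_space \<A> x. \<forall>z\<in>tangent_space \<A> x. \<forall>a b.
        g x v w = g x w v \<and>
        g x (\<lambda>c. a *\<^sub>R v c + b *\<^sub>R w c) z = a * g x v z + b * g x w z \<and>
        (v \<noteq> (\<lambda>c. 0) \<longrightarrow> g x v v > 0)) \<and>
     (\<forall>c\<in>\<A>. \<forall>v w. smooth_fun \<A> (cdom c) (\<lambda>x. g x (tvec_of \<A> x c v) (tvec_of \<A> x c w)))"

text \<open>Positively oriented orthonormal frames at \<open>x\<close> (the fibre of \<open>SOM\<close>) and the right action of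
  \<open>SO\<^sub>n\<close> on them.\<close>

definition so_frames :: "('m::topological_space, 'n::finite) mchart set \<Rightarrow> ('m, 'n) metric_field \<Rightarrow> 'm \<Rightarrow>
    ('n \<Rightarrow> ('m, 'n) mtvec) set" where
  "so_frames \<A> g x = {e. (\<forall>i. e i \<in> tangent_space \<A> x) \<and>
     (\<forall>i j. g x (e i) (e j) = (if i = j then 1 else 0)) \<and>
     (\<forall>c\<in>\<A>. x \<in> cdom c \<longrightarrow> det (\<chi> i j. e j c $ i) > 0)}"

definition frame_act :: "('n::finite \<Rightarrow> ('m, 'n) mtvec) \<Rightarrow> 'n rmat \<Rightarrow> ('n \<Rightarrow> ('m, 'n) mtvec)" where
  "frame_act e R = (\<lambda>j c. \<Sum>i\<in>UNIV. (R $ i $ j) *\<^sub>R e i c)"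

definition onframe :: "('m::topological_space, 'n::finite) mchart set \<Rightarrow> ('m, 'n) metric_field \<Rightarrow> 'm \<Rightarrow>
    'n \<Rightarrow> ('m, 'n) mtvec" where
  "onframe \<A> g x = (SOME e. e \<in> so_frames \<A> g x)"

abbreviation partial_deriv :: "'n::finite \<Rightarrow> (real^'n \<Rightarrow> 'v::real_normed_vector) \<Rightarrow> real^'n \<Rightarrow> 'v" where
  "partial_deriv i f y \<equiv> frechet_derivative f (at y) (axis i 1)"

definition metric_coord :: "('m, 'n::finite) mchart set \<Rightarrow> ('m, 'n) metric_field \<Rightarrow> ('m, 'n) mchart \<Rightarrow>
    real^'n \<Rightarrow> 'n rmat" where
  "metric_coord \<A> g c y = (\<chi> i j.
     g (cinv c y) (tvec_of \<A> (cinv c y) c (axis i 1)) (tvec_of \<A> (cinv c y) c (axis j 1)))"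

text \<open>\<open>christoffel \<A> g c k i j y\<close> is \<open>\<Gamma>\<^sup>k\<^sub>i\<^sub>j\<close> at the point with coordinates \<open>y\<close> in the chart \<open>c\<close>.\<close>

definition christoffel :: "('m, 'n::finite) mchart set \<Rightarrow> ('m, 'n) metric_field \<Rightarrow> ('m, 'n) mchart \<Rightarrow>
    'n \<Rightarrow> 'n \<Rightarrow> 'n \<Rightarrow> real^'n \<Rightarrow> real" where
  "christoffel \<A> g c k i j y = (1/2) * (\<Sum>l\<in>UNIV. matrix_inv (metric_coord \<A> g c y) $ k $ l *
     (partial_deriv i (\<lambda>y. metric_coord \<A> g c y $ j $ l) y +
      partial_deriv j (\<lambda>y. metric_coord \<A> g c y $ i $ l) y -
      partial_deriv l (\<lambda>y. metric_coord \<A> g c y $ i $ j) y))"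

text \<open>The Levi-Civita derivative \<open>\<nabla>\<^sup>M\<^sub>v Y\<close> at \<open>x\<close> of a (locally defined) vector field \<open>Y\<close>.\<close>

definition levi_civita :: "('m, 'n::finite) mchart set \<Rightarrow> ('m, 'n) metric_field \<Rightarrow> 'm \<Rightarrow> ('m, 'n) mtvec \<Rightarrow>
    ('m \<Rightarrow> ('m, 'n) mtvec) \<Rightarrow> ('m, 'n) mtvec" where
  "levi_civita \<A> g x v Y = (\<lambda>c. if c \<in> \<A> \<and> x \<in> cdom c then
       frechet_derivative (\<lambda>y. Y (cinv c y) c) (at (cmap c x)) (v c) +
       (\<chi> k. \<Sum>i\<in>UNIV. \<Sum>j\<in>UNIV. christoffel \<A> g c k i j (cmap c x) * v c $ i * Y x c $ j)
     else 0)"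

text \<open>\<open>riemann_coord \<A> g c l i j k\<close> is the \<open>l\<close>-th coordinate of \<open>R(\<partial>\<^sub>i,\<partial>\<^sub>j)\<partial>\<^sub>k\<close>; the Ricci tensor is
  \<open>Ric(Y,Z) = tr (X \<mapsto> R(X,Y)Z)\<close>, so round spheres have positive scalar curvature.\<close>

definition riemann_coord :: "('m, 'n::finite) mchart set \<Rightarrow> ('m, 'n) metric_field \<Rightarrow> ('m, 'n) mchart \<Rightarrow>
    'n \<Rightarrow> 'n \<Rightarrow> 'n \<Rightarrow> 'n \<Rightarrow> real^'n \<Rightarrow> real" where
  "riemann_coord \<A> g c l i j k y =
     partial_deriv i (christoffel \<A> g c l j k) y - partial_deriv j (christoffel \<A> g c l i k) y +
     (\<Sum>m\<in>UNIV. christoffel \<A> g c l i m y * christoffel \<A> g c m j k y -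
                christoffel \<A> g c l j m y * christoffel \<A> g c m i k y)"

definition scalar_curvature :: "('m, 'n::finite) mchart set \<Rightarrow> ('m, 'n) metric_field \<Rightarrow> 'm \<Rightarrow> real" where
  "scalar_curvature \<A> g x =
     (let c = chart_at \<A> x; y = cmap c x in
      \<Sum>j\<in>UNIV. \<Sum>k\<in>UNIV. matrix_inv (metric_coord \<A> g c y) $ j $ k *
        (\<Sum>i\<in>UNIV. riemann_coord \<A> g c i i j k y))"

text \<open>\<open>|\<Omega>|\<^sub>g\<close>, with \<open>|\<Omega>|\<^sub>g\<^sup>2\<close> the sum of \<open>\<Omega>(e\<^sub>i,e\<^sub>j)\<^sup>2\<close> over \<open>i < j\<close>.\<close>

definition two_form_norm :: "('m::topological_space, 'n::{finite,linorder}) mchart set \<Rightarrow>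
    ('m, 'n) metric_field \<Rightarrow> ('m \<Rightarrow> ('m, 'n) mtvec \<Rightarrow> ('m, 'n) mtvec \<Rightarrow> real) \<Rightarrow> 'm \<Rightarrow> real" where
  "two_form_norm \<A> g \<Omega> x = (let e = onframe \<A> g x in
     sqrt (\<Sum>(i,j) | i < j. (\<Omega> x (e i) (e j))\<^sup>2))"

text \<open>The endomorphism \<open>E\<close> of the tangent space with \<open>g(E(X),Y) = B(X,Y)\<close>, and
  \<open>|E|\<^sup>2 = \<Sum>\<^sub>i g(E(e\<^sub>i),E(e\<^sub>i))\<close>.\<close>

definition endo_of :: "('m, 'n::finite) mchart set \<Rightarrow> ('m, 'n) metric_field \<Rightarrow> 'm \<Rightarrow>
    (('m, 'n) mtvec \<Rightarrow> ('m, 'n) mtvec \<Rightarrow> real) \<Rightarrow> ('m, 'n) mtvec \<Rightarrow> ('m, 'n) mtvec" where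
  "endo_of \<A> g x B X =
     (THE v. v \<in> tangent_space \<A> x \<and> (\<forall>Y\<in>tangent_space \<A> x. g x v Y = B X Y))"

definition endo_norm_sq :: "('m::topological_space, 'n::finite) mchart set \<Rightarrow> ('m, 'n) metric_field \<Rightarrow> 'm \<Rightarrow>
    (('m, 'n) mtvec \<Rightarrow> ('m, 'n) mtvec) \<Rightarrow> real" where
  "endo_norm_sq \<A> g x E = (let e = onframe \<A> g x in \<Sum>i\<in>UNIV. g x (E (e i)) (E (e i)))"

section \<open>The complex Clifford algebra, \<open>Spin\<^sup>c\<^sub>n\<close>, and the spinor representation\<close>

text \<open>The complex Clifford algebra of \<open>\<real>\<^sup>n\<close> (with \<open>v\<cdot>v = -|v|\<^sup>2\<close>) has the basis \<open>e\<^sub>A\<close>, the products of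
  the \<open>e\<^sub>i\<close>, \<open>i \<in> A\<close>, in increasing order. Multiplying \<open>e\<^sub>A\<close> and \<open>e\<^sub>B\<close> gives \<open>\<plusminus>e\<^sub>C\<close> with \<open>C\<close> the symmetric
  difference; the sign counts the transpositions needed for sorting and the squares \<open>e\<^sub>i\<^sup>2 = -1\<close>.
  The product of the type \<open>complex^('n set)\<close> itself is componentwise and is not used.\<close>

type_synonym 'n cliff = "complex ^ ('n set)"

definition cl_sign :: "'n::linorder set \<Rightarrow> 'n set \<Rightarrow> complex" where
  "cl_sign A B = (-1) ^ (card {(i,j). i \<in> A \<and> j \<in> B \<and> j < i} + card (A \<inter> B))"

definition cl_mult :: "'n::{finite,linorder} cliff \<Rightarrow> 'n cliff \<Rightarrow> 'n cliff" where
  "cl_mult a b = (\<chi> C. \<Sum>A\<in>UNIV. \<Sum>B\<in>UNIV.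
     if (A - B) \<union> (B - A) = C then cl_sign A B * a $ A * b $ B else 0)"

definition cl_one :: "'n::{finite,linorder} cliff" where
  "cl_one = axis {} 1"

definition cl_vec :: "real^'n::{finite,linorder} \<Rightarrow> 'n cliff" where
  "cl_vec v = (\<Sum>i\<in>UNIV. axis {i} (complex_of_real (v $ i)))"

text \<open>\<open>Spin\<^sub>n\<close> consists of the products of an even number of unit vectors, and
  \<open>Spin\<^sup>c\<^sub>n = {z a | z \<in> S\<^sup>1, a \<in> Spin\<^sub>n}\<close>.\<close>

inductive_set spin_group :: "'n::{finite,linorder} cliff set" where
  spin_one: "cl_one \<in> spin_group"
| spin_step: "a \<in> spin_group \<Longrightarrow> norm v = 1 \<Longrightarrow> norm w = 1 \<Longrightarrow>
     cl_mult a (cl_mult (cl_vec v) (cl_vec w)) \<in> spin_group"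

definition spinc_group :: "'n::{finite,linorder} cliff set" where
  "spinc_group = {z *s a | z a. z \<in> sphere 0 1 \<and> a \<in> spin_group}"

text \<open>The 2-fold covering \<open>\<xi>(z a) = (Ad(a), z\<^sup>2)\<close> of \<open>SO\<^sub>n \<times> S\<^sup>1\<close>, where \<open>Ad(a)v = a v a\<inverse>\<close>.\<close>

definition spinc_xi :: "'n::{finite,linorder} cliff \<Rightarrow> 'n rmat \<times> complex" where
  "spinc_xi a = (THE p. \<exists>z\<in>sphere 0 1. \<exists>h\<in>spin_group. a = z *s h \<and>
     (\<forall>v. cl_mult a (cl_vec v) = cl_mult (cl_vec (fst p *v v)) a) \<and> snd p = z\<^sup>2)"

text \<open>A unital representation of the complex Clifford algebra of dimension \<open>2\<^bsup>[n/2]\<^esup>\<close> is irreducible, as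
  every non-zero module has at least this dimension. For odd \<open>n\<close> there are two inequivalent ones,
  and \<open>rho\<close> may be either. The Hermitian product is the standard one, and vectors are to act
  skew-Hermitian.\<close>

definition spinor_rep :: "('n::{finite,linorder} cliff \<Rightarrow> complex^'k^'k) \<Rightarrow> bool" where
  "spinor_rep rho \<longleftrightarrow> CARD('k) = 2 ^ (CARD('n) div 2) \<and>
     (\<forall>a b. rho (a + b) = rho a + rho b) \<and>
     (\<forall>z a. rho (z *s a) = (\<chi> i j. z * rho a $ i $ j)) \<and>
     (\<forall>a b. rho (cl_mult a b) = rho a ** rho b) \<and>
     rho cl_one = mat 1 \<and>
     (\<forall>v i j. rho (cl_vec v) $ i $ j = - cnj (rho (cl_vec v) $ j $ i))"

section \<open>Principal bundles and connection forms\<close>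

definition local_section :: "('m::topological_space, 'd::euclidean_space) chart set \<Rightarrow>
    ('p::topological_space, 'e::euclidean_space) chart set \<Rightarrow> ('p \<Rightarrow> 'm) \<Rightarrow> 'm set \<Rightarrow> ('m \<Rightarrow> 'p) \<Rightarrow> bool" where
  "local_section \<A> \<P> proj U b \<longleftrightarrow> smooth_map \<A> \<P> U b \<and> (\<forall>x\<in>U. proj (b x) = x)"

text \<open>The structure groups are submanifolds \<open>G\<close> of a Euclidean space. Smoothness of maps out of
  \<open>P \<times> G\<close> means that they are locally restrictions of smooth maps.\<close>

definition smooth_action :: "('p::topological_space, 'e::euclidean_space) chart set \<Rightarrow>
    'g::euclidean_space set \<Rightarrow> ('p \<Rightarrow> 'g \<Rightarrow> 'p) \<Rightarrow> bool" where
  "smooth_action \<P> G act \<longleftrightarrow>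
     (\<forall>c\<in>\<P>. \<forall>d\<in>\<P>. \<forall>u\<in>cdom c. \<forall>a\<in>G. act u a \<in> cdom d \<longrightarrow>
        (\<exists>W F. (cmap c u, a) \<in> W \<and> smooth_on W F \<and>
           (\<forall>u'\<in>cdom c. \<forall>a'\<in>G. (cmap c u', a') \<in> W \<longrightarrow>
              act u' a' \<in> cdom d \<and> cmap d (act u' a') = F (cmap c u', a'))))"

text \<open>In the local triviality clause, \<open>u \<mapsto> (proj u, \<tau> u)\<close> is the inverse of the
  diffeomorphism \<open>(x, a) \<mapsto> act (b x) a\<close> from \<open>U \<times> G\<close> to the part of the bundle over \<open>U\<close>.\<close>

definition principal_bundle :: "('m::topological_space, 'd::euclidean_space) chart set \<Rightarrow>
    ('p::topological_space, 'e::euclidean_space) chart set \<Rightarrow> ('p \<Rightarrow> 'm) \<Rightarrow>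
    'g::euclidean_space set \<Rightarrow> ('g \<Rightarrow> 'g \<Rightarrow> 'g) \<Rightarrow> 'g \<Rightarrow> ('p \<Rightarrow> 'g \<Rightarrow> 'p) \<Rightarrow> bool" where
  "principal_bundle \<A> \<P> proj G mul one act \<longleftrightarrow>
     smooth_atlas \<P> \<and> smooth_map \<P> \<A> UNIV proj \<and>
     (\<forall>u. act u one = u) \<and>
     (\<forall>u. \<forall>a\<in>G. \<forall>a'\<in>G. act u (mul a a') = act (act u a) a') \<and>
     (\<forall>u u'. proj u = proj u' \<longleftrightarrow> (\<exists>a\<in>G. u' = act u a)) \<and>
     (\<forall>u. \<forall>a\<in>G. \<forall>a'\<in>G. act u a = act u a' \<longrightarrow> a = a') \<and>
     smooth_action \<P> G act \<and>
     (\<forall>x. \<exists>U b \<tau>. x \<in> U \<and> local_section \<A> \<P> proj U b \<and>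
        smooth_fun \<P> (proj -` U) \<tau> \<and>
        (\<forall>u\<in>proj -` U. \<tau> u \<in> G \<and> u = act (b (proj u)) (\<tau> u)))"

text \<open>Connection forms on an \<open>S\<^sup>1\<close>-bundle. As \<open>S\<^sup>1\<close> is abelian, equivariance is invariance; the last
  clause normalises \<open>\<alpha>\<close> on the fundamental vector field of \<open>\<i> \<in> \<i>\<real>\<close>.\<close>

definition connection_form :: "('q::topological_space, 'f::euclidean_space) chart set \<Rightarrow>
    ('q \<Rightarrow> complex \<Rightarrow> 'q) \<Rightarrow> ('q \<Rightarrow> ('q, 'f) tvec \<Rightarrow> complex) \<Rightarrow> bool" where
  "connection_form \<Q> act \<alpha> \<longleftrightarrow>
     (\<forall>u. \<forall>v\<in>tangent_space \<Q> u. \<forall>w\<in>tangent_space \<Q> u. \<forall>a b.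
        \<alpha> u (\<lambda>c. a *\<^sub>R v c + b *\<^sub>R w c) = a *\<^sub>R \<alpha> u v + b *\<^sub>R \<alpha> u w) \<and>
     (\<forall>u. \<forall>v\<in>tangent_space \<Q> u. Re (\<alpha> u v) = 0) \<and>
     (\<forall>c\<in>\<Q>. \<forall>w. smooth_fun \<Q> (cdom c) (\<lambda>u. \<alpha> u (tvec_of \<Q> u c w))) \<and>
     (\<forall>u. \<forall>v\<in>tangent_space \<Q> u. \<forall>z\<in>sphere 0 1.
        \<alpha> (act u z) (pushforward \<Q> \<Q> (\<lambda>u. act u z) u v) = \<alpha> u v) \<and>
     (\<forall>u. \<alpha> u (velocity \<Q> (\<lambda>t. act u (cis t)) 0) = \<i>)"

section \<open>Riemannian \<open>Spin\<^sup>c\<close> manifolds\<close>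

text \<open>Throughout, \<open>'m\<close> is the manifold \<open>M\<close>, \<open>'n\<close> the index type of its dimension, \<open>'p\<close> and \<open>'q\<close> the
  total spaces of the \<open>Spin\<^sup>c\<^sub>n\<close>-bundle and the \<open>S\<^sup>1\<close>-bundle with charts in \<open>'e\<close> and \<open>'f\<close>, and \<open>'k\<close> the
  index type of spinor components. The first component of \<open>theta u\<close> is a frame at
  \<open>P_proj u\<close>, so that \<open>theta\<close> takes values in \<open>SOM \<times>\<^sub>M S\<^sup>1M\<close>.\<close>

record ('m, 'n, 'p, 'e, 'q, 'f, 'k) spinc =
  atlas :: "('m, 'n::{finite,linorder}) mchart set"
  gmetric :: "('m, 'n) metric_field"
  P_atlas :: "('p, 'e::euclidean_space) chart set"
  P_proj :: "'p \<Rightarrow> 'm"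
  P_act :: "'p \<Rightarrow> 'n cliff \<Rightarrow> 'p"
  Q_atlas :: "('q, 'f::euclidean_space) chart set"
  Q_proj :: "'q \<Rightarrow> 'm"
  Q_act :: "'q \<Rightarrow> complex \<Rightarrow> 'q"
  theta :: "'p \<Rightarrow> ('n \<Rightarrow> ('m, 'n) mtvec) \<times> 'q"
  conn :: "'q \<Rightarrow> ('q, 'f) tvec \<Rightarrow> complex"
  rep :: "'n cliff \<Rightarrow> complex^('k::finite)^'k"

type_synonym ('p, 'k) spinor = "'p \<Rightarrow> complex^'k"

definition spinc_structure ::
  "('m::topological_space, 'n::{finite,linorder}, 'p::topological_space, 'e::euclidean_space,
    'q::topological_space, 'f::euclidean_space, 'k::finite) spinc \<Rightarrow> bool" where
  "spinc_structure S \<longleftrightarrow>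
     principal_bundle (atlas S) (P_atlas S) (P_proj S) spinc_group cl_mult cl_one (P_act S) \<and>
     principal_bundle (atlas S) (Q_atlas S) (Q_proj S) (sphere 0 1) (*) 1 (Q_act S) \<and>
     (\<forall>u. fst (theta S u) \<in> so_frames (atlas S) (gmetric S) (P_proj S u) \<and>
          Q_proj S (snd (theta S u)) = P_proj S u) \<and>
     (\<forall>u. \<forall>a\<in>spinc_group. theta S (P_act S u a) =
        (frame_act (fst (theta S u)) (fst (spinc_xi a)), Q_act S (snd (theta S u)) (snd (spinc_xi a)))) \<and>
     (\<forall>c\<in>atlas S. \<forall>i. smooth_fun (P_atlas S) (P_proj S -` cdom c) (\<lambda>u. fst (theta S u) i c)) \<and>
     smooth_map (P_atlas S) (Q_atlas S) UNIV (\<lambda>u. snd (theta S u)) \<and>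
     (\<forall>q. \<forall>e\<in>so_frames (atlas S) (gmetric S) (Q_proj S q). card {u. theta S u = (e, q)} = 2)"

definition riemannian_spinc_manifold ::
  "('m::{t2_space,second_countable_topology}, 'n::{finite,linorder},
    'p::{t2_space,second_countable_topology}, 'e::euclidean_space,
    'q::{t2_space,second_countable_topology}, 'f::euclidean_space, 'k::finite) spinc \<Rightarrow> bool" where
  "riemannian_spinc_manifold S \<longleftrightarrow>
     oriented_atlas (atlas S) \<and> riemannian_metric (atlas S) (gmetric S) \<and>
     spinc_structure S \<and> connection_form (Q_atlas S) (Q_act S) (conn S) \<and> spinor_rep (rep S)"

text \<open>\<open>dA = \<i>\<Omega>\<close>, where \<open>\<Omega>\<close> is a real 2-form on \<open>M\<close>, pulled back to the total space of the \<open>S\<^sup>1\<close>-bundle.\<close>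

definition curvature_form ::
  "('m, 'n::{finite,linorder}, 'p, 'e::euclidean_space, 'q, 'f::euclidean_space, 'k::finite) spinc \<Rightarrow>
    ('m \<Rightarrow> ('m, 'n) mtvec \<Rightarrow> ('m, 'n) mtvec \<Rightarrow> real) \<Rightarrow> bool" where
  "curvature_form S \<Omega> \<longleftrightarrow>
     (\<forall>u. \<forall>v\<in>tangent_space (Q_atlas S) u. \<forall>w\<in>tangent_space (Q_atlas S) u.
        ext_deriv (Q_atlas S) (conn S) u v w = \<i> * complex_of_real (\<Omega> (Q_proj S u)
          (pushforward (Q_atlas S) (atlas S) (Q_proj S) u v)
          (pushforward (Q_atlas S) (atlas S) (Q_proj S) u w)))"

text \<open>The element \<open>[u,\<sigma>] = {(ua, \<rho>(a)\<inverse>\<sigma>) | a}\<close> of the associated bundle is the graph of a function on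
  the fibre of the \<open>Spin\<^sup>c\<^sub>n\<close>-bundle. A spinor at \<open>x\<close> is this function, extended by 0 to the whole
  bundle: \<open>\<Phi> = [u, \<Phi> u]\<close> for all \<open>u\<close> over \<open>x\<close>, and a spinor field is locally
  \<open>\<psi> = [b,\<sigma>]\<close> with \<open>\<sigma> x = \<psi> x (b x)\<close>. The vector space operations are pointwise.\<close>

definition spinor_fibre ::
  "('m, 'n::{finite,linorder}, 'p, 'e::euclidean_space, 'q, 'f::euclidean_space, 'k::finite) spinc \<Rightarrow>
    'm \<Rightarrow> ('p, 'k) spinor set" where
  "spinor_fibre S x = {\<Phi>. (\<forall>u. P_proj S u \<noteq> x \<longrightarrow> \<Phi> u = 0) \<and>
     (\<forall>u. P_proj S u = x \<longrightarrow> (\<forall>a\<in>spinc_group. rep S a *v \<Phi> (P_act S u a) = \<Phi> u))}"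

definition spinor_field ::
  "('m::topological_space, 'n::{finite,linorder}, 'p::topological_space, 'e::euclidean_space,
    'q, 'f::euclidean_space, 'k::finite) spinc \<Rightarrow> ('m \<Rightarrow> ('p, 'k) spinor) \<Rightarrow> bool" where
  "spinor_field S \<psi> \<longleftrightarrow> (\<forall>x. \<psi> x \<in> spinor_fibre S x) \<and>
     (\<forall>U b. local_section (atlas S) (P_atlas S) (P_proj S) U b \<longrightarrow>
        smooth_fun (atlas S) U (\<lambda>x. \<psi> x (b x)))"

definition herm ::
  "('m, 'n::{finite,linorder}, 'p, 'e::euclidean_space, 'q, 'f::euclidean_space, 'k::finite) spinc \<Rightarrow>
    'm \<Rightarrow> ('p, 'k) spinor \<Rightarrow> ('p, 'k) spinor \<Rightarrow> complex" where
  "herm S x \<Phi> \<Psi> = (let u = (SOME u. P_proj S u = x) in \<Sum>k\<in>UNIV. \<Phi> u $ k * cnj (\<Psi> u $ k))"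

text \<open>\<open>X \<cdot> [u,\<sigma>] = [u, \<rho>(\<xi>)\<sigma>]\<close>, with \<open>\<xi> \<in> \<real>\<^sup>n\<close> the components of \<open>X\<close> in the frame belonging to \<open>u\<close>.\<close>

definition cliff_act ::
  "('m, 'n::{finite,linorder}, 'p, 'e::euclidean_space, 'q, 'f::euclidean_space, 'k::finite) spinc \<Rightarrow>
    'm \<Rightarrow> ('m, 'n) mtvec \<Rightarrow> ('p, 'k) spinor \<Rightarrow> ('p, 'k) spinor" where
  "cliff_act S x X \<Phi> = (\<lambda>u. rep S (cl_vec (\<chi> i. gmetric S x X (fst (theta S u) i))) *v \<Phi> u)"

text \<open>\<open>nabla\<close> (with \<open>nabla \<psi> x v\<close> for \<open>\<nabla>\<^sub>v\<psi>\<close> at \<open>x\<close>) is the covariant derivative on the spinor bundle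
  induced by the Levi-Civita connection and \<open>A\<close>: it is given by the local formula with
  respect to every smooth local section \<open>b\<close> of the \<open>Spin\<^sup>c\<^sub>n\<close>-bundle, \<open>e\<close> and \<open>s\<close> being the
  orthonormal frame and the section of the \<open>S\<^sup>1\<close>-bundle belonging to \<open>b\<close>. This determines
  \<open>\<nabla>\<psi>\<close> uniquely.\<close>

definition spinor_connection ::
  "('m::topological_space, 'n::{finite,linorder}, 'p::topological_space, 'e::euclidean_space,
    'q, 'f::euclidean_space, 'k::finite) spinc \<Rightarrow>
    (('m \<Rightarrow> ('p, 'k) spinor) \<Rightarrow> 'm \<Rightarrow> ('m, 'n) mtvec \<Rightarrow> ('p, 'k) spinor) \<Rightarrow> bool" where
  "spinor_connection S nabla \<longleftrightarrow>
     (\<forall>\<psi>. spinor_field S \<psi> \<longrightarrow> (\<forall>x. \<forall>v\<in>tangent_space (atlas S) x.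
        nabla \<psi> x v \<in> spinor_fibre S x \<and>
        (\<forall>U b. local_section (atlas S) (P_atlas S) (P_proj S) U b \<and> x \<in> U \<longrightarrow>
           (let e = (\<lambda>j y. fst (theta S (b y)) j);
                s = (\<lambda>y. snd (theta S (b y)));
                \<sigma> = (\<lambda>y. \<psi> y (b y))
            in nabla \<psi> x v (b x) =
                 dir_deriv (atlas S) x v \<sigma> +
                 (1/4) *\<^sub>R (\<Sum>j\<in>UNIV. cliff_act S x (e j x)
                     (cliff_act S x (levi_civita (atlas S) (gmetric S) x v (e j)) (\<psi> x)) (b x)) +
                 (1/2 * conn S (s x) (pushforward (atlas S) (Q_atlas S) s x v)) *s \<sigma> x))))"

definition dirac ::
  "('m::topological_space, 'n::{finite,linorder}, 'p, 'e::euclidean_space,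
    'q, 'f::euclidean_space, 'k::finite) spinc \<Rightarrow>
    (('m \<Rightarrow> ('p, 'k) spinor) \<Rightarrow> 'm \<Rightarrow> ('m, 'n) mtvec \<Rightarrow> ('p, 'k) spinor) \<Rightarrow>
    ('m \<Rightarrow> ('p, 'k) spinor) \<Rightarrow> 'm \<Rightarrow> ('p, 'k) spinor" where
  "dirac S nabla \<psi> x = (let e = onframe (atlas S) (gmetric S) x in
     (\<lambda>u. \<Sum>i\<in>UNIV. cliff_act S x (e i) (nabla \<psi> x (e i)) u))"

definition ell_endo ::
  "('m, 'n::{finite,linorder}, 'p, 'e::euclidean_space, 'q, 'f::euclidean_space, 'k::finite) spinc \<Rightarrow>
    (('m \<Rightarrow> ('p, 'k) spinor) \<Rightarrow> 'm \<Rightarrow> ('m, 'n) mtvec \<Rightarrow> ('p, 'k) spinor) \<Rightarrow>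
    ('m \<Rightarrow> ('p, 'k) spinor) \<Rightarrow> 'm \<Rightarrow> ('m, 'n) mtvec \<Rightarrow> ('m, 'n) mtvec" where
  "ell_endo S nabla \<phi> x = endo_of (atlas S) (gmetric S) x (\<lambda>X Y. 1/2 * Re (herm S x
     (\<lambda>u. cliff_act S x X (nabla \<phi> x Y) u + cliff_act S x Y (nabla \<phi> x X) u)
     (\<lambda>u. (1 / Re (herm S x (\<phi> x) (\<phi> x))) *\<^sub>R \<phi> x u)))"

definition q_endo ::
  "('m, 'n::{finite,linorder}, 'p, 'e::euclidean_space, 'q, 'f::euclidean_space, 'k::finite) spinc \<Rightarrow>
    (('m \<Rightarrow> ('p, 'k) spinor) \<Rightarrow> 'm \<Rightarrow> ('m, 'n) mtvec \<Rightarrow> ('p, 'k) spinor) \<Rightarrow>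
    ('m \<Rightarrow> ('p, 'k) spinor) \<Rightarrow> 'm \<Rightarrow> ('m, 'n) mtvec \<Rightarrow> ('m, 'n) mtvec" where
  "q_endo S nabla \<phi> x = endo_of (atlas S) (gmetric S) x (\<lambda>X Y. 1/2 * Re (herm S x
     (\<lambda>u. cliff_act S x Y (nabla \<phi> x X) u - cliff_act S x X (nabla \<phi> x Y) u)
     (\<lambda>u. (1 / Re (herm S x (\<phi> x) (\<phi> x))) *\<^sub>R \<phi> x u)))"

end

theory Submission
  imports Defs
begin

text \<open>No integration is needed: the estimate holds at a point \<open>x\<close> where \<open>|\<psi>|\<close> is maximal. There the
  Hessian of \<open>|\<psi>|\<^sup>2\<close> is nonpositive, so \<open>Re \<langle>\<nabla>\<^sup>*\<nabla>\<psi>, \<psi>\<rangle> \<ge> |\<nabla>\<psi>|\<^sup>2\<close>, and the Schroedinger-Lichnerowicz formula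
  \<open>D\<^sup>2 = \<nabla>\<^sup>*\<nabla> + S/4 + (\<i>/2) \<Omega>\<close> gives \<open>\<lambda>\<^sup>2 |\<psi>|\<^sup>2 \<ge> |\<nabla>\<psi>|\<^sup>2 + S/4 |\<psi>|\<^sup>2 + Re \<langle>(\<i>/2) \<Omega> \<cdot> \<psi>, \<psi>\<rangle>\<close>. The spinors
  \<open>e\<^sub>i \<cdot> \<psi> / |\<psi>|\<close> are orthonormal for the real inner product, so Bessel's inequality bounds \<open>|\<nabla>\<psi>|\<^sup>2\<close> below by
  \<open>(|\<ell>|\<^sup>2 + |q|\<^sup>2) |\<psi>|\<^sup>2\<close>: \<open>\<ell>\<close> and \<open>q\<close> are the symmetric and skew parts of one bilinear form. Bessel also shows that
  the skew matrix \<open>Re \<langle>\<i> e\<^sub>i \<cdot> e\<^sub>j \<cdot> \<psi>, \<psi>\<rangle> / |\<psi>|\<^sup>2\<close> has operator norm at most 1; as its rank is even, its squared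
  Hilbert-Schmidt norm is at most \<open>2 [n/2]\<close>, which bounds the \<open>\<Omega>\<close> term by Cauchy-Schwarz.\<close>

section \<open>Calculus of smooth maps\<close>

text \<open>The real part of the Hermitian product is the right product for Bessel's inequality: for
  the complex product the spinors e_i \<psi> are in general not orthogonal. For n = 2, say, e_1 e_2
  has the eigenvalues \<i> and -\<i>, so the product of e_1 \<psi> and e_2 \<psi> is imaginary and
  non-zero on eigenvectors. Hence spinor space is treated as a real Euclidean space with an operator
  \<open>J\<close> for multiplication by \<i>. The frame is whatever a local section of the bundle
  provides; its connection forms cancel because Clifford multiplication is parallel. The quantities
  in the statement are defined through choices (a chart, a frame, a point of the fibre) unrelated to
  that section. Frame sums are shown to be independent of the frame, the charts are taken to be the
  chosen ones, and the section is made to pass through the chosen point of the fibre. Origin of c_n: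
  the curvature term is 1/4 of the sum over all i, j of \<Omega>_ij B_ij. The squares of \<Omega>_ij
  sum to 2 |\<Omega>|^2 and those of B_ij to at most 2 [n/2] |\<psi>|^4, so the term is at most 1/4
  * 2 [n/2]^(1/2) |\<Omega>| |\<psi>|^2 in absolute value.\<close>

abbreviation fderiv :: "('a::euclidean_space \<Rightarrow> 'b::real_normed_vector) \<Rightarrow> 'a \<Rightarrow> 'a \<Rightarrow> 'b" where
  "fderiv f y \<equiv> frechet_derivative f (at y)"

lemma fderiv_works: "f differentiable (at y) \<Longrightarrow> (f has_derivative fderiv f y) (at y)"
  using frechet_derivative_works by blast

lemma fderiv_eq: "(f has_derivative f') (at y) \<Longrightarrow> fderiv f y = f'"
  using frechet_derivative_at by metis

lemma fderiv_cong_open: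
  assumes "open S" "y \<in> S" "\<And>x. x \<in> S \<Longrightarrow> f x = g x"
  shows "fderiv f y = fderiv g y"
proof -
  \<comment> \<open>The two predicates agree, not only their witnesses. As
    \<open>frechet_derivative\<close> is a choice from this predicate, the derivatives coincide even
    at points where neither function is differentiable.\<close>
  have "(f has_derivative f') (at y) = (g has_derivative f') (at y)" for f'
    using assms has_derivative_transform_within_open[of f f' y UNIV S g]
      has_derivative_transform_within_open[of g f' y UNIV S f] by auto
  then show ?thesis unfolding frechet_derivative_def by simp
qed

lemma differentiable_cong_open:
  assumes "open S" "y \<in> S" "\<And>x. x \<in> S \<Longrightarrow> f x = g x" "f differentiable (at y)"
  shows "g differentiable (at y)"
  using assms has_derivative_transform_within_open[of f _ y UNIV S g] unfolding differentiable_def by blast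

lemma Ck_on_cong:
  assumes "open S" "\<And>x. x \<in> S \<Longrightarrow> f x = g x"
  shows "Ck_on k S f = Ck_on k S g"
  using assms(2)
proof (induction k arbitrary: f g)
  case 0
  then show ?case using continuous_on_cong[of S S f g] by simp
next
  case (Suc k)
  have 1: "f differentiable (at x) \<longleftrightarrow> g differentiable (at x)" if "x \<in> S" for x
    using differentiable_cong_open[OF assms(1) that, of f g] differentiable_cong_open[OF assms(1) that, of g f]
      Suc.prems by auto
  have "Ck_on k S (\<lambda>x. fderiv f x v) = Ck_on k S (\<lambda>x. fderiv g x v)" for v
    by (rule Suc.IH) (metis Suc.prems assms(1) fderiv_cong_open)
  with 1 show ?case by simp
qed

lemma Ck_on_subset: "Ck_on k S f \<Longrightarrow> T \<subseteq> S \<Longrightarrow> Ck_on k T f"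
proof (induction k arbitrary: f)
  case 0 then show ?case using continuous_on_subset by auto
next
  case (Suc k) then show ?case by auto
qed

lemma Ck_on_Suc_imp: "Ck_on (Suc k) S f \<Longrightarrow> Ck_on k S f"
proof (induction k arbitrary: f)
  case 0
  then have "f differentiable_on S" by (simp add: differentiable_on_def differentiable_at_withinI)
  then show ?case by (simp add: differentiable_imp_continuous_on)
next
  case (Suc k)
  have "\<And>v. Ck_on (Suc k) S (\<lambda>x. fderiv f x v)" using Suc.prems by simp
  then have "\<And>v. Ck_on k S (\<lambda>x. fderiv f x v)" using Suc.IH by blast
  then show ?case using Suc.prems by simp
qed

lemma Ck_on_local:
  assumes "\<And>x. x \<in> S \<Longrightarrow> \<exists>T. open T \<and> x \<in> T \<and> Ck_on k T f"
  shows "Ck_on k S f"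
  using assms
proof (induction k arbitrary: f)
  case 0
  show ?case
  proof (simp add: continuous_on_def, intro ballI)
    fix x assume "x \<in> S"
    then obtain T where "open T" "x \<in> T" "continuous_on T f" using 0 by force
    then show "(f \<longlongrightarrow> f x) (at x within S)"
      by (meson at_le continuous_on_eq_continuous_at isContD subset_UNIV tendsto_mono)
  qed
next
  case (Suc k)
  have "f differentiable (at x)" if "x \<in> S" for x using Suc.prems[OF that] by auto
  moreover have "Ck_on k S (\<lambda>x. fderiv f x v)" for v
    by (rule Suc.IH) (use Suc.prems in fastforce)
  ultimately show ?case by simp
qed

lemma Ck_on_const: "Ck_on k S (\<lambda>x. c)"
proof (induction k arbitrary: c)
  case (Suc k)
  then show ?case by simp
qed simp

lemma Ck_on_linear:
  assumes L: "bounded_linear L" and f: "Ck_on k S f" and S: "open S"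
  shows "Ck_on k S (\<lambda>x. L (f x))"
  using f
proof (induction k arbitrary: f)
  case 0 then show ?case using L by (auto intro: bounded_linear.continuous_on)
next
  case (Suc k)
  have d: "((\<lambda>x. L (f x)) has_derivative (\<lambda>v. L (fderiv f x v))) (at x)" if "x \<in> S" for x
    using Suc.prems that by (intro bounded_linear.has_derivative[OF L] fderiv_works) auto
  have "Ck_on k S (\<lambda>x. fderiv (\<lambda>x. L (f x)) x v)" for v
    using Suc by (subst Ck_on_cong[OF S, of _ "\<lambda>x. L (fderiv f x v)"]) (auto simp: fderiv_eq[OF d])
  then show ?case using d by (auto simp: differentiable_def)
qed

lemma Ck_on_add:
  assumes "Ck_on k S f" "Ck_on k S g" and S: "open S"
  shows "Ck_on k S (\<lambda>x. f x + g x)"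
  using assms(1,2)
proof (induction k arbitrary: f g)
  case 0 then show ?case by (auto intro: continuous_intros)
next
  case (Suc k)
  have d: "((\<lambda>x. f x + g x) has_derivative (\<lambda>v. fderiv f x v + fderiv g x v)) (at x)" if "x \<in> S" for x
    using Suc.prems that by (intro has_derivative_add fderiv_works) auto
  have "Ck_on k S (\<lambda>x. fderiv (\<lambda>x. f x + g x) x v)" for v
    using Suc by (subst Ck_on_cong[OF S, of _ "\<lambda>x. fderiv f x v + fderiv g x v"]) (auto simp: fderiv_eq[OF d])
  then show ?case using d by (auto simp: differentiable_def)
qed

lemma Ck_on_bilinear:
  assumes B: "bounded_bilinear B" and "Ck_on k S f" "Ck_on k S g" and S: "open S"
  shows "Ck_on k S (\<lambda>x. B (f x) (g x))"
  using assms(2,3)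
proof (induction k arbitrary: f g)
  case 0 then show ?case using B by (auto intro: bounded_bilinear.continuous_on)
next
  case (Suc k)
  have d: "((\<lambda>x. B (f x) (g x)) has_derivative (\<lambda>v. B (f x) (fderiv g x v) + B (fderiv f x v) (g x))) (at x)"
    if "x \<in> S" for x
    using Suc.prems that by (intro bounded_bilinear.FDERIV[OF B] fderiv_works) auto
  \<comment> \<open>The product rule puts an undifferentiated factor next to each derivative, so the
    regularity of \<open>f\<close> and \<open>g\<close> has to be lowered by one before the
    induction hypothesis applies.\<close>
  have "Ck_on k S (\<lambda>x. B (f x) (fderiv g x v) + B (fderiv f x v) (g x))" for v
    using Suc.prems Ck_on_Suc_imp[OF Suc.prems(1)] Ck_on_Suc_imp[OF Suc.prems(2)]
    by (intro Ck_on_add Suc.IH S) auto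
  then have "Ck_on k S (\<lambda>x. fderiv (\<lambda>x. B (f x) (g x)) x v)" for v
    using Suc by (subst Ck_on_cong[OF S, of _ "\<lambda>x. B (f x) (fderiv g x v) + B (fderiv f x v) (g x)"])
      (auto simp: fderiv_eq[OF d])
  then show ?case using d by (auto simp: differentiable_def)
qed

lemma Ck_on_sum:
  assumes "\<And>i. i \<in> I \<Longrightarrow> Ck_on k S (f i)" and S: "open S"
  shows "Ck_on k S (\<lambda>x. \<Sum>i\<in>I. f i x)"
  using assms(1)
proof (induction I rule: infinite_finite_induct)
  case (insert i I)
  then show ?case by (simp add: Ck_on_add S)
qed (simp_all add: Ck_on_const)

lemma linear_expand_Basis:
  assumes "linear L"
  shows "L (v::'a::euclidean_space) = (\<Sum>b\<in>Basis. (v \<bullet> b) *\<^sub>R L b)"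
proof -
  have "L v = L (\<Sum>b\<in>Basis. (v \<bullet> b) *\<^sub>R b)" by (simp add: euclidean_representation)
  then show ?thesis using assms by (simp add: linear_sum linear_cmul)
qed

lemma Ck_on_compose:
  fixes f :: "'a::euclidean_space \<Rightarrow> 'b::euclidean_space"
  assumes "Ck_on k S f" "Ck_on k T g" and S: "open S" and sub: "f ` S \<subseteq> T"
  shows "Ck_on k S (\<lambda>x. g (f x))"
  using assms(1,2)
proof (induction k arbitrary: g)
  case 0
  then show ?case using sub by (auto intro: continuous_on_compose2)
next
  case (Suc k)
  have d: "((\<lambda>x. g (f x)) has_derivative (\<lambda>v. fderiv g (f x) (fderiv f x v))) (at x)" if "x \<in> S" for x
  proof -
    have "(f has_derivative fderiv f x) (at x)" using Suc.prems that by (intro fderiv_works) auto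
    moreover have "(g has_derivative fderiv g (f x)) (at (f x))"
      using Suc.prems that sub by (intro fderiv_works) auto
    ultimately show ?thesis using diff_chain_at[of f] by (simp add: o_def)
  qed
  have lin: "linear (fderiv g (f x))" if "x \<in> S" for x
    using Suc.prems that sub by (intro linear_frechet_derivative) auto
  \<comment> \<open>In the chain rule the direction in which \<open>g\<close> is differentiated
    varies with \<open>x\<close>. Expanding it in the basis leaves derivatives of \<open>g\<close>
    in fixed directions composed with \<open>f\<close>, to which the induction hypothesis
    applies.\<close>
  have "Ck_on k S (\<lambda>x. \<Sum>b\<in>Basis. (fderiv f x v \<bullet> b) *\<^sub>R fderiv g (f x) b)" for v
    using Suc.prems Ck_on_Suc_imp[OF Suc.prems(1)]
    by (intro Ck_on_sum S Ck_on_bilinear[OF bounded_bilinear_scaleR]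
        Ck_on_bilinear[OF bounded_bilinear_inner] Ck_on_const Suc.IH) auto
  then have "Ck_on k S (\<lambda>x. fderiv (\<lambda>x. g (f x)) x v)" for v
    by (subst Ck_on_cong[OF S, of _ "\<lambda>x. \<Sum>b\<in>Basis. (fderiv f x v \<bullet> b) *\<^sub>R fderiv g (f x) b"])
      (auto simp: fderiv_eq[OF d] intro: linear_expand_Basis[OF lin])
  then show ?case using d by (auto simp: differentiable_def)
qed

lemma smooth_on_open: "smooth_on S f \<Longrightarrow> open S"
  by (simp add: smooth_on_def)

lemma smooth_on_differentiable: "smooth_on S f \<Longrightarrow> y \<in> S \<Longrightarrow> f differentiable (at y)"
  unfolding smooth_on_def by (metis Ck_on.simps(2))

lemma smooth_on_has_derivative: "smooth_on S f \<Longrightarrow> y \<in> S \<Longrightarrow> (f has_derivative fderiv f y) (at y)"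
  using fderiv_works smooth_on_differentiable by blast

lemma smooth_on_linear_fderiv: "smooth_on S f \<Longrightarrow> y \<in> S \<Longrightarrow> linear (fderiv f y)"
  using linear_frechet_derivative smooth_on_differentiable by blast

lemma smooth_on_continuous_on: "smooth_on S f \<Longrightarrow> continuous_on S f"
  unfolding smooth_on_def by (metis Ck_on.simps(1))

lemma smooth_on_fderiv: "smooth_on S f \<Longrightarrow> smooth_on S (\<lambda>y. fderiv f y v)"
  unfolding smooth_on_def by (metis Ck_on.simps(2))

lemma smooth_on_cong:
  assumes "\<And>x. x \<in> S \<Longrightarrow> f x = g x"
  shows "smooth_on S f = smooth_on S g"
  unfolding smooth_on_def using Ck_on_cong[of S f g] assms by auto

lemma smooth_on_subset: "smooth_on S f \<Longrightarrow> T \<subseteq> S \<Longrightarrow> open T \<Longrightarrow> smooth_on T f"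
  unfolding smooth_on_def using Ck_on_subset by blast

lemma smooth_on_local:
  assumes "\<And>x. x \<in> S \<Longrightarrow> \<exists>T. x \<in> T \<and> T \<subseteq> S \<and> smooth_on T f"
  shows "smooth_on S f"
  unfolding smooth_on_def
proof (intro conjI allI)
  show "open S" using assms unfolding smooth_on_def by (subst open_subopen) blast
  show "Ck_on k S f" for k
    by (rule Ck_on_local) (use assms in \<open>force simp: smooth_on_def\<close>)
qed

lemma smooth_on_const: "open S \<Longrightarrow> smooth_on S (\<lambda>x. c)"
  by (simp add: smooth_on_def Ck_on_const)

lemma smooth_on_linear: "bounded_linear L \<Longrightarrow> smooth_on S f \<Longrightarrow> smooth_on S (\<lambda>x. L (f x))"
  by (simp add: smooth_on_def Ck_on_linear)

lemma smooth_on_add: "smooth_on S f \<Longrightarrow> smooth_on S g \<Longrightarrow> smooth_on S (\<lambda>x. f x + g x)"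
  by (simp add: smooth_on_def Ck_on_add)

lemma smooth_on_bilinear:
  "bounded_bilinear B \<Longrightarrow> smooth_on S f \<Longrightarrow> smooth_on S g \<Longrightarrow> smooth_on S (\<lambda>x. B (f x) (g x))"
  by (simp add: smooth_on_def Ck_on_bilinear)

lemmas smooth_on_scaleR = smooth_on_bilinear[OF bounded_bilinear_scaleR]
lemmas smooth_on_mult = smooth_on_bilinear[OF bounded_bilinear_mult]
lemmas smooth_on_inner = smooth_on_bilinear[OF bounded_bilinear_inner]

lemma smooth_on_minus: "smooth_on S f \<Longrightarrow> smooth_on S (\<lambda>x. - f x)"
  by (rule smooth_on_linear[OF bounded_linear_minus[OF bounded_linear_ident]])

lemma smooth_on_diff: "smooth_on S f \<Longrightarrow> smooth_on S g \<Longrightarrow> smooth_on S (\<lambda>x. f x - g x)"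
  using smooth_on_add[OF _ smooth_on_minus] by force

lemma smooth_on_sum: "open S \<Longrightarrow> (\<And>i. i \<in> I \<Longrightarrow> smooth_on S (f i)) \<Longrightarrow> smooth_on S (\<lambda>x. \<Sum>i\<in>I. f i x)"
  by (simp add: smooth_on_def Ck_on_sum)

lemma smooth_on_compose:
  fixes f :: "'a::euclidean_space \<Rightarrow> 'b::euclidean_space"
  shows "smooth_on S f \<Longrightarrow> smooth_on T g \<Longrightarrow> f ` S \<subseteq> T \<Longrightarrow> smooth_on S (\<lambda>x. g (f x))"
  unfolding smooth_on_def using Ck_on_compose by blast

lemma smooth_on_ident: "open S \<Longrightarrow> smooth_on S (\<lambda>x. x)"
proof -
  have "Ck_on k S (\<lambda>x. x)" for k by (induction k) (auto simp: Ck_on_const)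
  then show "open S \<Longrightarrow> smooth_on S (\<lambda>x. x)" by (simp add: smooth_on_def)
qed

lemma smooth_on_componentwise:
  fixes f :: "'a::euclidean_space \<Rightarrow> real^'n"
  assumes "open S" "\<And>i. smooth_on S (\<lambda>x. f x $ i)"
  shows "smooth_on S f"
proof -
  have "smooth_on S (\<lambda>x. \<Sum>i\<in>UNIV. (f x $ i) *\<^sub>R axis i (1::real))"
    by (intro smooth_on_sum smooth_on_scaleR smooth_on_const assms)
  then show ?thesis by (simp add: basis_expansion[symmetric] scalar_mult_eq_scaleR[symmetric])
    (simp add: basis_expansion)
qed

section \<open>Symmetry of second derivatives, and necessary conditions at a maximum\<close>

lemma fderiv_along_line:
  assumes "f differentiable (at (x + t *\<^sub>R v))"
  shows "((\<lambda>t. f (x + t *\<^sub>R v)) has_vector_derivative fderiv f (x + t *\<^sub>R v) v) (at t)"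
proof -
  have l: "((\<lambda>t. x + t *\<^sub>R v) has_derivative (\<lambda>h. h *\<^sub>R v)) (at t)"
    by (auto intro!: derivative_eq_intros)
  have lin: "linear (fderiv f (x + t *\<^sub>R v))" using assms linear_frechet_derivative by blast
  have "((\<lambda>t. f (x + t *\<^sub>R v)) has_derivative (\<lambda>h. fderiv f (x + t *\<^sub>R v) (h *\<^sub>R v))) (at t)"
    using diff_chain_at[OF l fderiv_works[OF assms]] by (simp add: o_def)
  then show ?thesis using lin by (simp add: has_vector_derivative_def linear_cmul)
qed

lemma fderiv_along_line_real:
  fixes f :: "'a::euclidean_space \<Rightarrow> real"
  assumes "f differentiable (at (x + t *\<^sub>R v))"
  shows "((\<lambda>t. f (x + t *\<^sub>R v)) has_real_derivative fderiv f (x + t *\<^sub>R v) v) (at t)"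
  using fderiv_along_line[OF assms] by (simp add: has_real_derivative_iff_has_vector_derivative)

text \<open>The mean value theorem is used along \<open>v\<close> for the difference in the
  direction \<open>w\<close>, and then along \<open>w\<close> for the resulting difference of
  derivatives. The second difference on the left is symmetric in \<open>v\<close> and
  \<open>w\<close>, while the right-hand side singles out an order of differentiation.\<close>

lemma mixed_difference_quotient:
  fixes f :: "'a::euclidean_space \<Rightarrow> real"
  assumes f: "smooth_on S f" and sub: "\<And>s r. 0 \<le> s \<Longrightarrow> s \<le> t \<Longrightarrow> 0 \<le> r \<Longrightarrow> r \<le> t \<Longrightarrow> y + s *\<^sub>R v + r *\<^sub>R w \<in> S"
    and t: "0 < t"
  shows "\<exists>s r. 0 < s \<and> s < t \<and> 0 < r \<and> r < t \<and>
    f (y + t *\<^sub>R v + t *\<^sub>R w) - f (y + t *\<^sub>R v) - f (y + t *\<^sub>R w) + f y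
      = t\<^sup>2 * fderiv (\<lambda>x. fderiv f x v) (y + s *\<^sub>R v + r *\<^sub>R w) w"
proof -
  have diff: "f differentiable (at (y + s *\<^sub>R v + r *\<^sub>R w))" if "0 \<le> s" "s \<le> t" "0 \<le> r" "r \<le> t" for s r
    using smooth_on_differentiable[OF f sub] that by auto
  have diff2: "(\<lambda>x. fderiv f x v) differentiable (at (y + s *\<^sub>R v + r *\<^sub>R w))" if "0 \<le> s" "s \<le> t" "0 \<le> r" "r \<le> t" for s r
    using smooth_on_differentiable[OF smooth_on_fderiv[OF f] sub] that by auto
  have "\<exists>z>0. z < t \<and> (f (y + t *\<^sub>R w + t *\<^sub>R v) - f (y + 0 *\<^sub>R w + t *\<^sub>R v)) - (f (y + t *\<^sub>R w + 0 *\<^sub>R v) - f (y + 0 *\<^sub>R w + 0 *\<^sub>R v))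
     = (t - 0) * (fderiv f (y + t *\<^sub>R w + z *\<^sub>R v) v - fderiv f (y + 0 *\<^sub>R w + z *\<^sub>R v) v)"
  proof (rule MVT2[where f="\<lambda>s. f (y + t *\<^sub>R w + s *\<^sub>R v) - f (y + 0 *\<^sub>R w + s *\<^sub>R v)"])
    show "0 < t" by fact
    fix s :: real assume "0 \<le> s" "s \<le> t"
    then show "((\<lambda>s. f (y + t *\<^sub>R w + s *\<^sub>R v) - f (y + 0 *\<^sub>R w + s *\<^sub>R v)) has_real_derivative
        fderiv f (y + t *\<^sub>R w + s *\<^sub>R v) v - fderiv f (y + 0 *\<^sub>R w + s *\<^sub>R v) v) (at s)"
      using diff[of s t] diff[of s 0] t
      by (intro DERIV_diff fderiv_along_line_real) (auto simp: add_ac)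
  qed
  then obtain s where s: "0 < s" "s < t" and
    eq1: "f (y + t *\<^sub>R w + t *\<^sub>R v) - f (y + t *\<^sub>R v) - (f (y + t *\<^sub>R w) - f y) =
      t * (fderiv f (y + t *\<^sub>R w + s *\<^sub>R v) v - fderiv f (y + s *\<^sub>R v) v)" by auto
  have "\<exists>z>0. z < t \<and> fderiv f (y + s *\<^sub>R v + t *\<^sub>R w) v - fderiv f (y + s *\<^sub>R v + 0 *\<^sub>R w) v
     = (t - 0) * (fderiv (\<lambda>x. fderiv f x v) (y + s *\<^sub>R v + z *\<^sub>R w) w)"
  proof (rule MVT2[where f="\<lambda>r. fderiv f (y + s *\<^sub>R v + r *\<^sub>R w) v"])
    show "0 < t" by fact
    fix r :: real assume "0 \<le> r" "r \<le> t"
    then show "((\<lambda>r. fderiv f (y + s *\<^sub>R v + r *\<^sub>R w) v) has_real_derivative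
        fderiv (\<lambda>x. fderiv f x v) (y + s *\<^sub>R v + r *\<^sub>R w) w) (at r)"
      using diff2[of s r] s
      by (intro fderiv_along_line_real[where f="\<lambda>x. fderiv f x v"]) auto
  qed
  then obtain r where r: "0 < r" "r < t" and
    eq2: "fderiv f (y + s *\<^sub>R v + t *\<^sub>R w) v - fderiv f (y + s *\<^sub>R v) v = t * fderiv (\<lambda>x. fderiv f x v) (y + s *\<^sub>R v + r *\<^sub>R w) w"
    by auto
  have "f (y + t *\<^sub>R v + t *\<^sub>R w) - f (y + t *\<^sub>R v) - f (y + t *\<^sub>R w) + f y
    = t * (fderiv f (y + s *\<^sub>R v + t *\<^sub>R w) v - fderiv f (y + s *\<^sub>R v) v)"
    using eq1 by (simp add: add_ac)
  also have "\<dots> = t\<^sup>2 * fderiv (\<lambda>x. fderiv f x v) (y + s *\<^sub>R v + r *\<^sub>R w) w"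
    unfolding eq2 by (simp add: power2_eq_square)
  finally show ?thesis using s r by blast
qed

text \<open>Both mixed derivatives, taken at suitable points near \<open>y\<close>, equal the same
  second difference divided by \<open>t\<close> squared. Continuity carries the equality to
  \<open>y\<close>.\<close>

lemma second_fderiv_symmetric_real:
  fixes f :: "'a::euclidean_space \<Rightarrow> real"
  assumes f: "smooth_on S f" and y: "y \<in> S"
  shows "fderiv (\<lambda>x. fderiv f x v) y w = fderiv (\<lambda>x. fderiv f x w) y v"
proof (rule ccontr)
  define p where "p = (\<lambda>x. fderiv (\<lambda>x. fderiv f x v) x w)"
  define q where "q = (\<lambda>x. fderiv (\<lambda>x. fderiv f x w) x v)"
  assume "\<not> ?thesis"
  then have ne: "p y \<noteq> q y" by (simp add: p_def q_def)
  \<comment> \<open>Half the gap: values within \<open>e\<close> of \<open>p y\<close> and of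
    \<open>q y\<close> respectively cannot coincide.\<close>
  define e where "e = \<bar>p y - q y\<bar> / 2"
  have e: "e > 0" using ne by (simp add: e_def)
  have "isCont p y" "isCont q y"
    unfolding p_def q_def using smooth_on_fderiv[OF smooth_on_fderiv[OF f]] smooth_on_open[OF f] y
    by (metis smooth_on_continuous_on continuous_on_eq_continuous_at)+
  then obtain d1 d2 where d1: "d1 > 0" "\<And>x. dist x y < d1 \<Longrightarrow> dist (p x) (p y) < e"
    and d2: "d2 > 0" "\<And>x. dist x y < d2 \<Longrightarrow> dist (q x) (q y) < e"
    using e unfolding continuous_at_eps_delta by metis
  obtain d3 where d3: "d3 > 0" "ball y d3 \<subseteq> S" using smooth_on_open[OF f] y open_contains_ball by blast
  define d where "d = min d1 (min d2 d3)"
  have d: "d > 0" using d1 d2 d3 by (simp add: d_def)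
  \<comment> \<open>With this \<open>t\<close> the whole parallelogram lies within
    \<open>d / 2\<close> of \<open>y\<close>. The summand 1 keeps the denominator positive when
    \<open>v\<close> and \<open>w\<close> both vanish.\<close>
  define t where "t = d / (2 * (norm v + norm w + 1))"
  have nn: "norm v + norm w + 1 > 0" by (smt (verit) norm_ge_zero)
  have t: "t > 0" using d nn by (simp add: t_def)
  have near: "dist (y + s *\<^sub>R v + r *\<^sub>R w) y < d" if "0 \<le> s" "s \<le> t" "0 \<le> r" "r \<le> t" for s r
  proof -
    have "dist (y + s *\<^sub>R v + r *\<^sub>R w) y = norm (s *\<^sub>R v + r *\<^sub>R w)" by (simp add: dist_norm)
    also have "\<dots> \<le> s * norm v + r * norm w" using that norm_triangle_ineq[of "s *\<^sub>R v" "r *\<^sub>R w"] by simp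
    also have "\<dots> \<le> t * norm v + t * norm w" using that by (intro add_mono mult_right_mono) auto
    also have "\<dots> \<le> t * (norm v + norm w + 1)" using t by (simp add: algebra_simps)
    also have "\<dots> = d / 2" using nn by (simp add: t_def field_simps)
    finally show ?thesis using d by simp
  qed
  have inS: "y + s *\<^sub>R v + r *\<^sub>R w \<in> S" if "0 \<le> s" "s \<le> t" "0 \<le> r" "r \<le> t" for s r
    using near[OF that] d3 by (auto simp: d_def dist_commute mem_ball subset_iff)
  obtain s r where sr: "0 < s" "s < t" "0 < r" "r < t" and
    1: "f (y + t *\<^sub>R v + t *\<^sub>R w) - f (y + t *\<^sub>R v) - f (y + t *\<^sub>R w) + f y = t\<^sup>2 * p (y + s *\<^sub>R v + r *\<^sub>R w)"
    using mixed_difference_quotient[OF f inS t] unfolding p_def by blast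
  have inS': "y + s *\<^sub>R w + r *\<^sub>R v \<in> S" if "0 \<le> s" "s \<le> t" "0 \<le> r" "r \<le> t" for s r
    using inS[of r s] that by (simp add: add_ac)
  obtain s' r' where sr': "0 < s'" "s' < t" "0 < r'" "r' < t" and
    2: "f (y + t *\<^sub>R w + t *\<^sub>R v) - f (y + t *\<^sub>R w) - f (y + t *\<^sub>R v) + f y = t\<^sup>2 * q (y + s' *\<^sub>R w + r' *\<^sub>R v)"
    using mixed_difference_quotient[OF f inS' t] unfolding q_def by blast
  have "t\<^sup>2 * p (y + s *\<^sub>R v + r *\<^sub>R w) = t\<^sup>2 * q (y + s' *\<^sub>R w + r' *\<^sub>R v)"
    using 1 2 by (simp add: algebra_simps)
  then have "p (y + s *\<^sub>R v + r *\<^sub>R w) = q (y + r' *\<^sub>R v + s' *\<^sub>R w)" using t by (simp add: add_ac)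
  moreover have "dist (p (y + s *\<^sub>R v + r *\<^sub>R w)) (p y) < e" "dist (q (y + r' *\<^sub>R v + s' *\<^sub>R w)) (q y) < e"
    using sr sr' near d1 d2 by (auto simp: d_def)
  ultimately show False unfolding e_def dist_real_def by (smt (verit) field_sum_of_halves)
qed

lemma fderiv_linear:
  assumes "bounded_linear L" "f differentiable (at x)"
  shows "fderiv (\<lambda>x. L (f x)) x v = L (fderiv f x v)"
  using fderiv_eq[OF bounded_linear.has_derivative[OF assms(1) fderiv_works[OF assms(2)]]] by simp

lemma second_fderiv_symmetric:
  fixes f :: "'a::euclidean_space \<Rightarrow> 'b::euclidean_space"
  assumes f: "smooth_on S f" and y: "y \<in> S"
  shows "fderiv (\<lambda>x. fderiv f x v) y w = fderiv (\<lambda>x. fderiv f x w) y v"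
proof (rule euclidean_eqI)
  fix b :: 'b assume "b \<in> Basis"
  have L: "bounded_linear (\<lambda>z. z \<bullet> b)" by (rule bounded_linear_inner_left)
  have 1: "fderiv (\<lambda>x. fderiv (\<lambda>x. f x \<bullet> b) x v) y w = fderiv (\<lambda>x. fderiv f x v) y w \<bullet> b" for v w
  proof -
    have "fderiv (\<lambda>x. fderiv (\<lambda>x. f x \<bullet> b) x v) y = fderiv (\<lambda>x. fderiv f x v \<bullet> b) y"
      by (rule fderiv_cong_open[OF smooth_on_open[OF f] y])
        (use fderiv_linear[OF L] smooth_on_differentiable[OF f] in blast)
    then show ?thesis
      by (simp add: fderiv_linear[OF L smooth_on_differentiable[OF smooth_on_fderiv[OF f] y]])
  qed
  show "fderiv (\<lambda>x. fderiv f x v) y w \<bullet> b = fderiv (\<lambda>x. fderiv f x w) y v \<bullet> b"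
    using second_fderiv_symmetric_real[OF smooth_on_linear[OF L f] y, of v w] by (simp only: 1)
qed

lemma fderiv_zero_at_max:
  fixes f :: "'a::euclidean_space \<Rightarrow> real"
  assumes f: "smooth_on S f" and y: "y \<in> S" and max: "\<And>x. x \<in> S \<Longrightarrow> f x \<le> f y"
  shows "fderiv f y v = 0"
proof -
  have "fderiv f y = (\<lambda>v. 0)"
    using differential_zero_maxmin[of y S f "fderiv f y"] smooth_on_open[OF f] y
      smooth_on_has_derivative[OF f y] max by blast
  then show ?thesis by simp
qed

text \<open>Along a line through the maximum the first derivative vanishes at 0. A positive second
  derivative would make it positive just after 0, and by the mean value theorem \<open>f\<close>
  would exceed its maximum.\<close>

lemma second_fderiv_nonpos_at_max:
  fixes f :: "'a::euclidean_space \<Rightarrow> real"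
  assumes f: "smooth_on S f" and y: "y \<in> S" and max: "\<And>x. x \<in> S \<Longrightarrow> f x \<le> f y"
  shows "fderiv (\<lambda>x. fderiv f x v) y v \<le> 0"
proof (rule ccontr)
  assume "\<not> ?thesis"
  then have pos: "0 < fderiv (\<lambda>x. fderiv f x v) y v" by simp
  have "((\<lambda>t. fderiv f (y + t *\<^sub>R v) v) has_real_derivative fderiv (\<lambda>x. fderiv f x v) (y + 0 *\<^sub>R v) v) (at 0)"
    by (rule fderiv_along_line_real[where f="\<lambda>x. fderiv f x v"])
      (simp add: smooth_on_differentiable[OF smooth_on_fderiv[OF f] y])
  then obtain d where d: "d > 0" "\<And>h. h > 0 \<Longrightarrow> h < d \<Longrightarrow> fderiv f (y + 0 *\<^sub>R v) v < fderiv f (y + h *\<^sub>R v) v"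
    using DERIV_pos_inc_right[of "\<lambda>t. fderiv f (y + t *\<^sub>R v) v" _ 0] pos by fastforce
  then have dp: "\<And>h. h > 0 \<Longrightarrow> h < d \<Longrightarrow> 0 < fderiv f (y + h *\<^sub>R v) v"
    using fderiv_zero_at_max[OF f y max, of v] by simp
  have "open ((\<lambda>t. y + t *\<^sub>R v) -` S)"
    by (rule open_vimage[OF smooth_on_open[OF f]]) (intro continuous_intros)
  moreover have "0 \<in> (\<lambda>t::real. y + t *\<^sub>R v) -` S" using y by simp
  ultimately obtain d' where d': "d' > 0" "ball 0 d' \<subseteq> (\<lambda>t. y + t *\<^sub>R v) -` S"
    using open_contains_ball by blast
  define t where "t = min d d' / 2"
  have t: "0 < t" "t < d" "t < d'" using d d' by (auto simp: t_def)
  have inS: "y + s *\<^sub>R v \<in> S" if "0 \<le> s" "s \<le> t" for s using d' that t by (auto simp: subset_iff)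
  have "\<exists>z>0. z < t \<and> f (y + t *\<^sub>R v) - f (y + 0 *\<^sub>R v) = (t - 0) * fderiv f (y + z *\<^sub>R v) v"
    by (rule MVT2[OF t(1)], rule fderiv_along_line_real) (use smooth_on_differentiable[OF f inS] in auto)
  then obtain z where z: "0 < z" "z < t" "f (y + t *\<^sub>R v) - f y = t * fderiv f (y + z *\<^sub>R v) v" by auto
  then have "f (y + t *\<^sub>R v) > f y" using dp[of z] t by (smt (verit) mult_pos_pos)
  then show False using max[of "y + t *\<^sub>R v"] inS[of t] t by auto
qed

text \<open>The Leibniz rule for a field of linear maps applied to a vector field. Metric,
  Christoffel map, covariant derivative and connection form are all functions of a point and a
  vector, and differentiability is known only with the vector held fixed.\<close>

lemma has_derivative_linear_field:
  fixes P :: "'c::real_normed_vector \<Rightarrow> 'a::euclidean_space \<Rightarrow> 'b::real_normed_vector"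
  assumes S: "open S" "y \<in> S" and lin: "\<And>x. x \<in> S \<Longrightarrow> linear (P x)"
    and P: "\<And>v. ((\<lambda>x. P x v) has_derivative P' v) (at y)"
    and e: "(e has_derivative e') (at y)"
  shows "((\<lambda>x. P x (e x)) has_derivative (\<lambda>u. P' (e y) u + P y (e' u))) (at y)"
proof -
  \<comment> \<open>Linearity of \<open>P'\<close> in \<open>v\<close> is inherited from
    \<open>P\<close> because derivatives are unique.\<close>
  have lin': "P' v u = (\<Sum>b\<in>Basis. (v \<bullet> b) *\<^sub>R P' b u)" for v u
  proof -
    have "((\<lambda>x. \<Sum>b\<in>Basis. (v \<bullet> b) *\<^sub>R P x b) has_derivative (\<lambda>u. \<Sum>b\<in>Basis. (v \<bullet> b) *\<^sub>R P' b u)) (at y)"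
      by (intro has_derivative_sum has_derivative_scaleR_right P)
    then have "((\<lambda>x. P x v) has_derivative (\<lambda>u. \<Sum>b\<in>Basis. (v \<bullet> b) *\<^sub>R P' b u)) (at y)"
      by (rule has_derivative_transform_within_open[OF _ S]) (use linear_expand_Basis[OF lin, of _ v] in auto)
    then have "P' v = (\<lambda>u. \<Sum>b\<in>Basis. (v \<bullet> b) *\<^sub>R P' b u)" using P has_derivative_unique by blast
    then show ?thesis by metis
  qed
  have "((\<lambda>x. \<Sum>b\<in>Basis. (e x \<bullet> b) *\<^sub>R P x b) has_derivative
      (\<lambda>u. \<Sum>b\<in>Basis. (e y \<bullet> b) *\<^sub>R P' b u + (e' u \<bullet> b) *\<^sub>R P y b)) (at y)"
    by (intro has_derivative_sum has_derivative_scaleR P has_derivative_inner_left e)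
  then have "((\<lambda>x. \<Sum>b\<in>Basis. (e x \<bullet> b) *\<^sub>R P x b) has_derivative (\<lambda>u. P' (e y) u + P y (e' u))) (at y)"
    by (simp add: sum.distrib lin'[of "e y", symmetric] linear_expand_Basis[OF lin[OF S(2)], symmetric])
  then show ?thesis
    by (rule has_derivative_transform_within_open[OF _ S]) (use linear_expand_Basis[OF lin] in \<open>metis\<close>)
qed

lemma fderiv_linear_field:
  fixes P :: "'c::euclidean_space \<Rightarrow> 'a::euclidean_space \<Rightarrow> 'b::real_normed_vector"
  assumes "open S" "y \<in> S" "\<And>x. x \<in> S \<Longrightarrow> linear (P x)"
    "\<And>v. (\<lambda>x. P x v) differentiable (at y)" "e differentiable (at y)"
  shows "fderiv (\<lambda>x. P x (e x)) y u = fderiv (\<lambda>x. P x (e y)) y u + P y (fderiv e y u)"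
    and "(\<lambda>x. P x (e x)) differentiable (at y)"
proof -
  have "((\<lambda>x. P x (e x)) has_derivative (\<lambda>u. fderiv (\<lambda>x. P x (e y)) y u + P y (fderiv e y u))) (at y)"
    by (rule has_derivative_linear_field[where P'="\<lambda>v. fderiv (\<lambda>x. P x v) y"])
      (use assms fderiv_works in auto)
  then show "fderiv (\<lambda>x. P x (e x)) y u = fderiv (\<lambda>x. P x (e y)) y u + P y (fderiv e y u)"
    "(\<lambda>x. P x (e x)) differentiable (at y)"
    by (auto simp: fderiv_eq differentiable_def)
qed

lemma smooth_on_linear_field:
  fixes P :: "'c::euclidean_space \<Rightarrow> 'a::euclidean_space \<Rightarrow> 'b::real_normed_vector"
  assumes "\<And>x. x \<in> S \<Longrightarrow> linear (P x)" "\<And>v. smooth_on S (\<lambda>x. P x v)" "smooth_on S e"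
  shows "smooth_on S (\<lambda>x. P x (e x))"
proof -
  have "smooth_on S (\<lambda>x. \<Sum>b\<in>Basis. (e x \<bullet> b) *\<^sub>R P x b)"
    using smooth_on_open[OF assms(3)]
    by (intro smooth_on_sum smooth_on_scaleR smooth_on_inner smooth_on_const assms)
  then show ?thesis
    by (subst smooth_on_cong[of S _ "\<lambda>x. \<Sum>b\<in>Basis. (e x \<bullet> b) *\<^sub>R P x b"])
      (use linear_expand_Basis[OF assms(1)] in auto)
qed

lemma fderiv_sum:
  "(\<And>i. i \<in> I \<Longrightarrow> f i differentiable (at y)) \<Longrightarrow> fderiv (\<lambda>y. \<Sum>i\<in>I. f i y) y u = (\<Sum>i\<in>I. fderiv (f i) y u)"
  by (subst fderiv_eq[OF has_derivative_sum[OF fderiv_works]]) auto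

lemma fderiv_add: "f differentiable (at y) \<Longrightarrow> g differentiable (at y) \<Longrightarrow> fderiv (\<lambda>y. f y + g y) y u = fderiv f y u + fderiv g y u"
  by (subst fderiv_eq[OF has_derivative_add[OF fderiv_works fderiv_works]]) auto

lemma fderiv_diff: "f differentiable (at y) \<Longrightarrow> g differentiable (at y) \<Longrightarrow> fderiv (\<lambda>y. f y - g y) y u = fderiv f y u - fderiv g y u"
  by (subst fderiv_eq[OF has_derivative_diff[OF fderiv_works fderiv_works]]) auto

lemma fderiv_bilinear:
  assumes "bounded_bilinear B" "f differentiable (at y)" "g differentiable (at y)"
  shows "fderiv (\<lambda>y. B (f y) (g y)) y u = B (f y) (fderiv g y u) + B (fderiv f y u) (g y)"
  using fderiv_eq[OF bounded_bilinear.FDERIV[OF assms(1) fderiv_works[OF assms(2)] fderiv_works[OF assms(3)]]] by simp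

lemma linear_fderiv_field:
  fixes P :: "'c::euclidean_space \<Rightarrow> 'a::euclidean_space \<Rightarrow> 'b::real_normed_vector"
  assumes "open S" "y \<in> S" and lin: "\<And>x. x \<in> S \<Longrightarrow> linear (P x)" and d: "\<And>v. (\<lambda>x. P x v) differentiable (at y)"
  shows "linear (\<lambda>v. fderiv (\<lambda>x. P x v) y u)"
proof (rule linearI)
  fix v w :: 'a and r :: real
  have "fderiv (\<lambda>x. P x (v + w)) y = fderiv (\<lambda>x. P x v + P x w) y"
    by (rule fderiv_cong_open[OF assms(1,2)]) (simp add: linear_add[OF lin])
  then show "fderiv (\<lambda>x. P x (v + w)) y u = fderiv (\<lambda>x. P x v) y u + fderiv (\<lambda>x. P x w) y u"
    by (simp add: fderiv_eq[OF has_derivative_add[OF fderiv_works[OF d] fderiv_works[OF d]]])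
  have "fderiv (\<lambda>x. P x (r *\<^sub>R v)) y = fderiv (\<lambda>x. r *\<^sub>R P x v) y"
    by (rule fderiv_cong_open[OF assms(1,2)]) (simp add: linear_cmul[OF lin])
  then show "fderiv (\<lambda>x. P x (r *\<^sub>R v)) y u = r *\<^sub>R fderiv (\<lambda>x. P x v) y u"
    by (simp add: fderiv_linear[OF bounded_linear_scaleR_right d])
qed

section \<open>Clifford modules\<close>

lemma sum_rotate3:
  fixes g :: "'i::finite \<Rightarrow> 'i \<Rightarrow> 'i \<Rightarrow> 'b::comm_monoid_add"
  shows "(\<Sum>a\<in>UNIV. \<Sum>b\<in>UNIV. \<Sum>c\<in>UNIV. g b c a) = (\<Sum>a\<in>UNIV. \<Sum>b\<in>UNIV. \<Sum>c\<in>UNIV. g a b c)"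
proof -
  have "(\<Sum>a\<in>UNIV. \<Sum>b\<in>UNIV. \<Sum>c\<in>UNIV. g b c a) = (\<Sum>b\<in>UNIV. \<Sum>a\<in>UNIV. \<Sum>c\<in>UNIV. g b c a)"
    by (rule sum.swap)
  also have "\<dots> = (\<Sum>b\<in>UNIV. \<Sum>c\<in>UNIV. \<Sum>a\<in>UNIV. g b c a)"
    by (intro sum.cong refl sum.swap)
  finally show ?thesis .
qed

lemma sum_reverse3:
  fixes g :: "'i::finite \<Rightarrow> 'i \<Rightarrow> 'i \<Rightarrow> 'b::comm_monoid_add"
  shows "(\<Sum>a\<in>UNIV. \<Sum>b\<in>UNIV. \<Sum>c\<in>UNIV. g a b c) = (\<Sum>c\<in>UNIV. \<Sum>b\<in>UNIV. \<Sum>a\<in>UNIV. g a b c)"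
proof -
  have "(\<Sum>a\<in>UNIV. \<Sum>b\<in>UNIV. \<Sum>c\<in>UNIV. g a b c) = (\<Sum>a\<in>UNIV. \<Sum>c\<in>UNIV. \<Sum>b\<in>UNIV. g a b c)"
    by (intro sum.cong refl sum.swap)
  also have "\<dots> = (\<Sum>c\<in>UNIV. \<Sum>a\<in>UNIV. \<Sum>b\<in>UNIV. g a b c)" by (rule sum.swap)
  also have "\<dots> = (\<Sum>c\<in>UNIV. \<Sum>b\<in>UNIV. \<Sum>a\<in>UNIV. g a b c)"
    by (intro sum.cong refl sum.swap)
  finally show ?thesis .
qed

lemma sum_last_first4:
  fixes g :: "'i::finite \<Rightarrow> 'i \<Rightarrow> 'i \<Rightarrow> 'i \<Rightarrow> 'b::comm_monoid_add"
  shows "(\<Sum>a\<in>UNIV. \<Sum>b\<in>UNIV. \<Sum>c\<in>UNIV. \<Sum>d\<in>UNIV. g a b c d) = (\<Sum>d\<in>UNIV. \<Sum>a\<in>UNIV. \<Sum>b\<in>UNIV. \<Sum>c\<in>UNIV. g a b c d)"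
proof -
  have "(\<Sum>a\<in>UNIV. \<Sum>b\<in>UNIV. \<Sum>c\<in>UNIV. \<Sum>d\<in>UNIV. g a b c d) = (\<Sum>a\<in>UNIV. \<Sum>b\<in>UNIV. \<Sum>d\<in>UNIV. \<Sum>c\<in>UNIV. g a b c d)"
    by (intro sum.cong refl sum.swap)
  also have "\<dots> = (\<Sum>a\<in>UNIV. \<Sum>d\<in>UNIV. \<Sum>b\<in>UNIV. \<Sum>c\<in>UNIV. g a b c d)" by (intro sum.cong refl sum.swap)
  also have "\<dots> = (\<Sum>d\<in>UNIV. \<Sum>a\<in>UNIV. \<Sum>b\<in>UNIV. \<Sum>c\<in>UNIV. g a b c d)" by (rule sum.swap)
  finally show ?thesis .
qed

lemma sum_delta_scaleR:
  fixes g :: "'i::finite \<Rightarrow> 'b::real_vector"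
  shows "(\<Sum>a\<in>UNIV. (if a = b then x else 0) *\<^sub>R g a) = x *\<^sub>R g b"
    and "(\<Sum>a\<in>UNIV. (if b = a then x else 0) *\<^sub>R g a) = x *\<^sub>R g b"
  by (simp_all add: if_distrib[of "\<lambda>t. t *\<^sub>R _"] cong: if_cong)

text \<open>The complex spinor space seen as a real Euclidean space: \<open>rho j\<close> is
  Clifford multiplication by the j-th basis vector and \<open>J\<close> is multiplication by
  \<i>.\<close>

locale clifford_module =
  fixes rho :: "'n::finite \<Rightarrow> 'v::euclidean_space \<Rightarrow> 'v" and J :: "'v \<Rightarrow> 'v"
  assumes linear_rho: "linear (rho j)"
    and rho_skew: "rho j x \<bullet> y = - (x \<bullet> rho j y)"
    and rho_clifford: "rho j (rho k x) + rho k (rho j x) = (if j = k then - 2 else 0) *\<^sub>R x"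
    and linear_J: "linear J"
    and J_skew: "J x \<bullet> y = - (x \<bullet> J y)"
    and J_J: "J (J x) = - x"
    and J_rho: "J (rho j x) = rho j (J x)"
begin

lemmas rho_simps = linear_add[OF linear_rho] linear_diff[OF linear_rho] linear_cmul[OF linear_rho]
  linear_neg[OF linear_rho] linear_sum[OF linear_rho] linear_0[OF linear_rho]
lemmas J_simps = linear_add[OF linear_J] linear_diff[OF linear_J] linear_cmul[OF linear_J]
  linear_neg[OF linear_J] linear_sum[OF linear_J] linear_0[OF linear_J]

lemmas bounded_linear_rho = linear_rho[unfolded linear_conv_bounded_linear]
lemmas bounded_linear_J = linear_J[unfolded linear_conv_bounded_linear]

lemma rho_swap: "rho j (rho k x) = - rho k (rho j x) - (if j = k then 2 else 0) *\<^sub>R x"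
proof -
  have "rho j (rho k x) = (if j = k then - 2 else 0) *\<^sub>R x - rho k (rho j x)"
    using rho_clifford[of j k x] by (simp only: eq_diff_eq)
  moreover have "(if j = k then - 2 else 0) *\<^sub>R x - z = - z - (if j = k then 2 else 0) *\<^sub>R x" for z
    by simp
  ultimately show ?thesis by metis
qed

text \<open>By skewness the product equals minus the quadratic form of \<open>rho k\<close> after
  \<open>rho j\<close>, and also of \<open>rho j\<close> after \<open>rho k\<close>; adding the two
  gives the anticommutator. So the vectors \<open>rho j x\<close> are orthogonal and as long as
  \<open>x\<close>, the input to Bessel's inequality.\<close>

lemma rho_rho_inner: "rho j x \<bullet> rho k x = (if j = k then x \<bullet> x else 0)"
proof -
  have "2 * (rho j x \<bullet> rho k x) = - (rho k (rho j x) + rho j (rho k x)) \<bullet> x"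
    using rho_skew[of k "rho j x" x] rho_skew[of j "rho k x" x]
    by (simp add: inner_add_left inner_diff_left inner_diff_right inner_commute)
  also have "\<dots> = (if j = k then 2 * (x \<bullet> x) else 0)" by (simp add: rho_clifford)
  finally show ?thesis by (simp split: if_splits)
qed

lemma rho_move:
  "rho k (rho l (rho j x)) = rho j (rho k (rho l x)) + (if k = j then 2 else 0) *\<^sub>R rho l x - (if l = j then 2 else 0) *\<^sub>R rho k x"
  by (subst rho_swap[of l j]) (simp add: rho_simps rho_swap[of k j "rho l x"] del: scaleR_left.diff)

text \<open>For skew \<open>B\<close> this is the differential of the spin representation, applied
  to the endomorphism that sends the j-th basis vector to the combination of the l-th ones with
  coefficients \<open>B j l\<close>. The rows of \<open>B\<close> hold the images, so composing
  endomorphisms multiplies the matrices in reverse order. The factor 1/4 is that of the local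
  formula for the spinor connection.\<close>

definition cl :: "('n \<Rightarrow> 'n \<Rightarrow> real) \<Rightarrow> 'v \<Rightarrow> 'v" where
  "cl B x = (1/4) *\<^sub>R (\<Sum>j\<in>UNIV. \<Sum>l\<in>UNIV. B j l *\<^sub>R rho j (rho l x))"

lemma linear_cl: "linear (cl B)"
  unfolding cl_def
  by (intro linear_compose_scale_right linear_compose_sum ballI linear_compose[OF linear_rho linear_rho, unfolded o_def])

lemmas cl_simps = linear_add[OF linear_cl] linear_diff[OF linear_cl] linear_cmul[OF linear_cl]
  linear_neg[OF linear_cl] linear_sum[OF linear_cl] linear_0[OF linear_cl]

lemma cl_add: "cl (\<lambda>j l. B j l + B' j l) x = cl B x + cl B' x"
  by (simp add: cl_def scaleR_add_left sum.distrib scaleR_add_right)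

lemma cl_diff: "cl (\<lambda>j l. B j l - B' j l) x = cl B x - cl B' x"
  by (simp add: cl_def scaleR_diff_left sum_subtractf scaleR_diff_right)

lemma cl_scale: "cl (\<lambda>j l. r * B j l) x = r *\<^sub>R cl B x"
  by (simp add: cl_def scaleR_sum_right mult_ac)

lemma J_cl: "J (cl B x) = cl B (J x)"
  by (simp add: cl_def J_simps J_rho)

text \<open>Moving \<open>rho j\<close> through two factors yields one contraction with each index
  of \<open>B\<close>. Both contribute twice the same sum, since \<open>B\<close> is skew, and the
  resulting 4 cancels the 1/4 in \<open>cl\<close>.\<close>

lemma cl_rho:
  assumes B: "\<And>j l. B j l = - B l j"
  shows "cl B (rho j x) = rho j (cl B x) + (\<Sum>l\<in>UNIV. B j l *\<^sub>R rho l x)"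
proof -
  have "(\<Sum>k\<in>UNIV. \<Sum>l\<in>UNIV. B k l *\<^sub>R rho k (rho l (rho j x)))
    = (\<Sum>k\<in>UNIV. \<Sum>l\<in>UNIV. B k l *\<^sub>R rho j (rho k (rho l x)) + (if k = j then 2 else 0) *\<^sub>R (B k l *\<^sub>R rho l x)
        - (if l = j then 2 else 0) *\<^sub>R (B k l *\<^sub>R rho k x))"
    by (simp add: rho_move[of _ _ j] scaleR_add_right scaleR_diff_right mult.commute)
  also have "\<dots> = (\<Sum>k\<in>UNIV. \<Sum>l\<in>UNIV. B k l *\<^sub>R rho j (rho k (rho l x)))
     + (\<Sum>k\<in>UNIV. (if k = j then 2 else 0) *\<^sub>R (\<Sum>l\<in>UNIV. B k l *\<^sub>R rho l x))
     - (\<Sum>k\<in>UNIV. 2 *\<^sub>R (B k j *\<^sub>R rho k x))"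
    by (simp only: sum.distrib sum_subtractf sum_delta_scaleR scaleR_sum_right[symmetric])
  also have "\<dots> = (\<Sum>k\<in>UNIV. \<Sum>l\<in>UNIV. B k l *\<^sub>R rho j (rho k (rho l x))) + 4 *\<^sub>R (\<Sum>l\<in>UNIV. B j l *\<^sub>R rho l x)"
  proof -
    have "(\<Sum>k\<in>UNIV. 2 *\<^sub>R (B k j *\<^sub>R rho k x)) = (\<Sum>k\<in>UNIV. - (2 *\<^sub>R (B j k *\<^sub>R rho k x)))"
      by (intro sum.cong refl) (subst B, simp)
    also have "\<dots> = - 2 *\<^sub>R (\<Sum>k\<in>UNIV. B j k *\<^sub>R rho k x)"
      by (simp add: scaleR_sum_right sum_negf)
    finally show ?thesis unfolding sum_delta_scaleR by (simp add: scaleR_left_distrib[symmetric])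
  qed
  finally show ?thesis
    by (simp add: cl_def rho_simps scaleR_add_right)
qed

text \<open>By \<open>cl_rho\<close> the commutator with \<open>cl B\<close> acts as a derivation on
  products of two Clifford factors, so the commutator is again quadratic. It yields the quadratic
  part of the curvature of the connection forms.\<close>

lemma cl_commutator:
  assumes B: "\<And>j l. B j l = - B l j" and B': "\<And>j l. B' j l = - B' l j"
  shows "cl B (cl B' x) - cl B' (cl B x) = cl (\<lambda>l k. \<Sum>j\<in>UNIV. B' l j * B j k - B l j * B' j k) x"
proof -
  have 1: "cl B (rho j (rho k x)) = rho j (rho k (cl B x)) + (\<Sum>l\<in>UNIV. B k l *\<^sub>R rho j (rho l x)) + (\<Sum>l\<in>UNIV. B j l *\<^sub>R rho l (rho k x))" for j k
    by (simp add: cl_rho[OF B] rho_simps)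
  have "4 *\<^sub>R (cl B (cl B' x) - cl B' (cl B x)) =
    (\<Sum>j\<in>UNIV. \<Sum>k\<in>UNIV. B' j k *\<^sub>R cl B (rho j (rho k x))) - (\<Sum>j\<in>UNIV. \<Sum>k\<in>UNIV. B' j k *\<^sub>R rho j (rho k (cl B x)))"
    by (simp add: cl_def[of B' x] cl_def[of B' "cl B x"] cl_simps scaleR_diff_right)
  also have "\<dots> = (\<Sum>j\<in>UNIV. \<Sum>k\<in>UNIV. \<Sum>l\<in>UNIV. (B' j k * B k l) *\<^sub>R rho j (rho l x))
     + (\<Sum>j\<in>UNIV. \<Sum>k\<in>UNIV. \<Sum>l\<in>UNIV. (B' j k * B j l) *\<^sub>R rho l (rho k x))"
    unfolding 1 by (simp add: scaleR_add_right sum.distrib scaleR_sum_right)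
  also have "(\<Sum>j\<in>UNIV. \<Sum>k\<in>UNIV. \<Sum>l\<in>UNIV. (B' j k * B k l) *\<^sub>R rho j (rho l x))
     = (\<Sum>j\<in>UNIV. \<Sum>l\<in>UNIV. (\<Sum>k\<in>UNIV. B' j k * B k l) *\<^sub>R rho j (rho l x))"
    by (simp only: scaleR_sum_left) (intro sum.cong refl sum.swap)
  also have "(\<Sum>j\<in>UNIV. \<Sum>k\<in>UNIV. \<Sum>l\<in>UNIV. (B' j k * B j l) *\<^sub>R rho l (rho k x))
     = (\<Sum>l\<in>UNIV. \<Sum>k\<in>UNIV. \<Sum>j\<in>UNIV. (B' j k * B j l) *\<^sub>R rho l (rho k x))"
    by (rule sum_reverse3)
  also have "\<dots> = - (\<Sum>l\<in>UNIV. \<Sum>k\<in>UNIV. (\<Sum>j\<in>UNIV. B l j * B' j k) *\<^sub>R rho l (rho k x))"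
    unfolding scaleR_sum_left sum_negf[symmetric]
    by (intro sum.cong refl) (subst B, simp add: mult.commute)
  finally have "4 *\<^sub>R (cl B (cl B' x) - cl B' (cl B x)) = 4 *\<^sub>R cl (\<lambda>l k. \<Sum>j\<in>UNIV. B' l j * B j k - B l j * B' j k) x"
    by (simp add: cl_def sum_subtractf scaleR_diff_left)
  then show ?thesis by simp
qed

lemma cl_skew:
  assumes B: "\<And>j l. B j l = - B l j"
  shows "cl B x \<bullet> y = - (x \<bullet> cl B y)"
proof -
  have "(\<Sum>j\<in>UNIV. \<Sum>l\<in>UNIV. B j l * (rho j (rho l x) \<bullet> y)) = (\<Sum>j\<in>UNIV. \<Sum>l\<in>UNIV. B j l * (x \<bullet> rho l (rho j y)))"
    by (simp add: rho_skew)
  also have "\<dots> = (\<Sum>l\<in>UNIV. \<Sum>j\<in>UNIV. B j l * (x \<bullet> rho l (rho j y)))" by (rule sum.swap)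
  also have "\<dots> = - (\<Sum>j\<in>UNIV. \<Sum>l\<in>UNIV. B j l * (x \<bullet> rho j (rho l y)))"
    unfolding sum_negf[symmetric] by (intro sum.cong refl) (subst B, simp)
  finally show ?thesis by (simp add: cl_def inner_sum_left inner_sum_right)
qed

text \<open>Write T for the triple sum and U for the contracted one. After relabelling, the cyclic
  identity says that the three sums with cyclically rotated Clifford factors add up to zero.
  Rotating the factors back reproduces T up to contractions: one rotated sum is T + 4U, the other T
  + 2U. Hence 3T + 6U = 0.\<close>

lemma bianchi_rho3:
  assumes anti: "\<And>a b j. C a b j = - C b a j" and cyc: "\<And>a b j. C a b j + C b j a + C j a b = 0"
  shows "(\<Sum>a\<in>UNIV. \<Sum>b\<in>UNIV. \<Sum>j\<in>UNIV. C a b j *\<^sub>R rho a (rho b (rho j z)))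
    = - 2 *\<^sub>R (\<Sum>a\<in>UNIV. \<Sum>b\<in>UNIV. C a b b *\<^sub>R rho a z)"
proof -
  define F where "F a b j = rho a (rho b (rho j z))" for a b j
  define T where "T = (\<Sum>a\<in>UNIV. \<Sum>b\<in>UNIV. \<Sum>j\<in>UNIV. C a b j *\<^sub>R F a b j)"
  define U where "U = (\<Sum>a\<in>UNIV. \<Sum>b\<in>UNIV. C a b b *\<^sub>R rho a z)"
  have diag: "C a a j = 0" for a j using anti[of a a j] by simp
  have U': "(\<Sum>a\<in>UNIV. \<Sum>b\<in>UNIV. C a b a *\<^sub>R rho b z) = - U"
  proof -
    have "(\<Sum>a\<in>UNIV. \<Sum>b\<in>UNIV. C a b a *\<^sub>R rho b z) = (\<Sum>b\<in>UNIV. \<Sum>a\<in>UNIV. C a b a *\<^sub>R rho b z)"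
      by (rule sum.swap)
    also have "\<dots> = (\<Sum>b\<in>UNIV. \<Sum>a\<in>UNIV. - (C b a a *\<^sub>R rho b z))"
      by (intro sum.cong refl) (subst anti, simp)
    finally show ?thesis unfolding U_def by (simp add: sum_negf)
  qed
  have r1: "F j a b = F a b j + (if b = j then 2 else 0) *\<^sub>R rho a z - (if a = j then 2 else 0) *\<^sub>R rho b z" for a b j
    unfolding F_def using rho_move[of a b j z] by (simp add: algebra_simps)
  have r2: "F b j a = F a b j + (if b = a then 2 else 0) *\<^sub>R rho j z - (if j = a then 2 else 0) *\<^sub>R rho b z" for a b j
    unfolding F_def using rho_move[of b j a z] by simp
  \<comment> \<open>Renaming indices trades a rotation of the factors for a rotation of the indices
    of \<open>C\<close>.\<close>
  have T1: "(\<Sum>a\<in>UNIV. \<Sum>b\<in>UNIV. \<Sum>j\<in>UNIV. C a b j *\<^sub>R F j a b) = (\<Sum>a\<in>UNIV. \<Sum>b\<in>UNIV. \<Sum>j\<in>UNIV. C b j a *\<^sub>R F a b j)"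
    using sum_rotate3[of "\<lambda>a b j. C a b j *\<^sub>R F j a b"] by simp
  have T2: "(\<Sum>a\<in>UNIV. \<Sum>b\<in>UNIV. \<Sum>j\<in>UNIV. C a b j *\<^sub>R F b j a) = (\<Sum>a\<in>UNIV. \<Sum>b\<in>UNIV. \<Sum>j\<in>UNIV. C j a b *\<^sub>R F a b j)"
    using sum_rotate3[of "\<lambda>a b j. C j a b *\<^sub>R F a b j"] by simp
  have "(\<Sum>a\<in>UNIV. \<Sum>b\<in>UNIV. \<Sum>j\<in>UNIV. C a b j *\<^sub>R F j a b) = T + 2 *\<^sub>R U - 2 *\<^sub>R (\<Sum>a\<in>UNIV. \<Sum>b\<in>UNIV. C a b a *\<^sub>R rho b z)"
  proof -
    have "(\<Sum>a\<in>UNIV. \<Sum>b\<in>UNIV. \<Sum>j\<in>UNIV. C a b j *\<^sub>R F j a b) =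
      (\<Sum>a\<in>UNIV. \<Sum>b\<in>UNIV. \<Sum>j\<in>UNIV. C a b j *\<^sub>R F a b j + (if b = j then 2 else 0) *\<^sub>R (C a b j *\<^sub>R rho a z)
        - (if a = j then 2 else 0) *\<^sub>R (C a b j *\<^sub>R rho b z))"
      by (intro sum.cong refl, subst r1) (simp add: scaleR_add_right scaleR_diff_right mult.commute)
    then show ?thesis unfolding T_def U_def
      by (simp only: sum.distrib sum_subtractf sum_delta_scaleR scaleR_sum_right)
  qed
  moreover have "(\<Sum>a\<in>UNIV. \<Sum>b\<in>UNIV. \<Sum>j\<in>UNIV. C a b j *\<^sub>R F b j a) = T - 2 *\<^sub>R (\<Sum>a\<in>UNIV. \<Sum>b\<in>UNIV. C a b a *\<^sub>R rho b z)"
  proof -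
    have "(\<Sum>a\<in>UNIV. \<Sum>b\<in>UNIV. \<Sum>j\<in>UNIV. C a b j *\<^sub>R F b j a) =
      (\<Sum>a\<in>UNIV. \<Sum>b\<in>UNIV. \<Sum>j\<in>UNIV. C a b j *\<^sub>R F a b j + (if b = a then 2 else 0) *\<^sub>R (C a b j *\<^sub>R rho j z)
        - (if j = a then 2 else 0) *\<^sub>R (C a b j *\<^sub>R rho b z))"
      by (intro sum.cong refl, subst r2) (simp add: scaleR_add_right scaleR_diff_right mult.commute)
    also have "\<dots> = T + (\<Sum>a\<in>UNIV. \<Sum>b\<in>UNIV. (if b = a then 2 else 0) *\<^sub>R (\<Sum>j\<in>UNIV. C a b j *\<^sub>R rho j z)) - 2 *\<^sub>R (\<Sum>a\<in>UNIV. \<Sum>b\<in>UNIV. C a b a *\<^sub>R rho b z)"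
      unfolding T_def by (simp only: sum.distrib sum_subtractf sum_delta_scaleR scaleR_sum_right)
    also have "(\<Sum>a\<in>UNIV. \<Sum>b\<in>UNIV. (if b = a then 2 else 0) *\<^sub>R (\<Sum>j\<in>UNIV. C a b j *\<^sub>R rho j z)) = 0"
      unfolding sum_delta_scaleR by (simp add: diag)
    finally show ?thesis by simp
  qed
  moreover have "T + (\<Sum>a\<in>UNIV. \<Sum>b\<in>UNIV. \<Sum>j\<in>UNIV. C a b j *\<^sub>R F j a b) + (\<Sum>a\<in>UNIV. \<Sum>b\<in>UNIV. \<Sum>j\<in>UNIV. C a b j *\<^sub>R F b j a) = 0"
    unfolding T1 T2 T_def sum.distrib[symmetric] scaleR_add_left[symmetric] cyc by simp
  moreover have "3 *\<^sub>R T = T + T + T"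
  proof -
    have "3 *\<^sub>R T = (1 + 1 + 1 :: real) *\<^sub>R T" by simp
    then show ?thesis by (simp only: scaleR_add_left scaleR_one)
  qed
  moreover have "6 *\<^sub>R U = 2 *\<^sub>R U + 2 *\<^sub>R U + 2 *\<^sub>R U"
    by (simp only: scaleR_add_left[symmetric]) simp
  ultimately have "3 *\<^sub>R T + 6 *\<^sub>R U = 0" unfolding U' by (simp add: algebra_simps)
  then have "3 *\<^sub>R (T + 2 *\<^sub>R U) = 0" by (simp add: scaleR_add_right)
  then have "T = - 2 *\<^sub>R U" by (simp add: add_eq_0_iff2)
  then show ?thesis unfolding T_def U_def F_def .
qed

text \<open>The Bianchi identity reduces the sum to the Ricci contraction, whose skew part drops out of the
  inner product with \<open>x\<close>.\<close>

lemma bianchi_rho4_inner: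
  assumes anti: "\<And>a b j l. R a b j l = - R b a j l" and cyc: "\<And>a b j l. R a b j l + R b j a l + R j a b l = 0"
  shows "(\<Sum>a\<in>UNIV. \<Sum>b\<in>UNIV. \<Sum>j\<in>UNIV. \<Sum>l\<in>UNIV. R a b j l * (rho a (rho b (rho j (rho l x))) \<bullet> x))
    = 2 * (\<Sum>a\<in>UNIV. \<Sum>b\<in>UNIV. R a b b a) * (x \<bullet> x)"
proof -
  \<comment> \<open>The last index is made outermost, so that for fixed \<open>l\<close> the inner
    triple sum is the one of \<open>bianchi_rho3\<close> with \<open>rho l x\<close> in the place of
    \<open>z\<close>.\<close>
  have "(\<Sum>a\<in>UNIV. \<Sum>b\<in>UNIV. \<Sum>j\<in>UNIV. \<Sum>l\<in>UNIV. R a b j l * (rho a (rho b (rho j (rho l x))) \<bullet> x))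
    = (\<Sum>l\<in>UNIV. \<Sum>a\<in>UNIV. \<Sum>b\<in>UNIV. \<Sum>j\<in>UNIV. R a b j l * (rho a (rho b (rho j (rho l x))) \<bullet> x))"
    by (rule sum_last_first4)
  also have "\<dots> = (\<Sum>l\<in>UNIV. (\<Sum>a\<in>UNIV. \<Sum>b\<in>UNIV. \<Sum>j\<in>UNIV. R a b j l *\<^sub>R rho a (rho b (rho j (rho l x)))) \<bullet> x)"
    by (simp add: inner_sum_left)
  also have "\<dots> = (\<Sum>l\<in>UNIV. (- 2 *\<^sub>R (\<Sum>a\<in>UNIV. \<Sum>b\<in>UNIV. R a b b l *\<^sub>R rho a (rho l x))) \<bullet> x)"
    using bianchi_rho3[of "\<lambda>a b j. R a b j _", OF anti cyc] by (intro sum.cong refl) simp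
  also have "\<dots> = (\<Sum>l\<in>UNIV. 2 * (\<Sum>a\<in>UNIV. (if a = l then 1 else 0) *\<^sub>R (\<Sum>b\<in>UNIV. R a b b l * (x \<bullet> x))))"
  proof (intro sum.cong refl)
    fix l
    have "rho a (rho l x) \<bullet> x = - (if a = l then x \<bullet> x else 0)" for a
      by (simp only: rho_skew[of a] rho_rho_inner) (simp split: if_splits)
    then show "(- 2 *\<^sub>R (\<Sum>a\<in>UNIV. \<Sum>b\<in>UNIV. R a b b l *\<^sub>R rho a (rho l x))) \<bullet> x
      = 2 * (\<Sum>a\<in>UNIV. (if a = l then 1 else 0) *\<^sub>R (\<Sum>b\<in>UNIV. R a b b l * (x \<bullet> x)))"
      by (simp add: inner_sum_left sum_distrib_left sum_negf[symmetric]) (auto intro!: sum.cong)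
  qed
  also have "\<dots> = 2 * (\<Sum>a\<in>UNIV. \<Sum>b\<in>UNIV. R a b b a) * (x \<bullet> x)"
    unfolding sum_delta_scaleR by (simp add: sum_distrib_left sum_distrib_right mult_ac)
  finally show ?thesis .
qed

end

section \<open>The Lichnerowicz formula at a maximum of the spinor norm\<close>

text \<open>All geometric data transported to an open set of a Euclidean space by a chart and a
  local section. \<open>Gam\<close> enters through symmetry and metric compatibility, which
  characterise the Levi-Civita connection, and \<i> times \<open>a\<close> is the pulled back
  connection form.\<close>

locale spinor_coordinates = clifford_module rho J
  for rho :: "'n::finite \<Rightarrow> 'v::euclidean_space \<Rightarrow> 'v" and J :: "'v \<Rightarrow> 'v" +
  fixes V :: "'a::euclidean_space set" and G :: "'a \<Rightarrow> 'a \<Rightarrow> 'a \<Rightarrow> real" and Gam :: "'a \<Rightarrow> 'a \<Rightarrow> 'a \<Rightarrow> 'a"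
    and E :: "'n \<Rightarrow> 'a \<Rightarrow> 'a" and s :: "'a \<Rightarrow> 'v" and a :: "'a \<Rightarrow> 'a \<Rightarrow> real"
  assumes open_V: "open V"
    and smooth_G: "smooth_on V (\<lambda>y. G y u v)"
    and linear_G: "y \<in> V \<Longrightarrow> linear (G y u)"
    and sym_G: "y \<in> V \<Longrightarrow> G y u v = G y v u"
    and smooth_Gam: "smooth_on V (\<lambda>y. Gam y u v)"
    and linear_Gam: "y \<in> V \<Longrightarrow> linear (Gam y u)"
    and sym_Gam: "y \<in> V \<Longrightarrow> Gam y u v = Gam y v u"
    and compat: "y \<in> V \<Longrightarrow> fderiv (\<lambda>y. G y u v) y w = G y (Gam y w u) v + G y u (Gam y w v)"
    and smooth_E: "smooth_on V (E i)"
    and ortho_E: "y \<in> V \<Longrightarrow> G y (E i y) (E j y) = (if i = j then 1 else 0)"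
    and span_E: "y \<in> V \<Longrightarrow> v = (\<Sum>i\<in>UNIV. G y v (E i y) *\<^sub>R E i y)"
    and smooth_s: "smooth_on V s"
    and smooth_a: "smooth_on V (\<lambda>y. a y v)"
    and linear_a: "y \<in> V \<Longrightarrow> linear (a y)"
begin

lemma linear_G': "y \<in> V \<Longrightarrow> linear (\<lambda>u. G y u v)"
  using linear_G[of y v] sym_G[of y _ v] by simp

lemma linear_Gam': "y \<in> V \<Longrightarrow> linear (\<lambda>u. Gam y u v)"
  using linear_Gam[of y v] sym_Gam[of y _ v] by simp

lemma smooth_G_fields: "smooth_on V X \<Longrightarrow> smooth_on V Y \<Longrightarrow> smooth_on V (\<lambda>y. G y (X y) (Y y))"
  by (rule smooth_on_linear_field[where P="\<lambda>y v. G y (X y) v"], erule linear_G)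
    (auto intro: smooth_on_linear_field[where P="\<lambda>y u. G y u v" for v] linear_G' smooth_G)

lemma smooth_Gam_field: "smooth_on V Y \<Longrightarrow> smooth_on V (\<lambda>y. Gam y u (Y y))"
  by (rule smooth_on_linear_field[where P="\<lambda>y v. Gam y u v"]) (auto intro: linear_Gam smooth_Gam)

lemma fderiv_G_fields:
  assumes y: "y \<in> V" and X: "smooth_on V X" and Y: "smooth_on V Y"
  shows "fderiv (\<lambda>y. G y (X y) (Y y)) y w
    = G y (fderiv X y w + Gam y w (X y)) (Y y) + G y (X y) (fderiv Y y w + Gam y w (Y y))"
proof -
  have "fderiv (\<lambda>x. G x (X x) (Y x)) y w = fderiv (\<lambda>x. G x (X x) (Y y)) y w + G y (X y) (fderiv Y y w)"
    by (rule fderiv_linear_field(1)[OF open_V y, where P="\<lambda>x v. G x (X x) v"])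
      (auto intro!: linear_G smooth_on_differentiable[OF _ y] smooth_G_fields X Y smooth_on_const open_V)
  also have "fderiv (\<lambda>x. G x (X x) (Y y)) y w = fderiv (\<lambda>x. G x (X y) (Y y)) y w + G y (fderiv X y w) (Y y)"
    by (rule fderiv_linear_field(1)[OF open_V y, where P="\<lambda>x u. G x u (Y y)"])
      (auto intro: linear_G' smooth_on_differentiable[OF _ y] smooth_G X)
  finally show ?thesis
    by (simp add: compat[OF y] linear_add[OF linear_G[OF y]] linear_add[OF linear_G'[OF y]])
qed

text \<open>\<open>om y u j l = g(\<nabla>\<^sub>u e\<^sub>j, e\<^sub>l)\<close> are the connection forms of the frame, \<open>W y u\<close> is the induced
  zeroth order part of the spinor connection, and \<open>P y u\<close>, \<open>H y u v\<close>, \<open>Rm y u v j l\<close> stand for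
  \<open>\<nabla>\<^sub>u s\<close>, \<open>\<nabla>\<^sup>2\<^sub>u\<^sub>,\<^sub>v s\<close> and \<open>g(R(u,v)e\<^sub>j, e\<^sub>l)\<close>.\<close>

definition om :: "'a \<Rightarrow> 'a \<Rightarrow> 'n \<Rightarrow> 'n \<Rightarrow> real" where
  "om y u j l = G y (fderiv (E j) y u + Gam y u (E j y)) (E l y)"

definition W :: "'a \<Rightarrow> 'a \<Rightarrow> 'v \<Rightarrow> 'v" where
  "W y u x = cl (om y u) x + (a y u / 2) *\<^sub>R J x"

definition P :: "'a \<Rightarrow> 'a \<Rightarrow> 'v" where
  "P y u = fderiv s y u + W y u (s y)"

definition H :: "'a \<Rightarrow> 'a \<Rightarrow> 'a \<Rightarrow> 'v" where
  "H y u v = fderiv (\<lambda>y. P y v) y u + W y u (P y v) - P y (Gam y u v)"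

text \<open>The curvature R(u,v)w evaluated on constant fields, whose Lie brackets vanish.\<close>

definition Riem :: "'a \<Rightarrow> 'a \<Rightarrow> 'a \<Rightarrow> 'a \<Rightarrow> 'a" where
  "Riem y u v w = fderiv (\<lambda>y. Gam y v w) y u - fderiv (\<lambda>y. Gam y u w) y v
     + Gam y u (Gam y v w) - Gam y v (Gam y u w)"

definition Rm :: "'a \<Rightarrow> 'a \<Rightarrow> 'a \<Rightarrow> 'n \<Rightarrow> 'n \<Rightarrow> real" where
  "Rm y u v j l = fderiv (\<lambda>y. om y v j l) y u - fderiv (\<lambda>y. om y u j l) y v
     + (\<Sum>p\<in>UNIV. om y v j p * om y u p l - om y u j p * om y v p l)"

text \<open>The exterior derivative of \<open>a\<close> on constant fields, which later becomes
  \<Omega> in coordinates.\<close>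

definition da :: "'a \<Rightarrow> 'a \<Rightarrow> 'a \<Rightarrow> real" where
  "da y u v = fderiv (\<lambda>y. a y v) y u - fderiv (\<lambda>y. a y u) y v"

lemma om_antisym: "y \<in> V \<Longrightarrow> om y u j l = - om y u l j"
proof -
  assume y: "y \<in> V"
  have "fderiv (\<lambda>y. G y (E j y) (E l y)) y = fderiv (\<lambda>y. if j = l then 1 else 0) y"
    by (rule fderiv_cong_open[OF open_V y]) (simp add: ortho_E)
  then have "fderiv (\<lambda>y. G y (E j y) (E l y)) y u = 0" by simp
  then show ?thesis
    unfolding om_def fderiv_G_fields[OF y smooth_E smooth_E] using sym_G[OF y] by (simp add: add_eq_0_iff)
qed

lemma fderiv_E: "y \<in> V \<Longrightarrow> fderiv (E j) y u = (\<Sum>l\<in>UNIV. om y u j l *\<^sub>R E l y) - Gam y u (E j y)"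
  using span_E[of y "fderiv (E j) y u + Gam y u (E j y)"] unfolding om_def by (simp add: algebra_simps)

lemma smooth_om: "smooth_on V (\<lambda>y. om y u j l)"
  unfolding om_def by (intro smooth_G_fields smooth_on_add smooth_on_fderiv smooth_E smooth_Gam_field)

lemma linear_om:
  assumes y: "y \<in> V"
  shows "om y (u + v) = (\<lambda>j l. om y u j l + om y v j l)" "om y (r *\<^sub>R u) = (\<lambda>j l. r * om y u j l)"
  unfolding om_def
  by (auto simp: fun_eq_iff linear_add[OF smooth_on_linear_fderiv[OF smooth_E y]] linear_cmul[OF smooth_on_linear_fderiv[OF smooth_E y]]
      linear_add[OF linear_Gam'[OF y]] linear_cmul[OF linear_Gam'[OF y]] linear_add[OF linear_G'[OF y]]
      linear_cmul[OF linear_G'[OF y]] algebra_simps)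

lemma linear_W: "linear (W y u)"
  unfolding W_def by (rule linearI) (simp_all add: cl_simps J_simps algebra_simps)

lemmas W_simps = linear_add[OF linear_W] linear_diff[OF linear_W] linear_cmul[OF linear_W]
  linear_neg[OF linear_W] linear_sum[OF linear_W] linear_0[OF linear_W]

lemma linear_W': "y \<in> V \<Longrightarrow> linear (\<lambda>u. W y u x)"
  unfolding W_def
  by (rule linearI) (simp_all add: linear_om cl_add cl_scale linear_add[OF linear_a] linear_cmul[OF linear_a] add_divide_distrib algebra_simps)

text \<open>Clifford multiplication is parallel: the commutator of the connection term with
  \<open>rho j\<close> is Clifford multiplication by the covariant derivative of the j-th frame
  vector. The \<open>J\<close> part commutes with \<open>rho j\<close> and contributes
  nothing.\<close>

lemma W_rho: "y \<in> V \<Longrightarrow> W y u (rho j x) = rho j (W y u x) + (\<Sum>l\<in>UNIV. om y u j l *\<^sub>R rho l x)"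
  unfolding W_def using cl_rho[of "om y u", OF om_antisym] by (simp add: rho_simps J_rho)

lemma W_skew: "y \<in> V \<Longrightarrow> W y u x \<bullet> z = - (x \<bullet> W y u z)"
  unfolding W_def using cl_skew[of "om y u", OF om_antisym] by (simp add: inner_add_left inner_add_right J_skew)

lemma linear_P: "y \<in> V \<Longrightarrow> linear (P y)"
  unfolding P_def by (intro linear_compose_add smooth_on_linear_fderiv[OF smooth_s] linear_W')

lemma smooth_cl: "smooth_on V x \<Longrightarrow> smooth_on V (\<lambda>y. cl (om y v) (x y))"
  unfolding cl_def
  by (intro smooth_on_scaleR smooth_on_const open_V smooth_on_sum smooth_om
      smooth_on_linear[OF bounded_linear_rho])

lemma smooth_P: "smooth_on V (\<lambda>y. P y v)"
  unfolding P_def W_def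
  by (intro smooth_on_add smooth_on_fderiv smooth_s smooth_cl smooth_on_scaleR smooth_on_linear[OF bounded_linear_divide] smooth_a
      smooth_on_linear[OF bounded_linear_J])

lemma fderiv_rho: "f differentiable (at y) \<Longrightarrow> fderiv (\<lambda>y. rho j (f y)) y u = rho j (fderiv f y u)"
  by (rule fderiv_linear[OF bounded_linear_rho])

text \<open>The covariant derivative of the eigenvalue equation. The connection forms appear once
  from commuting \<open>W\<close> with Clifford multiplication and once from differentiating the
  frame inside \<open>P\<close>; the two contributions cancel, as if the frame were parallel at
  \<open>y\<close>.\<close>

lemma dirac_derivative:
  assumes dirac: "\<And>y. y \<in> V \<Longrightarrow> (\<Sum>j\<in>UNIV. rho j (P y (E j y))) = lam *\<^sub>R s y" and y: "y \<in> V"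
  shows "lam *\<^sub>R P y m = (\<Sum>j\<in>UNIV. rho j (H y m (E j y)))"
proof -
  have diffP: "(\<lambda>y. P y (E j y)) differentiable (at y)" for j
    by (rule fderiv_linear_field(2)[OF open_V y])
      (auto intro: linear_P smooth_on_differentiable[OF smooth_P y] smooth_on_differentiable[OF smooth_E y])
  have dP: "fderiv (\<lambda>y. P y (E j y)) y m = fderiv (\<lambda>x. P x (E j y)) y m + P y (fderiv (E j) y m)" for j
    by (rule fderiv_linear_field(1)[OF open_V y])
      (auto intro: linear_P smooth_on_differentiable[OF smooth_P y] smooth_on_differentiable[OF smooth_E y])
  have diffr: "(\<lambda>y. rho j (P y (E j y))) differentiable (at y)" for j
    by (rule differentiableI, rule bounded_linear.has_derivative[OF bounded_linear_rho])
      (rule fderiv_works[OF diffP])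
  have "lam *\<^sub>R fderiv s y m = fderiv (\<lambda>y. lam *\<^sub>R s y) y m"
    by (rule fderiv_linear[symmetric]) (auto intro: bounded_linear_scaleR_right smooth_on_differentiable[OF smooth_s y])
  also have "fderiv (\<lambda>y. lam *\<^sub>R s y) y = fderiv (\<lambda>y. \<Sum>j\<in>UNIV. rho j (P y (E j y))) y"
    by (rule fderiv_cong_open[OF open_V y]) (simp add: dirac)
  also have "\<dots> m = (\<Sum>j\<in>UNIV. rho j (fderiv (\<lambda>x. P x (E j y)) y m + P y (fderiv (E j) y m)))"
    by (simp add: fderiv_sum[OF diffr] fderiv_rho[OF diffP] dP)
  finally have 1: "lam *\<^sub>R fderiv s y m = (\<Sum>j\<in>UNIV. rho j (fderiv (\<lambda>x. P x (E j y)) y m + P y (fderiv (E j) y m)))" .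
  have 2: "lam *\<^sub>R W y m (s y) = (\<Sum>j\<in>UNIV. rho j (W y m (P y (E j y))) + (\<Sum>l\<in>UNIV. om y m j l *\<^sub>R rho l (P y (E j y))))"
    using arg_cong[OF dirac[OF y], of "W y m"] by (simp add: W_simps W_rho[OF y])
  have Pl: "P y (fderiv (E j) y m) = (\<Sum>l\<in>UNIV. om y m j l *\<^sub>R P y (E l y)) - P y (Gam y m (E j y))" for j
    unfolding fderiv_E[OF y] by (simp add: linear_diff[OF linear_P[OF y]] linear_sum[OF linear_P[OF y]] linear_cmul[OF linear_P[OF y]])
  \<comment> \<open>Exchanging the two indices costs a sign because the connection forms are skew;
    this is the cancellation.\<close>
  have 3: "(\<Sum>j\<in>UNIV. \<Sum>l\<in>UNIV. om y m j l *\<^sub>R rho l (P y (E j y))) = - (\<Sum>j\<in>UNIV. \<Sum>l\<in>UNIV. om y m j l *\<^sub>R rho j (P y (E l y)))"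
    unfolding sum_negf[symmetric]
    by (subst sum.swap, intro sum.cong refl) (subst om_antisym[OF y], simp)
  have "lam *\<^sub>R P y m = lam *\<^sub>R fderiv s y m + lam *\<^sub>R W y m (s y)" by (simp add: P_def scaleR_add_right)
  also have "\<dots> = (\<Sum>j\<in>UNIV. rho j (H y m (E j y)))"
    unfolding 1 2 Pl H_def using 3
    by (simp add: rho_simps sum.distrib sum_subtractf)
  finally show ?thesis .
qed

text \<open>Applying the Dirac operator twice gives a double sum of second covariant derivatives.
  The Clifford relation splits it into its symmetric part, the trace of the Hessian, and its skew
  part, the commutator of second derivatives.\<close>

lemma dirac_squared:
  assumes dirac: "\<And>y. y \<in> V \<Longrightarrow> (\<Sum>j\<in>UNIV. rho j (P y (E j y))) = lam *\<^sub>R s y" and y: "y \<in> V"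
  shows "lam\<^sup>2 *\<^sub>R s y = - (\<Sum>l\<in>UNIV. H y (E l y) (E l y))
    + (1/2) *\<^sub>R (\<Sum>l\<in>UNIV. \<Sum>j\<in>UNIV. rho l (rho j (H y (E l y) (E j y) - H y (E j y) (E l y))))"
proof -
  define X where "X = (\<Sum>l\<in>UNIV. \<Sum>j\<in>UNIV. rho l (rho j (H y (E l y) (E j y))))"
  have X: "lam\<^sup>2 *\<^sub>R s y = X"
  proof -
    have "lam\<^sup>2 *\<^sub>R s y = (\<Sum>l\<in>UNIV. rho l (lam *\<^sub>R P y (E l y)))"
      using dirac[OF y] by (simp add: rho_simps scaleR_sum_right[symmetric] power2_eq_square)
    moreover have "lam *\<^sub>R P y m = (\<Sum>j\<in>UNIV. rho j (H y m (E j y)))" for m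
      by (rule dirac_derivative[OF _ y]) (rule dirac)
    ultimately have "lam\<^sup>2 *\<^sub>R s y = X" unfolding X_def by (simp only: rho_simps)
    then show ?thesis .
  qed
  have "X = (\<Sum>l\<in>UNIV. \<Sum>j\<in>UNIV. rho j (rho l (H y (E j y) (E l y))))"
    unfolding X_def by (rule sum.swap)
  also have "\<dots> = (\<Sum>l\<in>UNIV. \<Sum>j\<in>UNIV. - rho l (rho j (H y (E j y) (E l y))) - (if j = l then 2 else 0) *\<^sub>R H y (E j y) (E l y))"
    by (intro sum.cong refl rho_swap)
  also have "\<dots> = - (\<Sum>l\<in>UNIV. \<Sum>j\<in>UNIV. rho l (rho j (H y (E j y) (E l y)))) - 2 *\<^sub>R (\<Sum>l\<in>UNIV. H y (E l y) (E l y))"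
    by (simp add: sum_subtractf sum_delta_scaleR sum_negf scaleR_sum_right)
  finally have X2: "X = - (\<Sum>l\<in>UNIV. \<Sum>j\<in>UNIV. rho l (rho j (H y (E j y) (E l y)))) - 2 *\<^sub>R (\<Sum>l\<in>UNIV. H y (E l y) (E l y))" .
  \<comment> \<open>Only one of the two copies is rewritten by the Clifford relation; the other
    supplies the second half of the commutator.\<close>
  have "2 *\<^sub>R X = X + X" by (rule scaleR_2)
  also have "\<dots> = (\<Sum>l\<in>UNIV. \<Sum>j\<in>UNIV. rho l (rho j (H y (E l y) (E j y) - H y (E j y) (E l y)))) - 2 *\<^sub>R (\<Sum>l\<in>UNIV. H y (E l y) (E l y))"
    by (subst (2) X2) (simp add: X_def rho_simps sum_subtractf)
  finally have "(1/2) *\<^sub>R (2 *\<^sub>R X) = (1/2) *\<^sub>R ((\<Sum>l\<in>UNIV. \<Sum>j\<in>UNIV. rho l (rho j (H y (E l y) (E j y) - H y (E j y) (E l y)))) - 2 *\<^sub>R (\<Sum>l\<in>UNIV. H y (E l y) (E l y)))"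
    by simp
  then show ?thesis unfolding X by (simp add: scaleR_diff_right)
qed

lemma fderiv_cl:
  assumes y: "y \<in> V" and x: "smooth_on V x"
  shows "fderiv (\<lambda>y. cl (om y v) (x y)) y u = cl (\<lambda>j l. fderiv (\<lambda>y. om y v j l) y u) (x y) + cl (om y v) (fderiv x y u)"
proof -
  note d = smooth_on_differentiable[OF _ y]
  have sr: "smooth_on V (\<lambda>y. rho j (rho l (x y)))" for j l
    by (intro smooth_on_linear[OF bounded_linear_rho] x)
  have dr: "fderiv (\<lambda>y. rho j (rho l (x y))) y u = rho j (rho l (fderiv x y u))" for j l
    by (simp add: fderiv_rho d smooth_on_linear[OF bounded_linear_rho] x)
  have "fderiv (\<lambda>y. cl (om y v) (x y)) y u
     = (1/4) *\<^sub>R fderiv (\<lambda>y. \<Sum>j\<in>UNIV. \<Sum>l\<in>UNIV. om y v j l *\<^sub>R rho j (rho l (x y))) y u"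
    unfolding cl_def
    by (rule fderiv_linear[OF bounded_linear_scaleR_right]) (intro d smooth_on_sum open_V smooth_on_scaleR smooth_om sr)
  also have "fderiv (\<lambda>y. \<Sum>j\<in>UNIV. \<Sum>l\<in>UNIV. om y v j l *\<^sub>R rho j (rho l (x y))) y u
     = (\<Sum>j\<in>UNIV. \<Sum>l\<in>UNIV. fderiv (\<lambda>y. om y v j l *\<^sub>R rho j (rho l (x y))) y u)"
    by (subst fderiv_sum, intro d smooth_on_sum open_V smooth_on_scaleR smooth_om sr)
      (intro sum.cong refl fderiv_sum d smooth_on_scaleR smooth_om sr)
  also have "\<dots> = (\<Sum>j\<in>UNIV. \<Sum>l\<in>UNIV. om y v j l *\<^sub>R rho j (rho l (fderiv x y u)) + fderiv (\<lambda>y. om y v j l) y u *\<^sub>R rho j (rho l (x y)))"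
    by (subst fderiv_bilinear[OF bounded_bilinear_scaleR d[OF smooth_om] d[OF sr]]) (simp add: dr)
  finally show ?thesis by (simp add: cl_def sum.distrib scaleR_add_right add.commute)
qed

text \<open>In the commutator the second derivatives of \<open>s\<close> cancel by symmetry and the
  terms with \<open>Gam\<close> by torsion-freeness, while the terms with first derivatives of
  \<open>s\<close> occur symmetrically in \<open>u\<close> and \<open>v\<close>. The derivatives of
  the connection forms and the commutator of the \<open>cl\<close> terms assemble to
  \<open>Rm\<close>. The \<open>J\<close> part is abelian and leaves only \<open>da\<close>.\<close>

lemma curvature_H:
  assumes y: "y \<in> V"
  shows "H y u v - H y v u = cl (Rm y u v) (s y) + (da y u v / 2) *\<^sub>R J (s y)"
proof -
  note d = smooth_on_differentiable[OF _ y]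
  note bJ = bounded_linear_J
  have DP: "fderiv (\<lambda>y. P y v) y u = fderiv (\<lambda>y. fderiv s y v) y u
      + (cl (\<lambda>j l. fderiv (\<lambda>y. om y v j l) y u) (s y) + cl (om y v) (fderiv s y u))
      + ((a y v / 2) *\<^sub>R J (fderiv s y u) + (fderiv (\<lambda>y. a y v) y u / 2) *\<^sub>R J (s y))" for u v
  proof -
    have sJ: "smooth_on V (\<lambda>y. J (s y))" by (rule smooth_on_linear[OF bJ smooth_s])
    have sa: "smooth_on V (\<lambda>y. a y v / 2)" by (rule smooth_on_linear[OF bounded_linear_divide smooth_a])
    have "fderiv (\<lambda>y. P y v) y u = fderiv (\<lambda>y. fderiv s y v) y u
      + (fderiv (\<lambda>y. cl (om y v) (s y)) y u + fderiv (\<lambda>y. (a y v / 2) *\<^sub>R J (s y)) y u)"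
      unfolding P_def W_def
      by (subst fderiv_add, (intro d smooth_on_add smooth_on_fderiv smooth_s smooth_cl smooth_on_scaleR sa sJ)+,
          subst fderiv_add, (intro d smooth_on_add smooth_on_fderiv smooth_s smooth_cl smooth_on_scaleR sa sJ)+) simp
    also have "fderiv (\<lambda>y. (a y v / 2) *\<^sub>R J (s y)) y u = (a y v / 2) *\<^sub>R J (fderiv s y u) + (fderiv (\<lambda>y. a y v) y u / 2) *\<^sub>R J (s y)"
      by (subst fderiv_bilinear[OF bounded_bilinear_scaleR d[OF sa] d[OF sJ]])
        (simp add: fderiv_linear[OF bJ d[OF smooth_s]] fderiv_linear[OF bounded_linear_divide d[OF smooth_a]])
    finally show ?thesis by (simp add: fderiv_cl[OF y smooth_s])
  qed
  have sym2: "fderiv (\<lambda>y. fderiv s y v) y u = fderiv (\<lambda>y. fderiv s y u) y v"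
    by (rule second_fderiv_symmetric[OF smooth_s y])
  have comm: "cl (om y u) (cl (om y v) x) = cl (om y v) (cl (om y u) x)
     + cl (\<lambda>j l. \<Sum>p\<in>UNIV. om y v j p * om y u p l - om y u j p * om y v p l) x" for x
    using cl_commutator[of "om y u" "om y v" x, OF om_antisym[OF y] om_antisym[OF y]] by (simp add: algebra_simps)
  have R: "cl (Rm y u v) x = cl (\<lambda>j l. fderiv (\<lambda>y. om y v j l) y u) x - cl (\<lambda>j l. fderiv (\<lambda>y. om y u j l) y v) x
     + cl (\<lambda>j l. \<Sum>p\<in>UNIV. om y v j p * om y u p l - om y u j p * om y v p l) x" for x
    unfolding Rm_def cl_add cl_diff by simp
  have WW: "W y u (P y v) = cl (om y u) (fderiv s y v) + cl (om y u) (cl (om y v) (s y)) + (a y v / 2) *\<^sub>R cl (om y u) (J (s y))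
     + (a y u / 2) *\<^sub>R J (fderiv s y v) + (a y u / 2) *\<^sub>R cl (om y v) (J (s y)) + (a y u / 2 * (a y v / 2)) *\<^sub>R J (J (s y))" for u v
    unfolding P_def W_def by (simp add: cl_simps J_simps J_cl scaleR_add_right)
  have G: "P y (Gam y u v) = P y (Gam y v u)" using sym_Gam[OF y] by simp
  show ?thesis
    unfolding H_def G DP WW R da_def sym2 comm
    by (simp add: algebra_simps add_divide_distrib diff_divide_distrib)
qed

text \<open>Cartan's second structure equation. The second derivatives of a frame vector, computed
  from \<open>fderiv_E\<close>, must be symmetric, and this is the claimed relation between the
  connection forms and the Christoffel map.\<close>

lemma Rm_eq_Riem:
  assumes y: "y \<in> V"
  shows "Rm y u v j l = G y (Riem y u v (E j y)) (E l y)"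
proof -
  note d = smooth_on_differentiable[OF _ y]
  have GE: "fderiv (\<lambda>y. Gam y v (E j y)) y u = fderiv (\<lambda>x. Gam x v (E j y)) y u + Gam y v (fderiv (E j) y u)" for u v
    by (rule fderiv_linear_field(1)[OF open_V y, where P="\<lambda>x. Gam x v"])
      (auto intro: linear_Gam d smooth_Gam smooth_E)
  define S where "S u v = (\<Sum>p\<in>UNIV. fderiv (\<lambda>y. om y v j p) y u *\<^sub>R E p y) + (\<Sum>l\<in>UNIV. (\<Sum>p\<in>UNIV. om y v j p * om y u p l) *\<^sub>R E l y)
     - fderiv (\<lambda>x. Gam x v (E j y)) y u + Gam y v (Gam y u (E j y))" for u v
  \<comment> \<open>The mixed terms of connection forms and \<open>Gam\<close>. They occur only as
    \<open>Q u v\<close> plus \<open>Q v u\<close> and drop out when the two orders of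
    differentiation are compared.\<close>
  define Q where "Q u v = (\<Sum>p\<in>UNIV. om y v j p *\<^sub>R Gam y u (E p y))" for u v
  have D2: "fderiv (\<lambda>y. fderiv (E j) y v) y u = S u v - Q u v - Q v u" for u v
  proof -
    have "fderiv (\<lambda>y. fderiv (E j) y v) y u = fderiv (\<lambda>y. (\<Sum>p\<in>UNIV. om y v j p *\<^sub>R E p y) - Gam y v (E j y)) y u"
      by (rule fun_cong[OF fderiv_cong_open[OF open_V y]]) (rule fderiv_E)
    also have "\<dots> = (\<Sum>p\<in>UNIV. fderiv (\<lambda>y. om y v j p *\<^sub>R E p y) y u) - fderiv (\<lambda>y. Gam y v (E j y)) y u"
      by (subst fderiv_diff, (intro d smooth_on_sum open_V smooth_on_scaleR smooth_om smooth_E smooth_Gam_field)+,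
          subst fderiv_sum, (intro d smooth_on_scaleR smooth_om smooth_E)+) simp
    also have "(\<Sum>p\<in>UNIV. fderiv (\<lambda>y. om y v j p *\<^sub>R E p y) y u)
      = (\<Sum>p\<in>UNIV. om y v j p *\<^sub>R fderiv (E p) y u) + (\<Sum>p\<in>UNIV. fderiv (\<lambda>y. om y v j p) y u *\<^sub>R E p y)"
      by (subst fderiv_bilinear[OF bounded_bilinear_scaleR d[OF smooth_om] d[OF smooth_E]]) (simp add: sum.distrib)
    also have "(\<Sum>p\<in>UNIV. om y v j p *\<^sub>R fderiv (E p) y u)
      = (\<Sum>l\<in>UNIV. (\<Sum>p\<in>UNIV. om y v j p * om y u p l) *\<^sub>R E l y) - Q u v"
    proof -
      have "(\<Sum>p\<in>UNIV. om y v j p *\<^sub>R fderiv (E p) y u) = (\<Sum>p\<in>UNIV. \<Sum>l\<in>UNIV. (om y v j p * om y u p l) *\<^sub>R E l y) - Q u v"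
        unfolding fderiv_E[OF y] Q_def by (simp add: scaleR_diff_right sum_subtractf scaleR_sum_right)
      then show ?thesis unfolding scaleR_sum_left by (subst (asm) sum.swap)
    qed
    also have "fderiv (\<lambda>y. Gam y v (E j y)) y u = fderiv (\<lambda>x. Gam x v (E j y)) y u + Q v u - Gam y v (Gam y u (E j y))"
      unfolding GE fderiv_E[OF y] Q_def
      by (simp add: linear_diff[OF linear_Gam[OF y]] linear_sum[OF linear_Gam[OF y]] linear_cmul[OF linear_Gam[OF y]])
    finally show ?thesis by (simp add: S_def)
  qed
  have "S u v = S v u"
    using second_fderiv_symmetric[OF smooth_E y, of j v u] unfolding D2 by (simp add: algebra_simps)
  moreover define A where "A u v = (\<Sum>p\<in>UNIV. fderiv (\<lambda>y. om y v j p) y u *\<^sub>R E p y)" for u v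
  moreover define B where "B u v = (\<Sum>l\<in>UNIV. (\<Sum>p\<in>UNIV. om y v j p * om y u p l) *\<^sub>R E l y)" for u v
  ultimately have "A u v - A v u + (B u v - B v u) = Riem y u v (E j y)"
    unfolding S_def Riem_def by (simp add: algebra_simps)
  moreover have "(\<Sum>p\<in>UNIV. Rm y u v j p *\<^sub>R E p y) = A u v - A v u + (B u v - B v u)"
    unfolding A_def B_def Rm_def
    by (simp add: scaleR_add_left scaleR_diff_left sum.distrib sum_subtractf)
  ultimately have "G y (Riem y u v (E j y)) (E l y) = G y (\<Sum>p\<in>UNIV. Rm y u v j p *\<^sub>R E p y) (E l y)" by simp
  also have "\<dots> = (\<Sum>p\<in>UNIV. Rm y u v j p *\<^sub>R G y (E p y) (E l y))"
    by (simp add: linear_sum[OF linear_G'[OF y]] linear_cmul[OF linear_G'[OF y]])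
  also have "\<dots> = Rm y u v j l"
    by (simp add: ortho_E[OF y] if_distrib cong: if_cong)
  finally show ?thesis by simp
qed

lemma Riem_antisym: "Riem y u v w = - Riem y v u w"
  by (simp add: Riem_def)

lemma Riem_bianchi: "y \<in> V \<Longrightarrow> Riem y u v w + Riem y v w u + Riem y w u v = 0"
proof -
  assume y: "y \<in> V"
  have D: "fderiv (\<lambda>y. Gam y v w) y = fderiv (\<lambda>y. Gam y w v) y" for v w
    by (rule fderiv_cong_open[OF open_V y]) (rule sym_Gam)
  show ?thesis unfolding Riem_def using D[of u v] D[of v w] D[of w u] sym_Gam[OF y, of u v] sym_Gam[OF y, of v w] sym_Gam[OF y, of w u]
    by (simp add: algebra_simps)
qed

lemma Bochner:
  assumes dirac: "\<And>y. y \<in> V \<Longrightarrow> (\<Sum>j\<in>UNIV. rho j (P y (E j y))) = lam *\<^sub>R s y" and y: "y \<in> V"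
    and max: "\<And>x. x \<in> V \<Longrightarrow> s x \<bullet> s x \<le> s y \<bullet> s y"
  shows "(\<Sum>j\<in>UNIV. P y (E j y) \<bullet> P y (E j y))
      + 1/4 * (\<Sum>i\<in>UNIV. \<Sum>j\<in>UNIV. G y (Riem y (E i y) (E j y) (E j y)) (E i y)) * (s y \<bullet> s y)
      + 1/4 * (\<Sum>i\<in>UNIV. \<Sum>j\<in>UNIV. da y (E i y) (E j y) * (rho i (rho j (J (s y))) \<bullet> s y))
    \<le> lam\<^sup>2 * (s y \<bullet> s y)"
proof -
  note d = smooth_on_differentiable[OF _ y]
  define R where "R i j k l = G y (Riem y (E i y) (E j y) (E k y)) (E l y)" for i j k l
  have RmR: "Rm y (E i y) (E j y) = R i j" for i j by (simp add: fun_eq_iff Rm_eq_Riem[OF y] R_def)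
  have f: "smooth_on V (\<lambda>x. s x \<bullet> s x)" by (intro smooth_on_inner smooth_s)
  \<comment> \<open>As \<open>W\<close> is skew, the plain derivative of the squared norm may be
    written with the covariant derivative \<open>P\<close>.\<close>
  have D1: "fderiv (\<lambda>x. s x \<bullet> s x) x v = 2 * (P x v \<bullet> s x)" if x: "x \<in> V" for x v
  proof -
    have "fderiv (\<lambda>x. s x \<bullet> s x) x v = 2 * (fderiv s x v \<bullet> s x)"
      by (subst fderiv_bilinear[OF bounded_bilinear_inner]) (auto intro: smooth_on_differentiable[OF smooth_s x] simp: inner_commute)
    moreover have "W x v (s x) \<bullet> s x = 0" using W_skew[OF x, of v "s x" "s x"] by (simp add: inner_commute)
    ultimately show ?thesis by (simp add: P_def inner_add_left)
  qed
  have D2: "fderiv (\<lambda>x. fderiv (\<lambda>x. s x \<bullet> s x) x v) y v = 2 * ((fderiv (\<lambda>y. P y v) y v + W y v (P y v)) \<bullet> s y + P y v \<bullet> P y v)" for v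
  proof -
    have "fderiv (\<lambda>x. fderiv (\<lambda>x. s x \<bullet> s x) x v) y v = fderiv (\<lambda>x. 2 * (P x v \<bullet> s x)) y v"
      by (rule fun_cong[OF fderiv_cong_open[OF open_V y]]) (rule D1)
    also have "\<dots> = 2 * fderiv (\<lambda>x. P x v \<bullet> s x) y v"
      by (rule fderiv_linear[OF bounded_linear_mult_right]) (intro d smooth_on_inner smooth_P smooth_s)
    also have "fderiv (\<lambda>x. P x v \<bullet> s x) y v = P y v \<bullet> fderiv s y v + fderiv (\<lambda>y. P y v) y v \<bullet> s y"
      by (rule fderiv_bilinear[OF bounded_bilinear_inner d[OF smooth_P] d[OF smooth_s]])
    also have "fderiv s y v = P y v - W y v (s y)" by (simp add: P_def)
    finally show ?thesis using W_skew[OF y, of v "P y v" "s y"] by (simp add: inner_diff_right inner_add_left)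
  qed
  \<comment> \<open>At the maximum every covariant derivative is orthogonal to \<open>s y\<close>.
    In particular the correction term \<open>P y (Gam y v v)\<close> of the Hessian \<open>H\<close>
    disappears from the inner product.\<close>
  have P0: "P y v \<bullet> s y = 0" for v
    using fderiv_zero_at_max[OF f y max, of v] D1[OF y] by simp
  have Hle: "H y v v \<bullet> s y \<le> - (P y v \<bullet> P y v)" for v
    using second_fderiv_nonpos_at_max[OF f y max, of v] unfolding D2 H_def by (simp add: inner_diff_left P0)
  have "lam\<^sup>2 * (s y \<bullet> s y) = (lam\<^sup>2 *\<^sub>R s y) \<bullet> s y" by simp
  also have "\<dots> = - (\<Sum>l\<in>UNIV. H y (E l y) (E l y) \<bullet> s y)
    + (1/2) * (\<Sum>i\<in>UNIV. \<Sum>j\<in>UNIV. rho i (rho j (cl (Rm y (E i y) (E j y)) (s y) + (da y (E i y) (E j y) / 2) *\<^sub>R J (s y))) \<bullet> s y)"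
    by (subst dirac_squared[OF dirac y])
      (simp_all add: curvature_H[OF y] inner_add_left inner_diff_left inner_sum_left)
  also have "(1/2) * (\<Sum>i\<in>UNIV. \<Sum>j\<in>UNIV. rho i (rho j (cl (Rm y (E i y) (E j y)) (s y) + (da y (E i y) (E j y) / 2) *\<^sub>R J (s y))) \<bullet> s y)
     = 1/2 * (\<Sum>i\<in>UNIV. \<Sum>j\<in>UNIV. rho i (rho j (cl (R i j) (s y))) \<bullet> s y) + 1/4 * (\<Sum>i\<in>UNIV. \<Sum>j\<in>UNIV. da y (E i y) (E j y) * (rho i (rho j (J (s y))) \<bullet> s y))"
    by (simp add: RmR rho_simps inner_add_left sum.distrib sum_distrib_left algebra_simps)
  also have "(\<Sum>i\<in>UNIV. \<Sum>j\<in>UNIV. rho i (rho j (cl (R i j) (s y))) \<bullet> s y)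
     = 1/4 * (\<Sum>i\<in>UNIV. \<Sum>j\<in>UNIV. \<Sum>k\<in>UNIV. \<Sum>l\<in>UNIV. R i j k l * (rho i (rho j (rho k (rho l (s y)))) \<bullet> s y))"
    by (simp add: cl_def rho_simps inner_sum_left sum_distrib_left)
  \<comment> \<open>The factor 2 from the Bianchi identity meets the 1/2 of
    \<open>dirac_squared\<close> and the 1/4 of \<open>cl\<close>, leaving one quarter of the scalar
    curvature.\<close>
  also have "(\<Sum>i\<in>UNIV. \<Sum>j\<in>UNIV. \<Sum>k\<in>UNIV. \<Sum>l\<in>UNIV. R i j k l * (rho i (rho j (rho k (rho l (s y)))) \<bullet> s y))
     = 2 * (\<Sum>i\<in>UNIV. \<Sum>j\<in>UNIV. R i j j i) * (s y \<bullet> s y)"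
  proof (rule bianchi_rho4_inner)
    show "R i j k l = - R j i k l" for i j k l
      unfolding R_def by (subst Riem_antisym) (simp add: linear_neg[OF linear_G'[OF y]])
    show "R i j k l + R j k i l + R k i j l = 0" for i j k l
      unfolding R_def linear_add[OF linear_G'[OF y], symmetric]
      by (simp add: Riem_bianchi[OF y] linear_0[OF linear_G'[OF y]])
  qed
  finally have "lam\<^sup>2 * (s y \<bullet> s y) = - (\<Sum>l\<in>UNIV. H y (E l y) (E l y) \<bullet> s y)
      + 1/4 * (\<Sum>i\<in>UNIV. \<Sum>j\<in>UNIV. R i j j i) * (s y \<bullet> s y)
      + 1/4 * (\<Sum>i\<in>UNIV. \<Sum>j\<in>UNIV. da y (E i y) (E j y) * (rho i (rho j (J (s y))) \<bullet> s y))"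
    by simp
  moreover have "(\<Sum>l\<in>UNIV. H y (E l y) (E l y) \<bullet> s y) \<le> (\<Sum>l\<in>UNIV. - (P y (E l y) \<bullet> P y (E l y)))"
    by (rule sum_mono) (rule Hle)
  ultimately show ?thesis unfolding R_def sum_negf by linarith
qed

end

section \<open>Linear algebra of the pointwise estimates\<close>

context clifford_module
begin

lemma Bessel_rho: "(\<Sum>j\<in>UNIV. (w \<bullet> rho j x)\<^sup>2) \<le> (w \<bullet> w) * (x \<bullet> x)"
proof (cases "x = 0")
  case True
  then show ?thesis by (simp add: rho_simps)
next
  case False
  define N where "N = x \<bullet> x"
  have N: "N > 0" using False by (simp add: N_def)
  define c where "c j = w \<bullet> rho j x" for j
  define t where "t = (\<Sum>j\<in>UNIV. c j *\<^sub>R rho j x)"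
  have wt: "w \<bullet> t = (\<Sum>j\<in>UNIV. (c j)\<^sup>2)"
    by (simp add: t_def inner_sum_right c_def power2_eq_square)
  have "rho i x \<bullet> t = c i * N" for i
    by (simp add: t_def inner_sum_right rho_rho_inner N_def if_distrib cong: if_cong)
  then have tt: "t \<bullet> t = N * (\<Sum>j\<in>UNIV. (c j)\<^sup>2)"
    by (subst (1) t_def) (simp add: inner_sum_left power2_eq_square sum_distrib_left mult_ac)
  \<comment> \<open>\<open>t\<close> divided by \<open>N\<close> is the projection of
    \<open>w\<close> onto the span of the \<open>rho j x\<close>, so this vector is \<open>N\<close>
    times the orthogonal component of \<open>w\<close>.\<close>
  have "0 \<le> (N *\<^sub>R w - t) \<bullet> (N *\<^sub>R w - t)" by simp
  also have "\<dots> = N * (N * (w \<bullet> w)) - 2 * N * (w \<bullet> t) + t \<bullet> t"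
    by (simp add: inner_diff_left inner_diff_right inner_commute)
  also have "\<dots> = N * (N * (w \<bullet> w) - (\<Sum>j\<in>UNIV. (c j)\<^sup>2))"
    unfolding tt wt by (simp add: algebra_simps)
  finally have "0 \<le> N * (w \<bullet> w) - (\<Sum>j\<in>UNIV. (c j)\<^sup>2)" using N zero_le_mult_iff[of N] by simp
  then show ?thesis by (simp add: c_def N_def mult.commute)
qed

text \<open>Bessel's inequality for each \<open>p j\<close> separately. With \<open>p j\<close> the
  covariant derivative of the spinor along the j-th frame vector, the squared entries are those of
  the bilinear form whose symmetric and skew parts are \<ell> and q up to sign.\<close>

lemma energy_momentum_bound:
  assumes "x \<noteq> 0"
  shows "(\<Sum>i\<in>UNIV. \<Sum>j\<in>UNIV. (rho i (p j) \<bullet> x / (x \<bullet> x))\<^sup>2) * (x \<bullet> x) \<le> (\<Sum>j\<in>UNIV. p j \<bullet> p j)"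
proof -
  have N: "x \<bullet> x > 0" using assms by simp
  have "(\<Sum>i\<in>UNIV. \<Sum>j\<in>UNIV. (rho i (p j) \<bullet> x / (x \<bullet> x))\<^sup>2) = (\<Sum>j\<in>UNIV. \<Sum>i\<in>UNIV. (p j \<bullet> rho i x)\<^sup>2 / (x \<bullet> x)\<^sup>2)"
    by (subst sum.swap) (simp add: rho_skew power_divide)
  also have "\<dots> \<le> (\<Sum>j\<in>UNIV. (p j \<bullet> p j) / (x \<bullet> x))"
  proof (rule sum_mono)
    fix j
    have "(\<Sum>i\<in>UNIV. (p j \<bullet> rho i x)\<^sup>2 / (x \<bullet> x)\<^sup>2) \<le> (p j \<bullet> p j) * (x \<bullet> x) / (x \<bullet> x)\<^sup>2"
      unfolding sum_divide_distrib[symmetric] by (intro divide_right_mono Bessel_rho) simp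
    then show "(\<Sum>i\<in>UNIV. (p j \<bullet> rho i x)\<^sup>2 / (x \<bullet> x)\<^sup>2) \<le> (p j \<bullet> p j) / (x \<bullet> x)"
      using N by (simp add: power2_eq_square)
  qed
  also have "\<dots> = (\<Sum>j\<in>UNIV. p j \<bullet> p j) / (x \<bullet> x)" by (simp add: sum_divide_distrib)
  finally show ?thesis using N by (simp add: pos_le_divide_eq)
qed

end

text \<open>Transposition changes the sign of every row, so in odd dimension the determinant equals
  its own negative.\<close>

lemma skew_kernel:
  fixes B :: "'n::finite \<Rightarrow> 'n \<Rightarrow> real"
  assumes skew: "\<And>i j. B i j = - B j i" and odd: "odd CARD('n)"
  shows "\<exists>v. (\<Sum>i\<in>UNIV. (v i)\<^sup>2) = 1 \<and> (\<forall>j. (\<Sum>i\<in>UNIV. v i * B i j) = 0)"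
proof -
  define M :: "real^'n^'n" where "M = (\<chi> i j. B i j)"
  have "det M = det (transpose M)" by simp
  also have "transpose M = (\<chi> i. (-1) *s M $ i)"
    by (simp add: M_def transpose_def vec_eq_iff) (intro allI skew)
  also have "det \<dots> = (\<Prod>i\<in>(UNIV::'n set). -1) * det (\<chi> i. M $ i)" by (rule det_rows_mul)
  also have "\<dots> = - det M" using odd by (simp add: vec_nth_inverse)
  finally have "det M = 0" by simp
  then have "det (matrix ((*v) M)) = 0" by simp
  then have "\<not> inj ((*v) M)" using det_nz_iff_inj[of "(*v) M"] by simp
  then obtain x where x: "M *v x = 0" "x \<noteq> 0"
    using linear_injective_0[of "(*v) M"] by auto
  define v where "v i = x $ i / norm x" for i
  have nx: "(norm x)\<^sup>2 = (\<Sum>i\<in>UNIV. (x $ i)\<^sup>2)"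
    by (simp add: norm_vec_def L2_set_def sum_nonneg)
  have "(\<Sum>i\<in>UNIV. (v i)\<^sup>2) = 1"
    using x(2) by (simp add: v_def power_divide sum_divide_distrib[symmetric] nx[symmetric])
  moreover have "(\<Sum>i\<in>UNIV. v i * B i j) = 0" for j
  proof -
    have "(M *v x) $ j = 0" using x by simp
    then have "(\<Sum>i\<in>UNIV. B j i * x $ i) = 0" by (simp add: matrix_vector_mult_def M_def)
    moreover have "(\<Sum>i\<in>UNIV. v i * B i j) = (\<Sum>i\<in>UNIV. - (B j i * x $ i) / norm x)"
      unfolding v_def by (intro sum.cong refl) (subst skew, simp)
    ultimately show ?thesis by (simp add: sum_divide_distrib[symmetric] sum_negf)
  qed
  ultimately show ?thesis by blast
qed

text \<open>The factor is \<open>2 [n/2]\<close> instead of \<open>n\<close> because for odd \<open>n\<close> a skew matrix has a kernel.\<close>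

lemma skew_Hilbert_Schmidt_bound:
  fixes B :: "'n::finite \<Rightarrow> 'n \<Rightarrow> real"
  assumes skew: "\<And>i j. B i j = - B j i"
    and bound: "\<And>x. (\<Sum>j\<in>UNIV. (\<Sum>i\<in>UNIV. x i * B i j)\<^sup>2) \<le> (\<Sum>i\<in>UNIV. (x i)\<^sup>2) * C"
  shows "(\<Sum>i\<in>UNIV. \<Sum>j\<in>UNIV. (B i j)\<^sup>2) \<le> 2 * real (CARD('n) div 2) * C"
proof -
  have kron: "(\<Sum>i\<in>UNIV. (if i = a then 1 else 0) * f i) = f a" for a :: 'n and f :: "'n \<Rightarrow> real"
    by (simp add: if_distrib[of "\<lambda>t. t * _"] cong: if_cong)
  \<comment> \<open>A unit kernel vector in odd dimension and the zero vector in even dimension, so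
    that one computation covers both parities.\<close>
  obtain v where v: "(\<Sum>i\<in>UNIV. (v i)\<^sup>2) = of_bool (odd CARD('n))" "\<And>j. (\<Sum>i\<in>UNIV. v i * B i j) = 0"
  proof (cases "odd CARD('n)")
    case True
    then show ?thesis using skew_kernel[of B, OF skew] that by auto
  next
    case False
    then show ?thesis using that[of "\<lambda>i. 0"] by simp
  qed
  have row: "(\<Sum>j\<in>UNIV. (B a j)\<^sup>2) \<le> (1 - 2 * (v a)\<^sup>2 + (v a)\<^sup>2 * (\<Sum>i\<in>UNIV. (v i)\<^sup>2)) * C" for a
  proof -
    \<comment> \<open>The a-th unit vector with its component along \<open>v\<close> removed. Since
      \<open>v\<close> lies in the kernel, \<open>B\<close> still maps it to row \<open>a\<close>,
      but when \<open>v\<close> is a unit vector its squared length is smaller by the square of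
      \<open>v a\<close>. Summed over \<open>a\<close>, this saves exactly 1 in odd
      dimension.\<close>
    define x where "x i = (if i = a then 1 else 0) - v a * v i" for i
    have "(\<Sum>i\<in>UNIV. x i * B i j) = B a j" for j
      using v(2)[of j] unfolding x_def
      by (simp add: left_diff_distrib sum_subtractf kron mult.assoc sum_distrib_left[symmetric])
    moreover have "(\<Sum>i\<in>UNIV. (x i)\<^sup>2) = 1 - 2 * (v a)\<^sup>2 + (v a)\<^sup>2 * (\<Sum>i\<in>UNIV. (v i)\<^sup>2)"
    proof -
      have "(x i)\<^sup>2 = (if i = a then 1 else 0) * (1 - 2 * (v a * v i)) + (v a)\<^sup>2 * (v i)\<^sup>2" for i
        by (simp add: x_def power2_eq_square algebra_simps)
      then show ?thesis by (simp add: sum.distrib kron sum_distrib_left[symmetric] power2_eq_square)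
    qed
    ultimately show ?thesis using bound[of x] by simp
  qed
  have "(\<Sum>a\<in>UNIV. \<Sum>j\<in>UNIV. (B a j)\<^sup>2) \<le> (\<Sum>a\<in>UNIV. (1 - 2 * (v a)\<^sup>2 + (v a)\<^sup>2 * (\<Sum>i\<in>UNIV. (v i)\<^sup>2)) * C)"
    by (rule sum_mono) (rule row)
  also have "\<dots> = (real CARD('n) - 2 * (\<Sum>i\<in>UNIV. (v i)\<^sup>2) + (\<Sum>i\<in>UNIV. (v i)\<^sup>2) * (\<Sum>i\<in>UNIV. (v i)\<^sup>2)) * C"
    by (simp add: sum_distrib_right[symmetric] sum.distrib sum_subtractf sum_distrib_left[symmetric])
  \<comment> \<open>The squared length of \<open>v\<close> is 0 or 1, hence equal to its own
    square.\<close>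
  also have "\<dots> = (real CARD('n) - of_bool (odd CARD('n))) * C"
    unfolding v(1) by simp
  also have "real CARD('n) - of_bool (odd CARD('n)) = 2 * real (CARD('n) div 2)"
    by (cases "odd CARD('n)") (auto elim!: oddE evenE)
  finally show ?thesis .
qed

context clifford_module
begin

text \<open>Cauchy-Schwarz for matrices: one factor is the coefficient matrix \<open>w\<close>, the
  other the skew matrix of Clifford expectation values, whose Hilbert-Schmidt norm is controlled by
  \<open>skew_Hilbert_Schmidt_bound\<close>.\<close>

lemma two_form_estimate:
  fixes w :: "'n \<Rightarrow> 'n \<Rightarrow> real"
  shows "\<bar>\<Sum>i\<in>UNIV. \<Sum>j\<in>UNIV. w i j * (rho i (rho j (J x)) \<bullet> x)\<bar>
    \<le> 2 * sqrt (real (CARD('n) div 2)) * sqrt ((\<Sum>i\<in>UNIV. \<Sum>j\<in>UNIV. (w i j)\<^sup>2) / 2) * (x \<bullet> x)"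
proof -
  define N where "N = x \<bullet> x"
  have N: "N \<ge> 0" by (simp add: N_def)
  have JN: "J x \<bullet> J x = N" using J_skew[of x "J x"] by (simp add: J_J N_def)
  have JJ0: "J x \<bullet> x = 0" using J_skew[of x x] by (simp add: inner_commute)
  define B where "B i j = rho i (rho j (J x)) \<bullet> x" for i j
  have Balt: "B i j = - (rho i x \<bullet> rho j (J x))" for i j
    by (simp add: B_def rho_skew[of i] inner_commute)
  \<comment> \<open>The anticommutator contributes on the diagonal only, where it is a multiple of
    the product of \<open>J x\<close> and \<open>x\<close>, which is zero.\<close>
  have skew: "B i j = - B j i" for i j
    unfolding B_def by (subst rho_swap) (simp add: inner_diff_left JJ0)
  have bound: "(\<Sum>j\<in>UNIV. (\<Sum>i\<in>UNIV. c i * B i j)\<^sup>2) \<le> (\<Sum>i\<in>UNIV. (c i)\<^sup>2) * N\<^sup>2" for c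
  proof -
    \<comment> \<open>\<open>z\<close> has squared length \<open>N\<close> times that of
      \<open>c\<close>, and the row combination of \<open>B\<close> consists of minus its products
      with the vectors \<open>rho j (J x)\<close>. Bessel's inequality at \<open>J x\<close> thus
      bounds the operator norm of \<open>B\<close> by \<open>N\<close>.\<close>
    define z where "z = (\<Sum>i\<in>UNIV. c i *\<^sub>R rho i x)"
    have "rho i x \<bullet> z = c i * N" for i
      by (simp add: z_def inner_sum_right rho_rho_inner N_def if_distrib cong: if_cong)
    then have zz: "z \<bullet> z = (\<Sum>i\<in>UNIV. (c i)\<^sup>2) * N"
      by (subst (1) z_def) (simp add: inner_sum_left power2_eq_square sum_distrib_left mult_ac)
    have "(\<Sum>i\<in>UNIV. c i * B i j) = - (z \<bullet> rho j (J x))" for j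
      by (simp add: z_def Balt inner_sum_left sum_negf)
    then have "(\<Sum>j\<in>UNIV. (\<Sum>i\<in>UNIV. c i * B i j)\<^sup>2) = (\<Sum>j\<in>UNIV. (z \<bullet> rho j (J x))\<^sup>2)" by simp
    also have "\<dots> \<le> (z \<bullet> z) * N" using Bessel_rho[of z "J x"] JN by simp
    finally show ?thesis by (simp add: zz power2_eq_square mult.assoc)
  qed
  have HS: "(\<Sum>i\<in>UNIV. \<Sum>j\<in>UNIV. (B i j)\<^sup>2) \<le> 2 * real (CARD('n) div 2) * N\<^sup>2"
    by (rule skew_Hilbert_Schmidt_bound[OF skew bound])
  define S where "S = (\<Sum>i\<in>UNIV. \<Sum>j\<in>UNIV. (w i j)\<^sup>2)"
  have "\<bar>\<Sum>i\<in>UNIV. \<Sum>j\<in>UNIV. w i j * B i j\<bar> = \<bar>\<Sum>(i,j)\<in>UNIV \<times> UNIV. w i j * B i j\<bar>"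
    by (simp add: sum.cartesian_product)
  also have "\<dots> = \<bar>\<Sum>p\<in>UNIV \<times> UNIV. (case p of (i,j) \<Rightarrow> w i j) * (case p of (i,j) \<Rightarrow> B i j)\<bar>"
    by (simp add: case_prod_beta)
  also have "\<dots> \<le> (\<Sum>p\<in>UNIV \<times> UNIV. \<bar>case p of (i,j) \<Rightarrow> w i j\<bar> * \<bar>case p of (i,j) \<Rightarrow> B i j\<bar>)"
    unfolding abs_mult[symmetric] by (rule sum_abs)
  also have "\<dots> \<le> L2_set (\<lambda>(i,j). w i j) (UNIV \<times> UNIV) * L2_set (\<lambda>(i,j). B i j) (UNIV \<times> UNIV)"
    using L2_set_mult_ineq[of "\<lambda>(i,j). w i j" "\<lambda>(i,j). B i j" "UNIV \<times> UNIV"] by simp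
  also have "\<dots> = sqrt S * sqrt (\<Sum>i\<in>UNIV. \<Sum>j\<in>UNIV. (B i j)\<^sup>2)"
    by (simp add: L2_set_def S_def sum.cartesian_product case_prod_beta)
  also have "\<dots> \<le> sqrt S * sqrt (2 * real (CARD('n) div 2) * N\<^sup>2)"
    by (intro mult_left_mono real_sqrt_le_mono HS) (simp add: S_def sum_nonneg)
  \<comment> \<open>One factor sqrt 2 comes from the rank bound and the other from passing to
    \<open>S / 2\<close>, which is the sum over i < j when \<open>w\<close> is skew. Together they
    form the 2 in c_n.\<close>
  also have "\<dots> = 2 * sqrt (real (CARD('n) div 2)) * sqrt (S / 2) * N"
  proof -
    have "sqrt S = sqrt 2 * sqrt (S / 2)" by (simp add: real_sqrt_mult[symmetric])
    then show ?thesis using N by (simp add: real_sqrt_mult)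
  qed
  finally show ?thesis by (simp add: B_def S_def N_def)
qed

end

section \<open>Orthonormal frames, traces and the inverse metric\<close>

lemma orthonormal_frame_expansion:
  fixes G :: "real^'n \<Rightarrow> real^'n \<Rightarrow> real" and e :: "'n::finite \<Rightarrow> real^'n"
  assumes lin: "\<And>v. linear (\<lambda>u. G u v)" and ortho: "\<And>i j. G (e i) (e j) = (if i = j then 1 else 0)"
  shows "v = (\<Sum>i\<in>UNIV. G v (e i) *\<^sub>R e i)"
proof -
  define L where "L x = (\<Sum>i\<in>UNIV. (x $ i) *\<^sub>R e i)" for x :: "real^'n"
  have linL: "linear L"
    unfolding L_def by (rule linearI) (simp_all add: scaleR_add_left sum.distrib scaleR_sum_right)
  have coord: "G (L x) (e j) = x $ j" for x j
    unfolding L_def by (simp add: linear_sum[OF lin] linear_cmul[OF lin] ortho if_distrib cong: if_cong)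
  \<comment> \<open>The coordinates can be recovered by orthonormality, so \<open>L\<close> is
    injective; equality of dimensions makes the frame span.\<close>
  have "inj L" by (rule injI) (metis coord vec_eq_iff)
  then have "surj L" using linL linear_injective_imp_surjective by blast
  then obtain x where "v = L x" by (metis surjD)
  then show ?thesis using coord by (simp add: L_def)
qed

text \<open>The Dirac operator and the norms of endomorphisms and 2-forms are defined with the
  arbitrary frame \<open>onframe\<close>, whereas the computation uses the frame of a local section.
  This lemma and its double-sum version relate the two.\<close>

lemma trace_frame_independent:
  fixes G :: "'a::real_vector \<Rightarrow> 'a \<Rightarrow> real" and B :: "'a \<Rightarrow> 'a \<Rightarrow> 'b::real_vector" and e f :: "'n::finite \<Rightarrow> 'a"
  assumes lin: "\<And>v. linear (G v)" and ortho: "\<And>i j. G (e i) (e j) = (if i = j then 1 else 0)"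
    and exp_e: "\<And>v. v = (\<Sum>i\<in>UNIV. G v (e i) *\<^sub>R e i)"
    and exp_f: "\<And>v. v = (\<Sum>i\<in>UNIV. G v (f i) *\<^sub>R f i)"
    and sym: "\<And>u v. G u v = G v u"
    and B1: "\<And>v. linear (\<lambda>u. B u v)" and B2: "\<And>u. linear (B u)"
  shows "(\<Sum>i\<in>UNIV. B (f i) (f i)) = (\<Sum>i\<in>UNIV. B (e i) (e i))"
proof -
  \<comment> \<open>The matrix that changes one frame into the other is orthogonal.\<close>
  have GG: "(\<Sum>i\<in>UNIV. G (f i) (e j) * G (f i) (e k)) = (if j = k then 1 else 0)" for j k
  proof -
    have "G (e k) (e j) = G (e k) (\<Sum>i\<in>UNIV. G (e j) (f i) *\<^sub>R f i)" using exp_f[of "e j"] by simp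
    also have "\<dots> = (\<Sum>i\<in>UNIV. G (e j) (f i) * G (e k) (f i))" by (simp add: linear_sum[OF lin] linear_cmul[OF lin])
    also have "\<dots> = (\<Sum>i\<in>UNIV. G (f i) (e j) * G (f i) (e k))" by (simp add: sym)
    finally show ?thesis using ortho[of k j] by auto
  qed
  have "B (f i) (f i) = (\<Sum>j\<in>UNIV. \<Sum>k\<in>UNIV. (G (f i) (e j) * G (f i) (e k)) *\<^sub>R B (e j) (e k))" for i
  proof -
    have "B (f i) (f i) = B (\<Sum>j\<in>UNIV. G (f i) (e j) *\<^sub>R e j) (\<Sum>k\<in>UNIV. G (f i) (e k) *\<^sub>R e k)"
      by (simp add: exp_e[symmetric])
    then show ?thesis
      by (simp add: linear_sum[OF B1] linear_cmul[OF B1] linear_sum[OF B2] linear_cmul[OF B2] scaleR_sum_right)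
        (subst sum.swap, simp add: mult.commute)
  qed
  then have "(\<Sum>i\<in>UNIV. B (f i) (f i)) = (\<Sum>i\<in>UNIV. \<Sum>j\<in>UNIV. \<Sum>k\<in>UNIV. (G (f i) (e j) * G (f i) (e k)) *\<^sub>R B (e j) (e k))"
    by simp
  also have "\<dots> = (\<Sum>j\<in>UNIV. \<Sum>k\<in>UNIV. \<Sum>i\<in>UNIV. (G (f i) (e j) * G (f i) (e k)) *\<^sub>R B (e j) (e k))"
    using sum_rotate3[of "\<lambda>j k i. (G (f i) (e j) * G (f i) (e k)) *\<^sub>R B (e j) (e k)"] .
  also have "\<dots> = (\<Sum>j\<in>UNIV. B (e j) (e j))"
    by (simp add: scaleR_sum_left[symmetric] GG sum_delta_scaleR)
  finally show ?thesis .
qed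

text \<open>A trace does not depend on the basis; this converts the coordinate trace in the
  definition of the Ricci tensor into a sum over the frame.\<close>

lemma trace_eq_frame_sum:
  fixes G :: "real^'n \<Rightarrow> real^'n \<Rightarrow> real" and e :: "'n::finite \<Rightarrow> real^'n"
  assumes lin: "\<And>v. linear (\<lambda>u. G u v)" and exp: "\<And>v. v = (\<Sum>i\<in>UNIV. G v (e i) *\<^sub>R e i)" and T: "linear T"
  shows "(\<Sum>i\<in>UNIV. T (axis i 1) $ i) = (\<Sum>a\<in>UNIV. G (T (e a)) (e a))"
proof -
  have "T (axis i 1) $ i = (\<Sum>a\<in>UNIV. G (axis i 1) (e a) * (T (e a) $ i))" for i
  proof -
    have "T (axis i 1) = (\<Sum>a\<in>UNIV. G (axis i 1) (e a) *\<^sub>R T (e a))"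
      by (subst exp[of "axis i 1"]) (simp add: linear_sum[OF T] linear_cmul[OF T])
    then show ?thesis by simp
  qed
  then have "(\<Sum>i\<in>UNIV. T (axis i 1) $ i) = (\<Sum>i\<in>UNIV. \<Sum>a\<in>UNIV. G (axis i 1) (e a) * (T (e a) $ i))" by simp
  also have "\<dots> = (\<Sum>a\<in>UNIV. \<Sum>i\<in>UNIV. (T (e a) $ i) * G (axis i 1) (e a))"
    by (subst sum.swap) (simp add: mult.commute)
  also have "\<dots> = (\<Sum>a\<in>UNIV. G (T (e a)) (e a))"
  proof (intro sum.cong refl)
    fix a
    have "G (\<Sum>i\<in>UNIV. (T (e a) $ i) *\<^sub>R axis i 1) (e a) = (\<Sum>i\<in>UNIV. (T (e a) $ i) * G (axis i 1) (e a))"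
      by (simp add: linear_sum[OF lin] linear_cmul[OF lin])
    then show "(\<Sum>i\<in>UNIV. (T (e a) $ i) * G (axis i 1) (e a)) = G (T (e a)) (e a)"
      using basis_expansion[of "T (e a)"] by (simp add: scalar_mult_eq_scaleR)
  qed
  finally show ?thesis .
qed

lemma matrix_inv_unique:
  fixes A :: "real^'n^'n"
  assumes "A ** X = mat 1"
  shows "matrix_inv A = X"
proof -
  have "X ** A = mat 1" using assms matrix_left_right_inverse by blast
  then have "\<exists>A'. A ** A' = mat 1 \<and> A' ** A = mat 1" using assms by blast
  then have "A ** matrix_inv A = mat 1 \<and> matrix_inv A ** A = mat 1"
    unfolding matrix_inv_def by (rule someI_ex)
  then show ?thesis by (metis assms matrix_mul_assoc matrix_mul_lid matrix_mul_rid)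
qed

text \<open>The components of the inverse metric are sums of products of frame components. This
  yields both the smoothness of the inverse metric and the conversion of contractions into frame
  sums.\<close>

lemma gram_matrix_inv:
  fixes G :: "real^'n \<Rightarrow> real^'n \<Rightarrow> real" and e :: "'n::finite \<Rightarrow> real^'n"
  assumes lin: "\<And>v. linear (G v)" and exp: "\<And>v. v = (\<Sum>i\<in>UNIV. G v (e i) *\<^sub>R e i)"
  shows "matrix_inv (\<chi> i j. G (axis i 1) (axis j 1)) = (\<chi> i j. \<Sum>a\<in>UNIV. e a $ i * e a $ j)"
proof (rule matrix_inv_unique)
  have key: "(\<Sum>k\<in>UNIV. G (axis i 1) (axis k 1) * (\<Sum>a\<in>UNIV. e a $ k * e a $ j)) = (if i = j then 1 else 0)" for i j
  proof -
  have "(\<Sum>k\<in>UNIV. G (axis i 1) (axis k 1) * (\<Sum>a\<in>UNIV. e a $ k * e a $ j))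
    = (\<Sum>k\<in>UNIV. \<Sum>a\<in>UNIV. (e a $ k * G (axis i 1) (axis k 1)) * e a $ j)"
    by (simp add: sum_distrib_left mult_ac)
  also have "\<dots> = (\<Sum>a\<in>UNIV. (\<Sum>k\<in>UNIV. e a $ k * G (axis i 1) (axis k 1)) * e a $ j)"
    by (subst sum.swap) (simp add: sum_distrib_right)
  also have "\<dots> = (\<Sum>a\<in>UNIV. G (axis i 1) (e a) * e a $ j)"
  proof (intro sum.cong refl)
    fix a
    have "G (axis i 1) (\<Sum>k\<in>UNIV. (e a $ k) *\<^sub>R axis k 1) = (\<Sum>k\<in>UNIV. e a $ k * G (axis i 1) (axis k 1))"
      by (simp add: linear_sum[OF lin] linear_cmul[OF lin])
    then show "(\<Sum>k\<in>UNIV. e a $ k * G (axis i 1) (axis k 1)) * e a $ j = G (axis i 1) (e a) * e a $ j"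
      using basis_expansion[of "e a"] by (simp add: scalar_mult_eq_scaleR)
  qed
  also have "\<dots> = (\<Sum>a\<in>UNIV. G (axis i 1) (e a) *\<^sub>R e a) $ j" by simp
  also have "\<dots> = axis i 1 $ j" by (simp only: exp[symmetric])
  finally show ?thesis by (simp add: axis_def)
  qed
  then show "(\<chi> i j. G (axis i 1) (axis j 1)) ** (\<chi> i j. \<Sum>a\<in>UNIV. e a $ i * e a $ j) = mat 1"
    by (simp add: matrix_matrix_mult_def mat_def vec_eq_iff)
qed

section \<open>Charts and tangent vectors\<close>

locale smooth_manifold =
  fixes A :: "('a::topological_space, 'e::euclidean_space) chart set"
  assumes atlas: "smooth_atlas A"
begin

lemma open_cdom: "c \<in> A \<Longrightarrow> open (cdom c)"
  using atlas unfolding smooth_atlas_def by blast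

lemma chart_homeo: "c \<in> A \<Longrightarrow> homeomorphism (cdom c) (cmap c ` cdom c) (cmap c) (cinv c)"
  using atlas unfolding smooth_atlas_def by blast

lemma cinv_cmap: "c \<in> A \<Longrightarrow> x \<in> cdom c \<Longrightarrow> cinv c (cmap c x) = x"
  using homeomorphism_apply1[OF chart_homeo] by blast

lemma cmap_cinv: "c \<in> A \<Longrightarrow> y \<in> cmap c ` cdom c \<Longrightarrow> cmap c (cinv c y) = y"
  using homeomorphism_apply2[OF chart_homeo] by blast

lemma cinv_cdom: "c \<in> A \<Longrightarrow> y \<in> cmap c ` cdom c \<Longrightarrow> cinv c y \<in> cdom c"
  by (metis cinv_cmap imageE)

lemma continuous_on_cmap: "c \<in> A \<Longrightarrow> continuous_on (cdom c) (cmap c)"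
  using chart_homeo homeomorphism_cont1 by blast

lemma open_chart_image:
  assumes c: "c \<in> A" and U: "open U"
  shows "open (cmap c ` (cdom c \<inter> U))"
proof -
  have "cmap c ` (cdom c \<inter> U) = (cmap c ` cdom c) \<inter> cinv c -` U"
    using cinv_cmap[OF c] by auto
  moreover have "open ((cmap c ` cdom c) \<inter> cinv c -` U)"
    using chart_homeo[OF c] atlas c U unfolding smooth_atlas_def
    by (intro continuous_open_preimage) (auto dest: homeomorphism_cont2)
  ultimately show ?thesis by simp
qed

lemma open_chart_image': "c \<in> A \<Longrightarrow> open (cmap c ` cdom c)"
  using open_chart_image[of c UNIV] by simp

lemma chart_at: "chart_at A x \<in> A" "x \<in> cdom (chart_at A x)"
proof -
  have "\<exists>c. c \<in> A \<and> x \<in> cdom c" using atlas unfolding smooth_atlas_def by blast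
  then have "chart_at A x \<in> A \<and> x \<in> cdom (chart_at A x)" unfolding chart_at_def by (rule someI_ex)
  then show "chart_at A x \<in> A" "x \<in> cdom (chart_at A x)" by auto
qed

lemma smooth_transition: "c \<in> A \<Longrightarrow> d \<in> A \<Longrightarrow> smooth_on (cmap c ` (cdom c \<inter> cdom d)) (\<lambda>y. cmap d (cinv c y))"
  using atlas unfolding smooth_atlas_def o_def by blast

lemma chart_jac_eq: "chart_jac c d x = fderiv (\<lambda>y. cmap d (cinv c y)) (cmap c x)"
  by (simp add: chart_jac_def o_def)

lemma transition_derivative:
  assumes "c \<in> A" "d \<in> A" "x \<in> cdom c" "x \<in> cdom d"
  shows "((\<lambda>y. cmap d (cinv c y)) has_derivative chart_jac c d x) (at (cmap c x))"
  unfolding chart_jac_eq by (rule smooth_on_has_derivative[OF smooth_transition]) (use assms in auto)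

lemma linear_chart_jac: "c \<in> A \<Longrightarrow> d \<in> A \<Longrightarrow> x \<in> cdom c \<Longrightarrow> x \<in> cdom d \<Longrightarrow> linear (chart_jac c d x)"
  using transition_derivative has_derivative_linear by blast

lemma has_derivative_change_chart:
  assumes c: "c \<in> A" "x \<in> cdom c" and d: "d \<in> A" "x \<in> cdom d"
    and f: "(f \<circ> cinv d) differentiable (at (cmap d x))"
  shows "((f \<circ> cinv c) has_derivative (\<lambda>w. fderiv (f \<circ> cinv d) (cmap d x) (chart_jac c d x w))) (at (cmap c x))"
proof -
  have "(((f \<circ> cinv d) \<circ> (\<lambda>y. cmap d (cinv c y))) has_derivative
      (fderiv (f \<circ> cinv d) (cmap d x) \<circ> chart_jac c d x)) (at (cmap c x))"
    using transition_derivative[of c d x] fderiv_works[OF f] c d cinv_cmap[of c x]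
    by (intro diff_chain_at) auto
  then show ?thesis unfolding o_def
    by (rule has_derivative_transform_within_open[OF _ open_chart_image[OF c(1) open_cdom[OF d(1)]]])
      (use c d cinv_cmap[OF c(1)] cinv_cmap[OF d(1)] in auto)
qed

lemma change_chart:
  assumes c: "c \<in> A" "x \<in> cdom c" and d: "d \<in> A" "x \<in> cdom d"
    and f: "(f \<circ> cinv d) differentiable (at (cmap d x))"
  shows "(f \<circ> cinv c) differentiable (at (cmap c x))"
    and "fderiv (f \<circ> cinv c) (cmap c x) w = fderiv (f \<circ> cinv d) (cmap d x) (chart_jac c d x w)"
  using has_derivative_change_chart[OF assms] differentiableI fderiv_eq by (blast, metis)

lemma chart_jac_id:
  assumes "c \<in> A" "x \<in> cdom c"
  shows "chart_jac c c x w = w"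
proof -
  have "fderiv (\<lambda>y. cmap c (cinv c y)) (cmap c x) = fderiv (\<lambda>y. y) (cmap c x)"
    by (rule fderiv_cong_open[OF open_chart_image'[OF assms(1)]]) (use assms cmap_cinv in auto)
  then show ?thesis by (simp add: chart_jac_eq)
qed

lemma chart_jac_cocycle:
  assumes c: "c \<in> A" "x \<in> cdom c" and d: "d \<in> A" "x \<in> cdom d" and e: "e \<in> A" "x \<in> cdom e"
  shows "chart_jac d e x (chart_jac c d x w) = chart_jac c e x w"
proof -
  have "(cmap e \<circ> cinv d) differentiable (at (cmap d x))"
    using transition_derivative[OF d(1) e(1) d(2) e(2)] unfolding o_def by (rule differentiableI)
  from change_chart(2)[OF c d this, of w] show ?thesis by (simp add: chart_jac_def)
qed

lemma tvec_of_tangent: "c \<in> A \<Longrightarrow> x \<in> cdom c \<Longrightarrow> tvec_of A x c w \<in> tangent_space A x"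
  unfolding tangent_space_def tvec_of_def by (simp add: chart_jac_cocycle)

lemma tvec_of_self: "c \<in> A \<Longrightarrow> x \<in> cdom c \<Longrightarrow> tvec_of A x c w c = w"
  by (simp add: tvec_of_def chart_jac_id)

lemma tangent_chart:
  "v \<in> tangent_space A x \<Longrightarrow> c \<in> A \<Longrightarrow> x \<in> cdom c \<Longrightarrow> d \<in> A \<Longrightarrow> x \<in> cdom d \<Longrightarrow> v d = chart_jac c d x (v c)"
  unfolding tangent_space_def by blast

lemma tvec_of_tangent_eq: "v \<in> tangent_space A x \<Longrightarrow> c \<in> A \<Longrightarrow> x \<in> cdom c \<Longrightarrow> tvec_of A x c (v c) = v"
proof
  fix d
  assume v: "v \<in> tangent_space A x" and c: "c \<in> A" "x \<in> cdom c"
  show "tvec_of A x c (v c) d = v d"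
  proof (cases "d \<in> A \<and> x \<in> cdom d")
    case True
    then show ?thesis using tangent_chart[OF v c, of d] by (simp add: tvec_of_def)
  next
    case False
    moreover have "v d = 0" using v False unfolding tangent_space_def by blast
    ultimately show ?thesis unfolding tvec_of_def by auto
  qed
qed

lemma tangent_eqI: "v \<in> tangent_space A x \<Longrightarrow> w \<in> tangent_space A x \<Longrightarrow> c \<in> A \<Longrightarrow> x \<in> cdom c \<Longrightarrow> v c = w c \<Longrightarrow> v = w"
  by (metis tvec_of_tangent_eq)

lemma tvec_of_linear:
  "c \<in> A \<Longrightarrow> x \<in> cdom c \<Longrightarrow> tvec_of A x c (r *\<^sub>R u + t *\<^sub>R v) = (\<lambda>d. r *\<^sub>R tvec_of A x c u d + t *\<^sub>R tvec_of A x c v d)"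
  by (rule ext) (simp add: tvec_of_def linear_add[OF linear_chart_jac] linear_cmul[OF linear_chart_jac])

lemma tangent_linear:
  "v \<in> tangent_space A x \<Longrightarrow> w \<in> tangent_space A x \<Longrightarrow> (\<lambda>c. r *\<^sub>R v c + t *\<^sub>R w c) \<in> tangent_space A x"
proof -
  assume v: "v \<in> tangent_space A x" and w: "w \<in> tangent_space A x"
  have jac: "r *\<^sub>R v d + t *\<^sub>R w d = chart_jac c d x (r *\<^sub>R v c + t *\<^sub>R w c)"
    if "c \<in> A" "d \<in> A" "x \<in> cdom c \<inter> cdom d" for c d
    using that tangent_chart[OF v, of c d] tangent_chart[OF w, of c d]
    by (simp add: linear_add[OF linear_chart_jac] linear_cmul[OF linear_chart_jac])
  have zero: "v c = 0" "w c = 0" if "\<not> (c \<in> A \<and> x \<in> cdom c)" for c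
    using that v w unfolding tangent_space_def by blast+
  show ?thesis
    unfolding tangent_space_def
  proof (intro CollectI conjI allI ballI impI)
    show "r *\<^sub>R v c + t *\<^sub>R w c = 0" if "\<not> (c \<in> A \<and> x \<in> cdom c)" for c
      using zero[OF that] by simp
  qed (rule jac)
qed

lemma tangent_sum:
  "(\<And>i. i \<in> I \<Longrightarrow> v i \<in> tangent_space A x) \<Longrightarrow> (\<lambda>c. \<Sum>i\<in>I. r i *\<^sub>R v i c) \<in> tangent_space A x"
proof (induction I rule: infinite_finite_induct)
  case (insert i I)
  then show ?case using tangent_linear[of "v i" x "\<lambda>c. \<Sum>i\<in>I. r i *\<^sub>R v i c" "r i" 1] by simp
qed (simp_all add: tangent_space_def linear_0[OF linear_chart_jac])

text \<open>The definition uses the chart picked by \<open>chart_at\<close>; the Jacobians in the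
  chain rule and in the transformation of \<open>v\<close> match, so any chart around the point
  serves as well.\<close>

lemma dir_deriv_chart:
  assumes v: "v \<in> tangent_space A x" and c: "c \<in> A" "x \<in> cdom c"
    and f: "(f \<circ> cinv c) differentiable (at (cmap c x))"
  shows "dir_deriv A x v f = fderiv (f \<circ> cinv c) (cmap c x) (v c)"
  using change_chart(2)[OF chart_at c f] tangent_chart[OF v chart_at c] by (simp add: dir_deriv_def Let_def)

lemma smooth_fun_chart: "smooth_fun A U f \<Longrightarrow> c \<in> A \<Longrightarrow> smooth_on (cmap c ` (cdom c \<inter> U)) (f \<circ> cinv c)"
  by (simp add: smooth_fun_def)

lemma smooth_fun_differentiable:
  "smooth_fun A U f \<Longrightarrow> c \<in> A \<Longrightarrow> x \<in> cdom c \<Longrightarrow> x \<in> U \<Longrightarrow> (f \<circ> cinv c) differentiable (at (cmap c x))"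
  by (rule smooth_on_differentiable[OF smooth_fun_chart]) auto

lemma smooth_fun_continuous_on:
  assumes "smooth_fun A U f"
  shows "continuous_on U f"
proof -
  have U: "open U" using assms by (simp add: smooth_fun_def)
  have "continuous_on (\<Union>c\<in>A. cdom c \<inter> U) f"
  proof (rule continuous_on_open_UN)
    fix c assume c: "c \<in> A"
    show "open (cdom c \<inter> U)" using open_cdom[OF c] U by blast
    have "continuous_on (cmap c ` (cdom c \<inter> U)) (f \<circ> cinv c)"
      using smooth_on_continuous_on[OF smooth_fun_chart[OF assms c]] .
    then have "continuous_on (cdom c \<inter> U) (\<lambda>x. (f \<circ> cinv c) (cmap c x))"
      by (rule continuous_on_compose2) (auto intro: continuous_on_subset[OF continuous_on_cmap[OF c]])
    then show "continuous_on (cdom c \<inter> U) f"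
      by (subst continuous_on_cong[OF refl, of _ f "\<lambda>x. (f \<circ> cinv c) (cmap c x)"]) (auto simp: cinv_cmap[OF c])
  qed
  moreover have "(\<Union>c\<in>A. cdom c \<inter> U) = U" using chart_at by blast
  ultimately show ?thesis by simp
qed

lemma smooth_map_chart:
  "smooth_map A B U f \<Longrightarrow> c \<in> A \<Longrightarrow> d \<in> B \<Longrightarrow> smooth_on (cmap c ` (cdom c \<inter> U \<inter> f -` cdom d)) (cmap d \<circ> f \<circ> cinv c)"
  by (simp add: smooth_map_def)

lemma smooth_map_differentiable:
  "smooth_map A B U f \<Longrightarrow> c \<in> A \<Longrightarrow> d \<in> B \<Longrightarrow> x \<in> cdom c \<Longrightarrow> x \<in> U \<Longrightarrow> f x \<in> cdom d \<Longrightarrow>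
    (cmap d \<circ> f \<circ> cinv c) differentiable (at (cmap c x))"
  by (rule smooth_on_differentiable[OF smooth_map_chart]) auto

lemma smooth_map_subset:
  assumes "smooth_map A B U f" "open U'" "U' \<subseteq> U" and B: "smooth_atlas B"
  shows "smooth_map A B U' f"
  unfolding smooth_map_def
proof (intro conjI ballI)
  show "open U'" by fact
  show "continuous_on U' f" using assms continuous_on_subset unfolding smooth_map_def by blast
  fix c d assume c: "c \<in> A" and d: "d \<in> B"
  have "open (f -` cdom d \<inter> U')"
    using \<open>continuous_on U' f\<close> \<open>open U'\<close> smooth_manifold.open_cdom[OF smooth_manifold.intro[OF B] d]
    by (simp add: continuous_on_open_vimage)
  then have "open (cmap c ` (cdom c \<inter> (U' \<inter> f -` cdom d)))" by (intro open_chart_image[OF c]) (simp add: Int_commute)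
  then show "smooth_on (cmap c ` (cdom c \<inter> U' \<inter> f -` cdom d)) (cmap d \<circ> f \<circ> cinv c)"
    unfolding Int_assoc
    by (rule smooth_on_subset[OF smooth_map_chart[OF assms(1) c d], rotated]) (use assms(3) in auto)
qed

text \<open>Smoothness is local, and near each point a chart of the intermediate manifold can be
  inserted between the two maps.\<close>

lemma smooth_fun_compose:
  assumes f: "smooth_map A B U f" and B: "smooth_atlas B" and h: "smooth_fun B W h" and sub: "f ` U \<subseteq> W"
  shows "smooth_fun A U (\<lambda>x. h (f x))"
  unfolding smooth_fun_def
proof (intro conjI ballI)
  interpret B: smooth_manifold B by unfold_locales (rule B)
  show "open U" using f by (simp add: smooth_map_def)
  fix c assume c: "c \<in> A"
  show "smooth_on (cmap c ` (cdom c \<inter> U)) ((\<lambda>x. h (f x)) \<circ> cinv c)"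
  proof (rule smooth_on_local)
    fix y assume "y \<in> cmap c ` (cdom c \<inter> U)"
    then obtain x where x: "x \<in> cdom c" "x \<in> U" "y = cmap c x" by auto
    define d where "d = chart_at B (f x)"
    have d: "d \<in> B" "f x \<in> cdom d" using B.chart_at by (auto simp: d_def)
    let ?T = "cmap c ` (cdom c \<inter> U \<inter> f -` cdom d)"
    have 1: "smooth_on ?T (cmap d \<circ> f \<circ> cinv c)" by (rule smooth_map_chart[OF f c d(1)])
    have 2: "smooth_on (cmap d ` (cdom d \<inter> W)) (h \<circ> cinv d)" by (rule B.smooth_fun_chart[OF h d(1)])
    have "smooth_on ?T (\<lambda>y. (h \<circ> cinv d) ((cmap d \<circ> f \<circ> cinv c) y))"
      by (rule smooth_on_compose[OF 1 2]) (use sub cinv_cmap[OF c] in auto)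
    then have "smooth_on ?T ((\<lambda>x. h (f x)) \<circ> cinv c)"
      by (subst smooth_on_cong[of _ _ "\<lambda>y. (h \<circ> cinv d) ((cmap d \<circ> f \<circ> cinv c) y)"])
        (auto simp: cinv_cmap[OF c] B.cinv_cmap[OF d(1)])
    then show "\<exists>T. y \<in> T \<and> T \<subseteq> cmap c ` (cdom c \<inter> U) \<and> smooth_on T ((\<lambda>x. h (f x)) \<circ> cinv c)"
      using x d by (intro exI[of _ ?T]) auto
  qed
qed

lemma smooth_map_compose:
  assumes f: "smooth_map A B U f" and B: "smooth_atlas B" and C: "smooth_atlas C"
    and h: "smooth_map B C W h" and sub: "f ` U \<subseteq> W"
  shows "smooth_map A C U (\<lambda>x. h (f x))"
  unfolding smooth_map_def
proof (intro conjI ballI)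
  interpret B: smooth_manifold B by unfold_locales (rule B)
  interpret C: smooth_manifold C by unfold_locales (rule C)
  show U: "open U" using f by (simp add: smooth_map_def)
  have fc: "continuous_on U f" using f by (simp add: smooth_map_def)
  show hf: "continuous_on U (\<lambda>x. h (f x))"
    using h fc sub continuous_on_compose2 unfolding smooth_map_def by blast
  fix c e assume c: "c \<in> A" and e: "e \<in> C"
  show "smooth_on (cmap c ` (cdom c \<inter> U \<inter> (\<lambda>x. h (f x)) -` cdom e)) (cmap e \<circ> (\<lambda>x. h (f x)) \<circ> cinv c)"
  proof (rule smooth_on_local)
    fix y assume "y \<in> cmap c ` (cdom c \<inter> U \<inter> (\<lambda>x. h (f x)) -` cdom e)"
    then obtain x where x: "x \<in> cdom c" "x \<in> U" "h (f x) \<in> cdom e" "y = cmap c x" by auto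
    define d where "d = chart_at B (f x)"
    have d: "d \<in> B" "f x \<in> cdom d" using B.chart_at by (auto simp: d_def)
    let ?T = "cmap c ` (cdom c \<inter> ((f -` cdom d \<inter> U) \<inter> ((\<lambda>x. h (f x)) -` cdom e \<inter> U)))"
    have oT: "open ?T"
      using fc hf U B.open_cdom[OF d(1)] C.open_cdom[OF e]
      by (intro open_chart_image[OF c] open_Int[of "f -` cdom d \<inter> U"]) (simp_all add: continuous_on_open_vimage)
    have 1: "smooth_on ?T (cmap d \<circ> f \<circ> cinv c)"
      by (rule smooth_on_subset[OF smooth_map_chart[OF f c d(1)] _ oT]) auto
    have 2: "smooth_on (cmap d ` (cdom d \<inter> W \<inter> h -` cdom e)) (cmap e \<circ> h \<circ> cinv d)"
      by (rule B.smooth_map_chart[OF h d(1) e])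
    have "smooth_on ?T (\<lambda>y. (cmap e \<circ> h \<circ> cinv d) ((cmap d \<circ> f \<circ> cinv c) y))"
      by (rule smooth_on_compose[OF 1 2]) (use sub cinv_cmap[OF c] in auto)
    then have "smooth_on ?T (cmap e \<circ> (\<lambda>x. h (f x)) \<circ> cinv c)"
      by (subst smooth_on_cong[of _ _ "\<lambda>y. (cmap e \<circ> h \<circ> cinv d) ((cmap d \<circ> f \<circ> cinv c) y)"])
        (auto simp: cinv_cmap[OF c] B.cinv_cmap[OF d(1)])
    then show "\<exists>T. y \<in> T \<and> T \<subseteq> cmap c ` (cdom c \<inter> U \<inter> (\<lambda>x. h (f x)) -` cdom e) \<and> smooth_on T (cmap e \<circ> (\<lambda>x. h (f x)) \<circ> cinv c)"
      using x d by (intro exI[of _ ?T]) auto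
  qed
qed

lemma pushforward_chart:
  assumes f: "smooth_map A B U f" and v: "v \<in> tangent_space A x" and c: "c \<in> A" "x \<in> cdom c"
    and d: "d \<in> B" "f x \<in> cdom d" and x: "x \<in> U"
  shows "pushforward A B f x v d = fderiv (cmap d \<circ> f \<circ> cinv c) (cmap c x) (v c)"
  using dir_deriv_chart[OF v c, of "cmap d \<circ> f"] smooth_map_differentiable[OF f c(1) d(1) c(2) x d(2)] d
  by (simp add: pushforward_def)

lemma pushforward_tangent:
  assumes f: "smooth_map A B U f" and B: "smooth_atlas B" and v: "v \<in> tangent_space A x" and x: "x \<in> U"
  shows "pushforward A B f x v \<in> tangent_space B (f x)"
  unfolding tangent_space_def
proof (intro CollectI conjI allI ballI impI)
  interpret B: smooth_manifold B by unfold_locales (rule B)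
  fix d assume "\<not> (d \<in> B \<and> f x \<in> cdom d)"
  then show "pushforward A B f x v d = 0" unfolding pushforward_def by (rule if_not_P)
next
  interpret B: smooth_manifold B by unfold_locales (rule B)
  fix d d' assume d: "d \<in> B" and d': "d' \<in> B" and "f x \<in> cdom d \<inter> cdom d'"
  then have fx: "f x \<in> cdom d" "f x \<in> cdom d'" by auto
  define c where "c = chart_at A x"
  have c: "c \<in> A" "x \<in> cdom c" using chart_at by (auto simp: c_def)
  have cc: "cinv c (cmap c x) = x" by (rule cinv_cmap[OF c])
  have D: "((cmap d \<circ> f \<circ> cinv c) has_derivative fderiv (cmap d \<circ> f \<circ> cinv c) (cmap c x)) (at (cmap c x))"
    by (rule fderiv_works[OF smooth_map_differentiable[OF f c(1) d c(2) x fx(1)]])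
  have "((\<lambda>y. cmap d' (cinv d y)) has_derivative chart_jac d d' (f x)) (at ((cmap d \<circ> f \<circ> cinv c) (cmap c x)))"
    using B.transition_derivative[OF d d' fx] by (simp add: cc)
  from diff_chain_at[OF D this]
  have "((cmap d' \<circ> f \<circ> cinv c) has_derivative (\<lambda>w. chart_jac d d' (f x) (fderiv (cmap d \<circ> f \<circ> cinv c) (cmap c x) w))) (at (cmap c x))"
    unfolding o_def
    by (rule has_derivative_transform_within_open[OF _ smooth_on_open[OF smooth_map_chart[OF f c(1) d]]])
      (use x c fx cinv_cmap[OF c(1)] B.cinv_cmap[OF d] in \<open>auto simp: o_def\<close>)
  then show "pushforward A B f x v d' = chart_jac d d' (f x) (pushforward A B f x v d)"
    by (simp add: pushforward_chart[OF f v c d fx(1) x] pushforward_chart[OF f v c d' fx(2) x] fderiv_eq)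
qed

text \<open>The chain rule for a section followed by the projection. It permits the curvature
  equation, which lives on the total space, to be evaluated on vectors of the base.\<close>

lemma pushforward_section:
  assumes b: "smooth_map A B U b" and B: "smooth_atlas B" and p: "smooth_map B A UNIV p"
    and pb: "\<And>z. z \<in> U \<Longrightarrow> p (b z) = z" and v: "v \<in> tangent_space A x" and x: "x \<in> U"
  shows "pushforward B A p (b x) (pushforward A B b x v) = v"
proof (rule tangent_eqI)
  interpret B: smooth_manifold B by unfold_locales (rule B)
  define c where "c = chart_at A x"
  show c: "c \<in> A" "x \<in> cdom c" using chart_at by (auto simp: c_def)
  define d where "d = chart_at B (b x)"
  have d: "d \<in> B" "b x \<in> cdom d" using B.chart_at by (auto simp: d_def)
  show "v \<in> tangent_space A x" by fact
  have T: "pushforward A B b x v \<in> tangent_space B (b x)" by (rule pushforward_tangent[OF b B v x])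
  show "pushforward B A p (b x) (pushforward A B b x v) \<in> tangent_space A x"
    using B.pushforward_tangent[OF p atlas T] pb[OF x] by simp
  have pbx: "p (b x) \<in> cdom c" using pb[OF x] c by simp
  have cc: "cinv c (cmap c x) = x" by (rule cinv_cmap[OF c])
  have D: "((cmap d \<circ> b \<circ> cinv c) has_derivative fderiv (cmap d \<circ> b \<circ> cinv c) (cmap c x)) (at (cmap c x))"
    by (rule fderiv_works[OF smooth_map_differentiable[OF b c(1) d(1) c(2) x d(2)]])
  have D2: "((cmap c \<circ> p \<circ> cinv d) has_derivative fderiv (cmap c \<circ> p \<circ> cinv d) (cmap d (b x))) (at ((cmap d \<circ> b \<circ> cinv c) (cmap c x)))"
    using fderiv_works[OF B.smooth_map_differentiable[OF p d(1) c(1) d(2) UNIV_I pbx]] by (simp add: cc)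
  have "((\<lambda>y. y) has_derivative (\<lambda>w. fderiv (cmap c \<circ> p \<circ> cinv d) (cmap d (b x)) (fderiv (cmap d \<circ> b \<circ> cinv c) (cmap c x) w))) (at (cmap c x))"
    using diff_chain_at[OF D D2] unfolding o_def
    by (rule has_derivative_transform_within_open[OF _ smooth_on_open[OF smooth_map_chart[OF b c(1) d(1)]]])
      (use x c d cinv_cmap[OF c(1)] B.cinv_cmap[OF d(1)] pb in \<open>auto simp: o_def\<close>)
  then have "(\<lambda>w. fderiv (cmap c \<circ> p \<circ> cinv d) (cmap d (b x)) (fderiv (cmap d \<circ> b \<circ> cinv c) (cmap c x) w)) = (\<lambda>w. w)"
    using has_derivative_unique has_derivative_ident by blast
  then show "pushforward B A p (b x) (pushforward A B b x v) c = v c"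
    by (simp add: B.pushforward_chart[OF p T d c(1) pbx UNIV_I] pushforward_chart[OF b v c d x] fun_eq_iff)
qed

end

section \<open>The Levi-Civita connection in charts\<close>

lemma linear_expand_axis:
  fixes L :: "real^'n \<Rightarrow> 'b::real_vector"
  assumes "linear L"
  shows "L u = (\<Sum>i\<in>UNIV. (u $ i) *\<^sub>R L (axis i 1))"
proof -
  have "L (\<Sum>i\<in>UNIV. (u $ i) *\<^sub>R axis i 1) = (\<Sum>i\<in>UNIV. (u $ i) *\<^sub>R L (axis i 1))"
    using assms by (simp add: linear_sum linear_cmul)
  then show ?thesis using basis_expansion[of u] by (simp add: scalar_mult_eq_scaleR)
qed

locale riemannian_manifold = smooth_manifold A for A :: "('m::topological_space, 'n::finite) mchart set" +
  fixes g :: "('m, 'n) metric_field"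
  assumes metric: "riemannian_metric A g"
begin

lemma g_sym: "v \<in> tangent_space A x \<Longrightarrow> w \<in> tangent_space A x \<Longrightarrow> g x v w = g x w v"
  using metric unfolding riemannian_metric_def by blast

lemma g_linear: "v \<in> tangent_space A x \<Longrightarrow> w \<in> tangent_space A x \<Longrightarrow> z \<in> tangent_space A x \<Longrightarrow>
    g x (\<lambda>c. r *\<^sub>R v c + t *\<^sub>R w c) z = r * g x v z + t * g x w z"
  using metric unfolding riemannian_metric_def by blast

lemma g_pos: "v \<in> tangent_space A x \<Longrightarrow> v \<noteq> (\<lambda>c. 0) \<Longrightarrow> g x v v > 0"
  using metric unfolding riemannian_metric_def by blast

definition gc :: "('m, 'n) mchart \<Rightarrow> real^'n \<Rightarrow> real^'n \<Rightarrow> real^'n \<Rightarrow> real" where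
  "gc c y u v = g (cinv c y) (tvec_of A (cinv c y) c u) (tvec_of A (cinv c y) c v)"

definition Gam :: "('m, 'n) mchart \<Rightarrow> real^'n \<Rightarrow> real^'n \<Rightarrow> real^'n \<Rightarrow> real^'n" where
  "Gam c y u v = (\<chi> k. \<Sum>i\<in>UNIV. \<Sum>j\<in>UNIV. christoffel A g c k i j y * u $ i * v $ j)"

lemma g_gc:
  "v \<in> tangent_space A x \<Longrightarrow> w \<in> tangent_space A x \<Longrightarrow> c \<in> A \<Longrightarrow> x \<in> cdom c \<Longrightarrow> g x v w = gc c (cmap c x) (v c) (w c)"
  by (simp add: gc_def cinv_cmap tvec_of_tangent_eq)

context
  fixes c y assumes c: "c \<in> A" and y: "y \<in> cmap c ` cdom c"
begin

lemma tvec_of_tangent': "tvec_of A (cinv c y) c w \<in> tangent_space A (cinv c y)"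
  by (rule tvec_of_tangent[OF c cinv_cdom[OF c y]])

lemma gc_sym: "gc c y u v = gc c y v u"
  unfolding gc_def by (rule g_sym[OF tvec_of_tangent' tvec_of_tangent'])

lemma linear_gc': "linear (\<lambda>u. gc c y u v)"
proof -
  have 1: "gc c y (r *\<^sub>R u + t *\<^sub>R w) v = r * gc c y u v + t * gc c y w v" for r t u w
    unfolding gc_def tvec_of_linear[OF c cinv_cdom[OF c y]]
    by (rule g_linear[OF tvec_of_tangent' tvec_of_tangent' tvec_of_tangent'])
  show ?thesis
    by (rule linearI) (use 1[of 1 _ 1] 1[of _ _ 0] in auto)
qed

lemma linear_gc: "linear (gc c y u)"
  using linear_gc'[of u] gc_sym[of _ u] by simp

lemma gc_pos: "u \<noteq> 0 \<Longrightarrow> gc c y u u > 0"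
  unfolding gc_def
proof (rule g_pos[OF tvec_of_tangent'])
  assume "u \<noteq> 0"
  then show "tvec_of A (cinv c y) c u \<noteq> (\<lambda>c. 0)"
    using tvec_of_self[OF c cinv_cdom[OF c y], of u] by metis
qed

lemma gc_nondegenerate:
  assumes "\<And>w. gc c y u w = gc c y v w"
  shows "u = v"
proof (rule ccontr)
  assume "u \<noteq> v"
  then have "gc c y (u - v) (u - v) > 0" by (intro gc_pos) simp
  moreover have "gc c y (u - v) (u - v) = 0" using assms[of "u - v"] by (simp add: linear_diff[OF linear_gc'])
  ultimately show False by simp
qed

lemma metric_coord_gc: "metric_coord A g c y $ i $ j = gc c y (axis i 1) (axis j 1)"
  by (simp add: metric_coord_def gc_def)

lemma gc_metric_coord: "gc c y u v = (metric_coord A g c y *v u) \<bullet> v"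
proof -
  have "gc c y u v = (\<Sum>i\<in>UNIV. u $ i * (\<Sum>j\<in>UNIV. v $ j * gc c y (axis i 1) (axis j 1)))"
    by (subst linear_expand_axis[OF linear_gc'], subst linear_expand_axis[OF linear_gc]) simp
  also have "\<dots> = (\<Sum>i\<in>UNIV. \<Sum>j\<in>UNIV. u $ i * (v $ j * gc c y (axis j 1) (axis i 1)))"
    by (simp add: sum_distrib_left gc_sym[of "axis _ 1" "axis _ 1"])
  also have "\<dots> = (\<Sum>j\<in>UNIV. \<Sum>i\<in>UNIV. u $ i * (v $ j * gc c y (axis j 1) (axis i 1)))"
    by (rule sum.swap)
  finally show ?thesis
    by (simp add: inner_vec_def matrix_vector_mult_def metric_coord_gc sum_distrib_left sum_distrib_right mult_ac)
qed

lemma metric_coord_inverse: "metric_coord A g c y ** matrix_inv (metric_coord A g c y) = mat 1"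
proof -
  have "inj ((*v) (metric_coord A g c y))"
  proof (subst linear_injective_0)
    show "\<forall>x. metric_coord A g c y *v x = 0 \<longrightarrow> x = 0"
    proof (intro allI impI)
      fix x assume "metric_coord A g c y *v x = 0"
      then have "gc c y x x = 0" unfolding gc_metric_coord by simp
      then show "x = 0" using gc_pos[of x] by force
    qed
  qed simp
  then obtain B where "B ** metric_coord A g c y = mat 1"
    using matrix_left_invertible_injective[of "metric_coord A g c y"] by (auto simp: inj_def)
  then have "metric_coord A g c y ** B = mat 1" using matrix_left_right_inverse by blast
  then show ?thesis using matrix_inv_unique by metis
qed

end

lemma smooth_gc: "c \<in> A \<Longrightarrow> smooth_on (cmap c ` cdom c) (\<lambda>y. gc c y u v)"
proof -
  assume c: "c \<in> A"
  then have "smooth_fun A (cdom c) (\<lambda>x. g x (tvec_of A x c u) (tvec_of A x c v))"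
    using metric unfolding riemannian_metric_def by blast
  from smooth_fun_chart[OF this c] show ?thesis by (simp add: o_def gc_def)
qed

lemma linear_Gam: "linear (Gam c y u)"
  unfolding Gam_def by (rule linearI) (simp_all add: vec_eq_iff algebra_simps sum.distrib sum_distrib_left)

text \<open>The Koszul formula on constant coordinate fields, whose brackets vanish. It removes the
  inverse matrix from the definition of the Christoffel symbols; symmetry, metric compatibility and
  the transformation law all follow from it by nondegeneracy.\<close>

lemma Koszul:
  assumes c: "c \<in> A" and y: "y \<in> cmap c ` cdom c"
  shows "2 * gc c y (Gam c y u v) w
    = fderiv (\<lambda>y. gc c y v w) y u + fderiv (\<lambda>y. gc c y u w) y v - fderiv (\<lambda>y. gc c y u v) y w"
proof -
  define d where "d i j l = partial_deriv i (\<lambda>y. metric_coord A g c y $ j $ l) y" for i j l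
  have mc: "metric_coord A g c y $ i $ j = gc c y (axis i 1) (axis j 1)" for y i j
    by (simp add: metric_coord_def gc_def)
  have opn: "open (cmap c ` cdom c)" by (rule open_chart_image'[OF c])
  have dd: "(\<lambda>y. gc c y p q) differentiable (at y)" for p q by (rule smooth_on_differentiable[OF smooth_gc[OF c] y])
  have D3: "fderiv (\<lambda>y. gc c y q r) y p = (\<Sum>i\<in>UNIV. \<Sum>j\<in>UNIV. \<Sum>l\<in>UNIV. p $ i * (q $ j * (r $ l * d i j l)))" for p q r
  proof -
    have "fderiv (\<lambda>y. gc c y q r) y p = (\<Sum>i\<in>UNIV. (p $ i) *\<^sub>R fderiv (\<lambda>y. gc c y q r) y (axis i 1))"
      by (rule linear_expand_axis[OF linear_frechet_derivative[OF dd]])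
    also have "\<dots> = (\<Sum>i\<in>UNIV. (p $ i) *\<^sub>R (\<Sum>j\<in>UNIV. (q $ j) *\<^sub>R fderiv (\<lambda>y. gc c y (axis j 1) r) y (axis i 1)))"
      by (intro sum.cong refl arg_cong2[where f=scaleR] linear_expand_axis
          linear_fderiv_field[where P="\<lambda>x q. gc c x q r", OF opn y linear_gc'[OF c] dd])
    also have "\<dots> = (\<Sum>i\<in>UNIV. (p $ i) *\<^sub>R (\<Sum>j\<in>UNIV. (q $ j) *\<^sub>R (\<Sum>l\<in>UNIV. (r $ l) *\<^sub>R fderiv (\<lambda>y. gc c y (axis j 1) (axis l 1)) y (axis i 1))))"
      by (intro sum.cong refl arg_cong2[where f=scaleR] linear_expand_axis
          linear_fderiv_field[where P="\<lambda>x r. gc c x _ r", OF opn y linear_gc[OF c] dd])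
    finally show ?thesis by (simp add: d_def mc sum_distrib_left)
  qed
  \<comment> \<open>Twice the Christoffel map with its upper index lowered; the definition raises
    the index again by the inverse metric.\<close>
  define K where "K = (\<chi> l. \<Sum>i\<in>UNIV. \<Sum>j\<in>UNIV. (d i j l + d j i l - d l i j) * u $ i * v $ j)"
  have "Gam c y u v = (1/2) *\<^sub>R (matrix_inv (metric_coord A g c y) *v K)"
  proof -
    have "(\<Sum>i\<in>UNIV. \<Sum>j\<in>UNIV. christoffel A g c k i j y * u $ i * v $ j)
      = 1/2 * (\<Sum>l\<in>UNIV. matrix_inv (metric_coord A g c y) $ k $ l * K $ l)" for k
    proof -
      have "(\<Sum>i\<in>UNIV. \<Sum>j\<in>UNIV. christoffel A g c k i j y * u $ i * v $ j)
        = (\<Sum>i\<in>UNIV. \<Sum>j\<in>UNIV. \<Sum>l\<in>UNIV. 1/2 * (matrix_inv (metric_coord A g c y) $ k $ l * ((d i j l + d j i l - d l i j) * u $ i * v $ j)))"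
        unfolding christoffel_def d_def by (simp add: sum_distrib_left sum_distrib_right mult_ac)
      also have "\<dots> = (\<Sum>l\<in>UNIV. \<Sum>i\<in>UNIV. \<Sum>j\<in>UNIV. 1/2 * (matrix_inv (metric_coord A g c y) $ k $ l * ((d i j l + d j i l - d l i j) * u $ i * v $ j)))"
        by (rule sum_rotate3[symmetric])
      finally show ?thesis by (simp add: K_def sum_distrib_left)
    qed
    then show ?thesis by (simp add: Gam_def vec_eq_iff matrix_vector_mult_def)
  qed
  then have "metric_coord A g c y *v Gam c y u v = (1/2) *\<^sub>R K"
    by (simp add: matrix_vector_mult_scaleR matrix_vector_mul_assoc metric_coord_inverse[OF c y])
  then have "2 * gc c y (Gam c y u v) w = K \<bullet> w" by (simp add: gc_metric_coord[OF c y])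
  also have "\<dots> = (\<Sum>l\<in>UNIV. \<Sum>i\<in>UNIV. \<Sum>j\<in>UNIV. u $ i * (v $ j * (w $ l * d i j l)))
     + (\<Sum>l\<in>UNIV. \<Sum>i\<in>UNIV. \<Sum>j\<in>UNIV. v $ j * (u $ i * (w $ l * d j i l)))
     - (\<Sum>l\<in>UNIV. \<Sum>i\<in>UNIV. \<Sum>j\<in>UNIV. w $ l * (u $ i * (v $ j * d l i j)))"
    by (simp add: K_def inner_vec_def sum.distrib[symmetric] sum_subtractf[symmetric] sum_distrib_right sum_distrib_left algebra_simps)
  also have "(\<Sum>l\<in>UNIV. \<Sum>i\<in>UNIV. \<Sum>j\<in>UNIV. u $ i * (v $ j * (w $ l * d i j l))) = fderiv (\<lambda>y. gc c y v w) y u"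
    unfolding D3 by (rule sum_rotate3)
  also have "(\<Sum>l\<in>UNIV. \<Sum>i\<in>UNIV. \<Sum>j\<in>UNIV. v $ j * (u $ i * (w $ l * d j i l))) = fderiv (\<lambda>y. gc c y u w) y v"
    unfolding D3 by (rule sum_reverse3)
  also have "(\<Sum>l\<in>UNIV. \<Sum>i\<in>UNIV. \<Sum>j\<in>UNIV. w $ l * (u $ i * (v $ j * d l i j))) = fderiv (\<lambda>y. gc c y u v) y w"
    unfolding D3 ..
  finally show ?thesis .
qed

lemma Gam_sym:
  assumes c: "c \<in> A" and y: "y \<in> cmap c ` cdom c"
  shows "Gam c y u v = Gam c y v u"
proof (rule gc_nondegenerate[OF c y])
  fix w
  have "fderiv (\<lambda>y. gc c y u v) y = fderiv (\<lambda>y. gc c y v u) y"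
    by (rule fderiv_cong_open[OF open_chart_image'[OF c] y]) (rule gc_sym[OF c])
  then have "2 * gc c y (Gam c y u v) w = 2 * gc c y (Gam c y v u) w" unfolding Koszul[OF c y] by simp
  then show "gc c y (Gam c y u v) w = gc c y (Gam c y v u) w" by simp
qed

lemma Gam_compat:
  assumes c: "c \<in> A" and y: "y \<in> cmap c ` cdom c"
  shows "fderiv (\<lambda>y. gc c y u v) y w = gc c y (Gam c y w u) v + gc c y u (Gam c y w v)"
proof -
  have s: "fderiv (\<lambda>y. gc c y p q) y = fderiv (\<lambda>y. gc c y q p) y" for p q
    by (rule fderiv_cong_open[OF open_chart_image'[OF c] y]) (rule gc_sym[OF c])
  show ?thesis
    using Koszul[OF c y, of w u v] Koszul[OF c y, of w v u] s[of u v] s[of w v] s[of w u] gc_sym[OF c y, of u "Gam c y w v"]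
    by simp
qed

text \<open>The transformation law of the Christoffel symbols. The metric in one chart is the
  pullback of the metric in the other, so the Koszul formulas of the two charts can be compared;
  they differ by terms with second derivatives of the transition map.\<close>

lemma Gam_transform:
  assumes c: "c \<in> A" "x \<in> cdom c" and d: "d \<in> A" "x \<in> cdom d"
  shows "chart_jac c d x (Gam c (cmap c x) u v)
    = Gam d (cmap d x) (chart_jac c d x u) (chart_jac c d x v)
      + fderiv (\<lambda>y. fderiv (\<lambda>y. cmap d (cinv c y)) y u) (cmap c x) v"
proof -
  define O' where "O' = cmap c ` (cdom c \<inter> cdom d)"
  define y where "y = cmap c x"
  define phi where "phi = (\<lambda>y. cmap d (cinv c y))"
  have opn: "open O'" unfolding O'_def by (rule open_chart_image[OF c(1) open_cdom[OF d(1)]])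
  have y: "y \<in> O'" using c d by (auto simp: O'_def y_def)
  have yc: "y \<in> cmap c ` cdom c" using c by (simp add: y_def)
  have phiy: "phi y = cmap d x" by (simp add: phi_def y_def cinv_cmap[OF c])
  have phid: "phi z \<in> cmap d ` cdom d" "cinv d (phi z) = cinv c z" "chart_jac c d (cinv c z) = fderiv phi z" if "z \<in> O'" for z
    using that cinv_cmap[OF c(1)] cinv_cmap[OF d(1)] unfolding O'_def phi_def chart_jac_eq by auto
  have sphi: "smooth_on O' phi" unfolding O'_def phi_def by (rule smooth_transition[OF c(1) d(1)])
  have J: "chart_jac c d x = fderiv phi y" by (simp add: chart_jac_eq phi_def y_def)
  define S where "S p q = fderiv (\<lambda>y. fderiv phi y p) y q" for p q
  have Ssym: "S p q = S q p" for p q unfolding S_def by (rule second_fderiv_symmetric[OF sphi y])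
  have gcd: "gc c z p q = gc d (phi z) (fderiv phi z p) (fderiv phi z q)" if z: "z \<in> O'" for z p q
  proof -
    have zc: "cinv c z \<in> cdom c" "cinv c z \<in> cdom d" using z cinv_cmap[OF c(1)] by (auto simp: O'_def)
    have t: "tvec_of A (cinv c z) c p = tvec_of A (cinv c z) d (fderiv phi z p)" for p
    proof -
      have "tvec_of A (cinv c z) c p d = fderiv phi z p"
        using zc d phid(3)[OF z] by (simp add: tvec_of_def)
      then show ?thesis using tvec_of_tangent_eq[OF tvec_of_tangent[OF c(1) zc(1)] d(1) zc(2), of p] by simp
    qed
    show ?thesis unfolding gc_def phid(2)[OF z] by (simp add: t)
  qed
  have sgd: "smooth_on O' (\<lambda>z. gc d (phi z) p q)" for p q
    by (rule smooth_on_compose[OF sphi smooth_gc[OF d(1)]]) (use phid in auto)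
  have sJ: "smooth_on O' (\<lambda>z. fderiv phi z p)" for p by (rule smooth_on_fderiv[OF sphi])
  have chain: "fderiv (\<lambda>z. gc d (phi z) p q) y w = fderiv (\<lambda>z. gc d z p q) (phi y) (fderiv phi y w)" for p q w
  proof -
    have "((\<lambda>z. gc d z p q) has_derivative fderiv (\<lambda>z. gc d z p q) (phi y)) (at (phi y))"
      by (rule smooth_on_has_derivative[OF smooth_gc[OF d(1)] phid(1)[OF y]])
    from fderiv_eq[OF diff_chain_at[OF smooth_on_has_derivative[OF sphi y] this]] show ?thesis by (simp add: o_def)
  qed
  have D: "fderiv (\<lambda>z. gc c z p q) y w = fderiv (\<lambda>z. gc d z (fderiv phi y p) (fderiv phi y q)) (phi y) (fderiv phi y w)
     + gc d (phi y) (S p w) (fderiv phi y q) + gc d (phi y) (fderiv phi y p) (S q w)" for p q w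
  proof -
    have l1: "linear (\<lambda>v. gc d (phi z) u v)" and l2: "linear (\<lambda>u. gc d (phi z) u v)" if "z \<in> O'" for z u v
      using linear_gc[OF d(1) phid(1)[OF that]] linear_gc'[OF d(1) phid(1)[OF that]] by auto
    have sm: "smooth_on O' (\<lambda>z. gc d (phi z) (fderiv phi z p) v)" for v
      by (rule smooth_on_linear_field[where P="\<lambda>z u. gc d (phi z) u v", OF l2 sgd sJ])
    have "fderiv (\<lambda>z. gc c z p q) y w = fderiv (\<lambda>z. gc d (phi z) (fderiv phi z p) (fderiv phi z q)) y w"
      by (rule fun_cong[OF fderiv_cong_open[OF opn y]]) (rule gcd)
    also have "\<dots> = fderiv (\<lambda>z. gc d (phi z) (fderiv phi z p) (fderiv phi y q)) y w + gc d (phi y) (fderiv phi y p) (S q w)"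
      unfolding S_def
      by (rule fderiv_linear_field(1)[where P="\<lambda>z v. gc d (phi z) (fderiv phi z p) v", OF opn y])
        (rule l1 smooth_on_differentiable[OF sm y] smooth_on_differentiable[OF sJ y] | assumption)+
    also have "fderiv (\<lambda>z. gc d (phi z) (fderiv phi z p) (fderiv phi y q)) y w
      = fderiv (\<lambda>z. gc d (phi z) (fderiv phi y p) (fderiv phi y q)) y w + gc d (phi y) (S p w) (fderiv phi y q)"
      unfolding S_def
      by (rule fderiv_linear_field(1)[where P="\<lambda>z u. gc d (phi z) u (fderiv phi y q)", OF opn y])
        (rule l2 smooth_on_differentiable[OF sgd y] smooth_on_differentiable[OF sJ y] | assumption)+
    finally show ?thesis unfolding chain by simp
  qed
  note pd = phid(1)[OF y]
  have "fderiv phi y (Gam c y u v) = Gam d (phi y) (fderiv phi y u) (fderiv phi y v) + S u v"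
  proof (rule gc_nondegenerate[OF d(1) pd])
    fix w'
    \<comment> \<open>The Koszul formula in the chart \<open>c\<close> tests against
      \<open>w\<close>; as the Jacobian is invertible, every test vector \<open>w'\<close> of the
      chart \<open>d\<close> is reached.\<close>
    define w where "w = chart_jac d c x w'"
    have w: "fderiv phi y w = w'"
      using chart_jac_cocycle[OF d c d, of w'] chart_jac_id[OF d] by (simp add: w_def J)
    have "2 * gc d (phi y) (fderiv phi y (Gam c y u v)) (fderiv phi y w) = 2 * gc c y (Gam c y u v) w"
      using gcd[OF y] by simp
    \<comment> \<open>Six terms with second derivatives of \<open>phi\<close> arise. By the symmetry
      of \<open>S\<close> four of them cancel in pairs and the remaining two add up to twice the
      pairing with \<open>S u v\<close>.\<close>
    also have "\<dots> = 2 * gc d (phi y) (Gam d (phi y) (fderiv phi y u) (fderiv phi y v) + S u v) (fderiv phi y w)"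
    proof -
      have 1: "gc d (phi y) (fderiv phi y v) (S w u) = gc d (phi y) (S u w) (fderiv phi y v)"
        by (subst gc_sym[OF d(1) pd], subst Ssym) (rule refl)
      have 2: "S v u = S u v" "S w v = S v w" by (rule Ssym)+
      show ?thesis
        unfolding Koszul[OF c(1) yc] D linear_add[OF linear_gc'[OF d(1) pd]]
        using Koszul[OF d(1) pd, of "fderiv phi y u" "fderiv phi y v" "fderiv phi y w"] 1
        unfolding 2 by (simp add: algebra_simps)
    qed
    finally show "gc d (phi y) (fderiv phi y (Gam c y u v)) w'
      = gc d (phi y) (Gam d (phi y) (fderiv phi y u) (fderiv phi y v) + S u v) w'"
      by (simp add: w)
  qed
  then show ?thesis unfolding J phiy[symmetric] y_def[symmetric] S_def phi_def by simp
qed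

lemma levi_civita_chart:
  "c \<in> A \<Longrightarrow> x \<in> cdom c \<Longrightarrow> levi_civita A g x v Y c
    = fderiv (\<lambda>y. Y (cinv c y) c) (cmap c x) (v c) + Gam c (cmap c x) (v c) (Y x c)"
  by (simp add: levi_civita_def Gam_def)

text \<open>The definition gives one coordinate vector per chart, and these must fit together as a
  tangent vector. Differentiating the transformation of the components of \<open>Y\<close> produces
  the same second derivative of the transition map as \<open>Gam_transform\<close>, with its
  arguments exchanged.\<close>

lemma levi_civita_tangent:
  assumes U: "open U" "x \<in> U" and Y: "\<And>z. z \<in> U \<Longrightarrow> Y z \<in> tangent_space A z"
    and dY: "\<And>c. c \<in> A \<Longrightarrow> x \<in> cdom c \<Longrightarrow> (\<lambda>y. Y (cinv c y) c) differentiable (at (cmap c x))"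
    and v: "v \<in> tangent_space A x"
  shows "levi_civita A g x v Y \<in> tangent_space A x"
  unfolding tangent_space_def
proof (intro CollectI conjI allI ballI impI)
  fix c assume "\<not> (c \<in> A \<and> x \<in> cdom c)"
  then show "levi_civita A g x v Y c = 0" unfolding levi_civita_def by (rule if_not_P)
next
  fix c d assume cA: "c \<in> A" and dA: "d \<in> A" and "x \<in> cdom c \<inter> cdom d"
  then have c: "c \<in> A" "x \<in> cdom c" and d: "d \<in> A" "x \<in> cdom d" by auto
  define O' where "O' = cmap c ` (cdom c \<inter> (cdom d \<inter> U))"
  define phi where "phi = (\<lambda>y. cmap d (cinv c y))"
  have opn: "open O'" unfolding O'_def using open_cdom[OF d(1)] U by (intro open_chart_image[OF c(1)]) auto
  have y: "cmap c x \<in> O'" using c d U by (auto simp: O'_def)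
  have sphi: "smooth_on O' phi"
    unfolding phi_def by (rule smooth_on_subset[OF smooth_transition[OF c(1) d(1)] _ opn]) (auto simp: O'_def)
  have phix: "phi (cmap c x) = cmap d x" by (simp add: phi_def cinv_cmap[OF c])
  have J: "chart_jac c d x = fderiv phi (cmap c x)" by (simp add: chart_jac_eq phi_def)
  have Yd: "Y (cinv d (phi z)) d = fderiv phi z (Y (cinv c z) c)" if "z \<in> O'" for z
  proof -
    have z: "cinv c z \<in> cdom c" "cinv c z \<in> cdom d" "cinv c z \<in> U" "cmap c (cinv c z) = z"
      using that cinv_cmap[OF c(1)] by (auto simp: O'_def)
    have "Y (cinv c z) d = chart_jac c d (cinv c z) (Y (cinv c z) c)"
      by (rule tangent_chart[OF Y[OF z(3)] c(1) z(1) d(1) z(2)])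
    then show ?thesis by (simp add: chart_jac_eq z(4) phi_def cinv_cmap[OF d(1) z(2)])
  qed
  have D: "fderiv (\<lambda>y. Y (cinv d y) d) (cmap d x) (chart_jac c d x w)
    = fderiv (\<lambda>z. fderiv phi z (Y x c)) (cmap c x) w + chart_jac c d x (fderiv (\<lambda>z. Y (cinv c z) c) (cmap c x) w)" for w
  proof -
    have "((\<lambda>y. Y (cinv d y) d) has_derivative fderiv (\<lambda>y. Y (cinv d y) d) (cmap d x)) (at (phi (cmap c x)))"
      unfolding phix by (rule fderiv_works[OF dY[OF d]])
    from fderiv_eq[OF diff_chain_at[OF smooth_on_has_derivative[OF sphi y] this]]
    have "fderiv (\<lambda>y. Y (cinv d y) d) (cmap d x) (chart_jac c d x w) = fderiv (\<lambda>z. Y (cinv d (phi z)) d) (cmap c x) w"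
      by (simp add: o_def J)
    also have "\<dots> = fderiv (\<lambda>z. fderiv phi z (Y (cinv c z) c)) (cmap c x) w"
      by (rule fun_cong[OF fderiv_cong_open[OF opn y]]) (rule Yd)
    also have "\<dots> = fderiv (\<lambda>z. fderiv phi z (Y (cinv c (cmap c x)) c)) (cmap c x) w + fderiv phi (cmap c x) (fderiv (\<lambda>z. Y (cinv c z) c) (cmap c x) w)"
      by (rule fderiv_linear_field(1)[OF opn y])
        (auto intro!: smooth_on_linear_fderiv[OF sphi] smooth_on_differentiable[OF smooth_on_fderiv[OF sphi] y] dY[OF c])
    finally show ?thesis by (simp add: J cinv_cmap[OF c])
  qed
  have sym: "fderiv (\<lambda>z. fderiv phi z (Y x c)) (cmap c x) (v c) = fderiv (\<lambda>z. fderiv phi z (v c)) (cmap c x) (Y x c)"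
    by (rule second_fderiv_symmetric[OF sphi y])
  show "levi_civita A g x v Y d = chart_jac c d x (levi_civita A g x v Y c)"
    unfolding levi_civita_chart[OF c] levi_civita_chart[OF d] tangent_chart[OF v c d] tangent_chart[OF Y[OF U(2)] c d]
      linear_add[OF linear_chart_jac[OF c(1) d(1) c(2) d(2)]] D Gam_transform[OF c d] sym
    by (simp add: phi_def)
qed

end

section \<open>Scalar curvature and curvature of the connection form\<close>

context riemannian_manifold
begin

lemma metric_coord_inv_frame:
  fixes e :: "'n \<Rightarrow> real^'n"
  assumes c: "c \<in> A" and y: "y \<in> cmap c ` cdom c"
    and ortho: "\<And>i j. gc c y (e i) (e j) = (if i = j then 1 else 0)"
  shows "matrix_inv (metric_coord A g c y) = (\<chi> i j. \<Sum>a\<in>UNIV. e a $ i * e a $ j)"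
proof -
  have "metric_coord A g c y = (\<chi> i j. gc c y (axis i 1) (axis j 1))"
    by (simp add: metric_coord_def gc_def)
  then show ?thesis
    using gram_matrix_inv[of "gc c y" e, OF linear_gc[OF c y] orthonormal_frame_expansion[OF linear_gc'[OF c y] ortho]]
    by simp
qed

text \<open>The smooth orthonormal frame is a hypothesis because the inverse metric is expressed by
  it, which makes its entries visibly smooth.\<close>

lemma smooth_Gam:
  fixes e :: "'n \<Rightarrow> real^'n \<Rightarrow> real^'n"
  assumes c: "c \<in> A" and V: "open V" "V \<subseteq> cmap c ` cdom c" and e: "\<And>i. smooth_on V (e i)"
    and ortho: "\<And>y i j. y \<in> V \<Longrightarrow> gc c y (e i y) (e j y) = (if i = j then 1 else 0)"
  shows "smooth_on V (\<lambda>y. Gam c y u v)"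
proof (rule smooth_on_componentwise[OF V(1)])
  fix k
  have mc: "smooth_on V (\<lambda>y. metric_coord A g c y $ i $ j)" for i j
    using smooth_on_subset[OF smooth_gc[OF c] V(2) V(1)] by (simp add: metric_coord_def gc_def)
  have ec: "smooth_on V (\<lambda>y. e a y $ i)" for a i
    by (rule smooth_on_linear[OF bounded_linear_vec_nth e])
  have "smooth_on V (\<lambda>y. \<Sum>a\<in>UNIV. e a y $ k * e a y $ l)" for l
    by (intro smooth_on_sum V smooth_on_mult ec)
  then have mi: "smooth_on V (\<lambda>y. matrix_inv (metric_coord A g c y) $ k $ l)" for l
    by (subst smooth_on_cong[of _ _ "\<lambda>y. \<Sum>a\<in>UNIV. e a y $ k * e a y $ l"])
      (use V in \<open>auto simp: metric_coord_inv_frame[OF c _ ortho]\<close>)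
  show "smooth_on V (\<lambda>y. Gam c y u v $ k)"
    unfolding Gam_def christoffel_def vec_lambda_beta
    by (intro smooth_on_sum V smooth_on_mult smooth_on_const smooth_on_add smooth_on_diff smooth_on_fderiv mi mc)
qed

text \<open>The curvature of \<open>spinor_coordinates\<close>, written for a chart alone so that
  the scalar curvature can be treated before any spinor is given.\<close>

definition Rie :: "('m, 'n) mchart \<Rightarrow> real^'n \<Rightarrow> real^'n \<Rightarrow> real^'n \<Rightarrow> real^'n \<Rightarrow> real^'n" where
  "Rie c y u v w = fderiv (\<lambda>y. Gam c y v w) y u - fderiv (\<lambda>y. Gam c y u w) y v
     + Gam c y u (Gam c y v w) - Gam c y v (Gam c y u w)"

text \<open>Two traces are converted into frame sums: the Ricci contraction by
  \<open>trace_eq_frame_sum\<close> and the contraction with the inverse metric by the frame formula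
  for its entries. Both rest on the curvature being trilinear. The chart is the one in which the
  scalar curvature is defined.\<close>

lemma scalar_curvature_frame:
  fixes e :: "'n \<Rightarrow> real^'n \<Rightarrow> real^'n"
  assumes V: "open V" "V \<subseteq> cmap c ` cdom c" "cmap c x \<in> V" and e: "\<And>i. smooth_on V (e i)"
    and ortho: "\<And>y i j. y \<in> V \<Longrightarrow> gc c y (e i y) (e j y) = (if i = j then 1 else 0)"
    and c: "c = chart_at A x" and y: "y = cmap c x"
  shows "scalar_curvature A g x = (\<Sum>i\<in>UNIV. \<Sum>j\<in>UNIV. gc c y (Rie c y (e i y) (e j y) (e j y)) (e i y))"
proof -
  have cA: "c \<in> A" and xc: "x \<in> cdom c" using chart_at c by auto
  have yV: "y \<in> V" and yc: "y \<in> cmap c ` cdom c" using V y by auto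
  note sG = smooth_Gam[OF cA V(1,2) e ortho]
  note dG = smooth_on_differentiable[OF sG yV]
  have lG: "linear (\<lambda>v. Gam c z v w)" if "z \<in> V" for z w
    using linear_Gam[of c z w] Gam_sym[OF cA, of z _ w] that V by (simp add: subset_iff)
  have lG1: "linear (\<lambda>v. Gam c y v w)" for w by (rule lG[OF yV])
  have lf: "linear (fderiv (\<lambda>y. Gam c y v w) y)" for v w by (rule linear_frechet_derivative[OF dG])
  have lf1: "linear (\<lambda>v. fderiv (\<lambda>y. Gam c y v w) y u)" for u w
    by (rule linear_fderiv_field[where P="\<lambda>x v. Gam c x v w", OF V(1) yV lG dG])
  have lf2: "linear (\<lambda>w. fderiv (\<lambda>y. Gam c y v w) y u)" for u v
    by (rule linear_fderiv_field[where P="\<lambda>x w. Gam c x v w", OF V(1) yV linear_Gam dG])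
  note comp = linear_compose[unfolded o_def]
  have R1: "linear (\<lambda>u. Rie c y u v w)" for v w
    unfolding Rie_def
    by (intro linear_compose_add linear_compose_sub lf lf1 lG1 comp[OF lG1 linear_Gam])
  have R2: "linear (\<lambda>v. Rie c y u v w)" for u w
    unfolding Rie_def
    by (intro linear_compose_add linear_compose_sub lf lf1 lG1 comp[OF lG1 linear_Gam])
  have R3: "linear (\<lambda>w. Rie c y u v w)" for u v
    unfolding Rie_def
    by (intro linear_compose_add linear_compose_sub lf2 comp[OF linear_Gam linear_Gam])
  have Gax: "Gam c z (axis i 1) (axis j 1) $ k = christoffel A g c k i j z" for z i j k
  proof -
    have "Gam c z (axis i 1) (axis j 1) $ k = (\<Sum>p\<in>UNIV. \<Sum>q\<in>UNIV. if q = j then (if p = i then christoffel A g c k p q z else 0) else 0)"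
      unfolding Gam_def vec_lambda_beta by (intro sum.cong refl) (simp add: axis_def)
    then show ?thesis by simp
  qed
  have Gax2: "Gam c z (axis i 1) w $ k = (\<Sum>m\<in>UNIV. christoffel A g c k i m z * w $ m)" for z i w k
  proof -
    have "Gam c z (axis i 1) w $ k = (\<Sum>p\<in>UNIV. if p = i then (\<Sum>q\<in>UNIV. christoffel A g c k p q z * w $ q) else 0)"
      unfolding Gam_def vec_lambda_beta by (intro sum.cong refl) (simp add: axis_def)
    then show ?thesis by simp
  qed
  have Dax: "fderiv (\<lambda>y. Gam c y (axis i 1) (axis j 1)) y u $ k = fderiv (christoffel A g c k i j) y u" for i j k u
  proof -
    have "fderiv (\<lambda>y. Gam c y (axis i 1) (axis j 1) $ k) y u = fderiv (\<lambda>y. Gam c y (axis i 1) (axis j 1)) y u $ k"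
      by (rule fderiv_linear[OF bounded_linear_vec_nth dG])
    then show ?thesis by (simp add: Gax)
  qed
  have rc: "riemann_coord A g c l i j k y = Rie c y (axis i 1) (axis j 1) (axis k 1) $ l" for l i j k
    unfolding riemann_coord_def Rie_def by (simp add: Dax Gax sum_subtractf
        Gax2[of y i "Gam c y (axis j 1) (axis k 1)"] Gax2[of y j "Gam c y (axis i 1) (axis k 1)"])
  \<comment> \<open>\<open>F v w\<close> is the Ricci tensor at \<open>y\<close>.\<close>
  define F where "F v w = (\<Sum>a\<in>UNIV. gc c y (Rie c y (e a y) v w) (e a y))" for v w
  have F1: "linear (\<lambda>v. F v w)" for w
    unfolding F_def by (intro linear_compose_sum ballI comp[OF R2 linear_gc'[OF cA yc]])
  have F2: "linear (F v)" for v
    unfolding F_def by (intro linear_compose_sum ballI comp[OF R3 linear_gc'[OF cA yc]])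
  have tr: "(\<Sum>i\<in>UNIV. Rie c y (axis i 1) v w $ i) = F v w" for v w
    unfolding F_def
    by (rule trace_eq_frame_sum[OF linear_gc'[OF cA yc] orthonormal_frame_expansion[OF linear_gc'[OF cA yc] ortho[OF yV]] R1])
  have "scalar_curvature A g x = (\<Sum>j\<in>UNIV. \<Sum>k\<in>UNIV. (\<Sum>a\<in>UNIV. e a y $ j * e a y $ k) * F (axis j 1) (axis k 1))"
    unfolding scalar_curvature_def Let_def c[symmetric] y[symmetric]
    by (simp add: metric_coord_inv_frame[OF cA yc ortho[OF yV]] rc tr)
  also have "\<dots> = (\<Sum>j\<in>UNIV. \<Sum>k\<in>UNIV. \<Sum>a\<in>UNIV. e a y $ j * (e a y $ k * F (axis j 1) (axis k 1)))"
    by (simp add: sum_distrib_right mult.assoc)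
  also have "\<dots> = (\<Sum>a\<in>UNIV. \<Sum>j\<in>UNIV. \<Sum>k\<in>UNIV. e a y $ j * (e a y $ k * F (axis j 1) (axis k 1)))"
    by (rule sum_rotate3[symmetric])
  also have "\<dots> = (\<Sum>a\<in>UNIV. F (e a y) (e a y))"
    by (intro sum.cong refl, subst (2) linear_expand_axis[OF F1], subst (2) linear_expand_axis[OF F2])
      (simp add: sum_distrib_left)
  finally show ?thesis unfolding F_def by (subst sum.swap)
qed

end

context smooth_manifold
begin

text \<open>The exterior derivative commutes with pullback along \<open>s\<close>; \<open>al\<close>
  is the pulled back form in coordinates. The two orders of differentiation produce the same second
  derivative of \<open>s\<close>, which therefore cancels. In the last claim \<open>d\<close> is the
  chart in which \<open>ext_deriv\<close> extends vectors to constant fields.\<close>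

lemma
  fixes alpha :: "'q::topological_space \<Rightarrow> ('q, 'f::euclidean_space) tvec \<Rightarrow> complex"
  assumes Q: "smooth_atlas Q" and s: "smooth_map A Q U s"
    and lin: "\<And>u v w r t. v \<in> tangent_space Q u \<Longrightarrow> w \<in> tangent_space Q u \<Longrightarrow>
        alpha u (\<lambda>c. r *\<^sub>R v c + t *\<^sub>R w c) = r *\<^sub>R alpha u v + t *\<^sub>R alpha u w"
    and smooth: "\<And>d w. d \<in> Q \<Longrightarrow> smooth_fun Q (cdom d) (\<lambda>u. alpha u (tvec_of Q u d w))"
    and c: "c \<in> A" and d: "d \<in> Q"
  defines "V \<equiv> cmap c ` (cdom c \<inter> U \<inter> s -` cdom d)"
  defines "al y v \<equiv> alpha (s (cinv c y)) (pushforward A Q s (cinv c y) (tvec_of A (cinv c y) c v))"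
  shows smooth_pullback: "smooth_on V (\<lambda>y. al y v)"
    and linear_pullback: "y \<in> V \<Longrightarrow> linear (al y)"
    and ext_deriv_pullback: "x \<in> cdom c \<Longrightarrow> x \<in> U \<Longrightarrow> d = chart_at Q (s x) \<Longrightarrow> X \<in> tangent_space A x \<Longrightarrow> Y \<in> tangent_space A x \<Longrightarrow>
      ext_deriv Q alpha (s x) (pushforward A Q s x X) (pushforward A Q s x Y)
        = fderiv (\<lambda>y. al y (Y c)) (cmap c x) (X c) - fderiv (\<lambda>y. al y (X c)) (cmap c x) (Y c)"
proof -
  interpret Q: smooth_manifold Q by unfold_locales (rule Q)
  define phi where "phi = cmap d \<circ> s \<circ> cinv c"
  have sphi: "smooth_on V phi" unfolding V_def phi_def by (rule smooth_map_chart[OF s c d])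
  have V: "open V" by (rule smooth_on_open[OF sphi])
  \<comment> \<open>The form itself in the chart \<open>d\<close>. Pulling back means composing it
    with \<open>phi\<close> and with the derivative of \<open>phi\<close>.\<close>
  define be where "be z w = alpha (cinv d z) (tvec_of Q (cinv d z) d w)" for z w
  have sbe: "smooth_on (cmap d ` cdom d) (\<lambda>z. be z w)" for w
    using Q.smooth_fun_chart[OF smooth[OF d] d] by (simp add: be_def o_def)
  have lbe: "linear (be z)" if "z \<in> cmap d ` cdom d" for z
  proof -
    have zd: "cinv d z \<in> cdom d" by (rule Q.cinv_cdom[OF d that])
    have 1: "be z (r *\<^sub>R u + t *\<^sub>R w) = r *\<^sub>R be z u + t *\<^sub>R be z w" for r t u w
      unfolding be_def Q.tvec_of_linear[OF d zd] by (rule lin[OF Q.tvec_of_tangent[OF d zd] Q.tvec_of_tangent[OF d zd]])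
    show ?thesis by (rule linearI) (use 1[of 1 _ 1] 1[of _ _ 0] in auto)
  qed
  have phid: "phi y \<in> cmap d ` cdom d" "cinv d (phi y) = s (cinv c y)" "cinv c y \<in> cdom c" "cinv c y \<in> U"
    "s (cinv c y) \<in> cdom d" "cmap c (cinv c y) = y" if "y \<in> V" for y
    using that cinv_cmap[OF c] Q.cinv_cmap[OF d] by (auto simp: V_def phi_def)
  have al: "al y v = be (phi y) (fderiv phi y v)" if y: "y \<in> V" for y v
  proof -
    let ?x = "cinv c y"
    have t: "tvec_of A ?x c v \<in> tangent_space A ?x" by (rule tvec_of_tangent[OF c phid(3)[OF y]])
    have p: "pushforward A Q s ?x (tvec_of A ?x c v) \<in> tangent_space Q (s ?x)"
      by (rule pushforward_tangent[OF s Q t phid(4)[OF y]])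
    have "pushforward A Q s ?x (tvec_of A ?x c v) d = fderiv phi y v"
      using pushforward_chart[OF s t c phid(3)[OF y] d phid(5)[OF y] phid(4)[OF y]]
      by (simp add: phi_def[symmetric] tvec_of_self[OF c phid(3)[OF y]] phid(6)[OF y])
    then have "tvec_of Q (s ?x) d (fderiv phi y v) = pushforward A Q s ?x (tvec_of A ?x c v)"
      using Q.tvec_of_tangent_eq[OF p d phid(5)[OF y]] by simp
    then show ?thesis by (simp add: al_def be_def phid(2)[OF y])
  qed
  have sbp: "smooth_on V (\<lambda>y. be (phi y) w)" for w
    by (rule smooth_on_compose[OF sphi sbe]) (use phid in blast)
  have "smooth_on V (\<lambda>y. be (phi y) (fderiv phi y v))" for v
    by (rule smooth_on_linear_field[OF lbe[OF phid(1)] sbp smooth_on_fderiv[OF sphi]])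
  then show "smooth_on V (\<lambda>y. al y v)"
    by (subst smooth_on_cong[OF al])
  show "linear (al y)" if y: "y \<in> V"
  proof -
    have "al y = (\<lambda>v. be (phi y) (fderiv phi y v))" using al[OF y] by blast
    then show ?thesis
      using linear_compose[OF smooth_on_linear_fderiv[OF sphi y] lbe[OF phid(1)[OF y]]] by (simp add: o_def)
  qed
  assume x: "x \<in> cdom c" "x \<in> U" and dx: "d = chart_at Q (s x)" and X: "X \<in> tangent_space A x" and Y: "Y \<in> tangent_space A x"
  have sx: "s x \<in> cdom d" using Q.chart_at dx by simp
  define y where "y = cmap c x"
  have y: "y \<in> V" using x sx by (auto simp: y_def V_def)
  have cy: "cinv c y = x" by (simp add: y_def cinv_cmap[OF c x(1)])
  have phiy: "phi y = cmap d (s x)" by (simp add: phi_def cy)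
  have D: "fderiv (\<lambda>y. al y p) y q = fderiv (\<lambda>z. be z (fderiv phi y p)) (phi y) (fderiv phi y q)
     + be (phi y) (fderiv (\<lambda>y. fderiv phi y p) y q)" for p q
  proof -
    have "fderiv (\<lambda>y. al y p) y q = fderiv (\<lambda>y. be (phi y) (fderiv phi y p)) y q"
      by (rule fun_cong[OF fderiv_cong_open[OF V y]]) (rule al)
    also have "\<dots> = fderiv (\<lambda>z. be (phi z) (fderiv phi y p)) y q + be (phi y) (fderiv (\<lambda>y. fderiv phi y p) y q)"
      by (rule fderiv_linear_field(1)[where P="\<lambda>z v. be (phi z) v", OF V y])
        (rule lbe[OF phid(1)] smooth_on_differentiable[OF sbp y] smooth_on_differentiable[OF smooth_on_fderiv[OF sphi] y] | assumption)+
    also have "fderiv (\<lambda>z. be (phi z) (fderiv phi y p)) y q = fderiv (\<lambda>z. be z (fderiv phi y p)) (phi y) (fderiv phi y q)"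
      using fderiv_eq[OF diff_chain_at[OF smooth_on_has_derivative[OF sphi y] smooth_on_has_derivative[OF sbe phid(1)[OF y]]]]
      by (simp add: o_def)
    finally show ?thesis .
  qed
  have pd: "pushforward A Q s x v d = fderiv phi y (v c)" if "v \<in> tangent_space A x" for v
    unfolding phi_def y_def by (rule pushforward_chart[OF s that c x(1) d sx x(2)])
  have dd: "dir_deriv Q (s x) (pushforward A Q s x p) (\<lambda>y. alpha y (tvec_of Q y d r)) = fderiv (\<lambda>z. be z r) (phi y) (fderiv phi y (p c))"
    if p: "p \<in> tangent_space A x" for p r
  proof -
    have o: "(\<lambda>y. alpha y (tvec_of Q y d r)) \<circ> cinv d = (\<lambda>z. be z r)" by (simp add: be_def o_def)
    have df: "(\<lambda>z. be z r) differentiable (at (cmap d (s x)))"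
      by (rule smooth_on_differentiable[OF sbe]) (use sx in auto)
    show ?thesis
      using Q.dir_deriv_chart[OF pushforward_tangent[OF s Q p x(2)] d sx, of "\<lambda>y. alpha y (tvec_of Q y d r)"] df
      unfolding o by (simp add: pd[OF p] phiy)
  qed
  have "ext_deriv Q alpha (s x) (pushforward A Q s x X) (pushforward A Q s x Y)
     = fderiv (\<lambda>z. be z (fderiv phi y (Y c))) (phi y) (fderiv phi y (X c)) - fderiv (\<lambda>z. be z (fderiv phi y (X c))) (phi y) (fderiv phi y (Y c))"
    unfolding ext_deriv_def Let_def dx[symmetric] dd[OF X] dd[OF Y] pd[OF X] pd[OF Y] ..
  also have "\<dots> = fderiv (\<lambda>y. al y (Y c)) y (X c) - fderiv (\<lambda>y. al y (X c)) y (Y c)"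
    unfolding D second_fderiv_symmetric[OF sphi y, of "X c" "Y c"] by simp
  finally show "ext_deriv Q alpha (s x) (pushforward A Q s x X) (pushforward A Q s x Y)
     = fderiv (\<lambda>y. al y (Y c)) (cmap c x) (X c) - fderiv (\<lambda>y. al y (X c)) (cmap c x) (Y c)"
    by (simp add: y_def)
qed

end

section \<open>The spinor representation as a Clifford module, and its unitarity\<close>

lemma complex_inner: "inner (a::complex) b = Re (a * cnj b)"
  by (simp add: inner_complex_def)

lemma inner_eq_Re_herm: "x \<bullet> (y :: complex^'k) = Re (\<Sum>i\<in>UNIV. x $ i * cnj (y $ i))"
  by (simp add: inner_vec_def complex_inner)

lemma cl_mult_axis:
  "cl_mult (axis A a) (axis B b) = axis ((A - B) \<union> (B - A)) (cl_sign A B * a * b)"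
proof -
  have "cl_mult (axis A a) (axis B b) $ C = (\<Sum>A'\<in>UNIV. \<Sum>B'\<in>UNIV.
      if B' = B then (if A' = A then (if (A - B) \<union> (B - A) = C then cl_sign A B * a * b else 0) else 0) else 0)" for C
    unfolding cl_mult_def vec_lambda_beta by (intro sum.cong refl) (auto simp: axis_def)
  then show ?thesis by (simp add: vec_eq_iff axis_def)
qed

lemma cl_vec_axis: "cl_vec (axis j 1) = axis {j} 1"
proof -
  have "cl_vec (axis j 1) = (\<Sum>i\<in>UNIV. if i = j then axis {j} 1 else 0)"
    unfolding cl_vec_def by (intro sum.cong refl) (auto simp: axis_def vec_eq_iff)
  then show ?thesis by simp
qed

text \<open>For distinct generators exactly one of the two orders requires a transposition, so the
  signs are opposite. For equal ones the only contribution to the sign is the common index.\<close>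

lemma cl_generators:
  "cl_mult (axis {i} 1) (axis {j} 1) + cl_mult (axis {j} 1) (axis {i} 1) = (if i = j then - 2 else 0) *s cl_one"
proof (cases "i = j")
  case True
  have empty: "{(a, b). a = j \<and> b = j \<and> b < a} = {}" by auto
  have "cl_sign {j} {j} = -1" unfolding cl_sign_def by (simp add: empty)
  then show ?thesis using True unfolding cl_mult_axis by (simp add: cl_one_def vec_eq_iff axis_def)
next
  case False
  have 1: "{(a, b). a \<in> {i} \<and> b \<in> {j} \<and> b < a} = (if j < i then {(i,j)} else {})" for i j :: 'a by auto
  have "cl_sign {i} {j} = - cl_sign {j} {i}"
    using False unfolding cl_sign_def 1 by auto
  then show ?thesis
    using False unfolding cl_mult_axis by (simp add: insert_commute vec_eq_iff axis_def)
qed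

lemma sum_matrix_vector: "(\<Sum>i\<in>I. M i) *v (x :: complex^'k) = (\<Sum>i\<in>I. (M i :: complex^'k^'k) *v x)"
  by (induction I rule: infinite_finite_induct) (simp_all add: matrix_vector_mult_add_rdistrib)

lemma scaleR_eq_scalar: "t *\<^sub>R (x :: complex^'k) = complex_of_real t *s x"
  unfolding vec_eq_iff vector_scaleR_component vector_smult_component by (simp add: scaleR_conv_of_real)

lemma linear_matrix: "linear (\<lambda>x. (M :: complex^'k^'k) *v x)"
proof (rule linearI)
  show "M *v (x + y) = M *v x + M *v y" for x y by (rule matrix_vector_right_distrib)
  show "M *v (t *\<^sub>R x) = t *\<^sub>R (M *v x)" for t x
    by (simp add: vec_eq_iff matrix_vector_mult_def scaleR_sum_right)
qed

lemma skew_matrix_inner: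
  assumes "\<And>i j. (M :: complex^'k^'k) $ i $ j = - cnj (M $ j $ i)"
  shows "(M *v x) \<bullet> y = - (x \<bullet> (M *v y))"
proof -
  have "(\<Sum>i\<in>UNIV. (M *v x) $ i * cnj (y $ i)) = (\<Sum>i\<in>UNIV. \<Sum>j\<in>UNIV. M $ i $ j * x $ j * cnj (y $ i))"
    by (simp add: matrix_vector_mult_def sum_distrib_right)
  also have "\<dots> = (\<Sum>j\<in>UNIV. \<Sum>i\<in>UNIV. M $ i $ j * x $ j * cnj (y $ i))" by (rule sum.swap)
  also have "\<dots> = (\<Sum>j\<in>UNIV. \<Sum>i\<in>UNIV. - (x $ j * cnj (M $ j $ i * y $ i)))"
    by (intro sum.cong refl) (subst assms, simp)
  also have "\<dots> = - (\<Sum>j\<in>UNIV. x $ j * cnj ((M *v y) $ j))"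
    by (simp add: matrix_vector_mult_def sum_distrib_left sum_negf)
  finally show ?thesis unfolding inner_eq_Re_herm by simp
qed

lemma norm_scalar: "norm (z *s (x :: complex^'k)) = norm z * norm x"
  by (simp add: norm_vec_def norm_mult L2_set_right_distrib[symmetric])

locale spinor_representation =
  fixes r :: "'n::{finite,linorder} cliff \<Rightarrow> complex^'k^'k"
  assumes rep: "spinor_rep r"
begin

lemma rep_add: "r (a + b) = r a + r b"
  and rep_scale: "r (z *s a) = (\<chi> i j. z * r a $ i $ j)"
  and rep_mult: "r (cl_mult a b) = r a ** r b"
  and rep_one: "r cl_one = mat 1"
  and rep_skew: "r (cl_vec v) $ i $ j = - cnj (r (cl_vec v) $ j $ i)"
  using rep unfolding spinor_rep_def by blast+

definition R :: "'n \<Rightarrow> complex^'k \<Rightarrow> complex^'k" where "R j x = r (cl_vec (axis j 1)) *v x"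

lemma rep_scale_vec: "r (z *s a) *v x = z *s (r a *v x)"
  by (simp add: rep_scale vec_eq_iff matrix_vector_mult_def sum_distrib_left mult.assoc)

lemma rep_zero: "r 0 = 0"
  using rep_add[of 0 0] by simp

lemma rep_sum: "r (\<Sum>i\<in>I. a i) = (\<Sum>i\<in>I. r (a i))"
  by (induction I rule: infinite_finite_induct) (simp_all add: rep_zero rep_add)

lemma rep_cl_vec: "r (cl_vec v) *v x = (\<Sum>j\<in>UNIV. (v $ j) *\<^sub>R R j x)"
proof -
  have "axis {j} (complex_of_real (v $ j)) = complex_of_real (v $ j) *s cl_vec (axis j 1)" for j
    unfolding cl_vec_axis by (simp add: vec_eq_iff axis_def)
  then show ?thesis
    unfolding cl_vec_def[of v] R_def scaleR_eq_scalar
    by (simp add: rep_sum sum_matrix_vector rep_scale_vec)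
qed

sublocale clifford_module R "\<lambda>x. \<i> *s x"
proof (rule clifford_module.intro)
  fix i j :: 'n and x y :: "complex^'k"
  show "linear (R j)" unfolding R_def by (rule linear_matrix)
  show "R j x \<bullet> y = - (x \<bullet> R j y)" unfolding R_def by (rule skew_matrix_inner[OF rep_skew])
  show "R i (R j x) + R j (R i x) = (if i = j then - 2 else 0) *\<^sub>R x"
  proof -
    have "R i (R j x) + R j (R i x) = r (cl_mult (axis {i} 1) (axis {j} 1) + cl_mult (axis {j} 1) (axis {i} 1)) *v x"
      unfolding R_def rep_add rep_mult cl_vec_axis by (simp add: matrix_vector_mul_assoc matrix_vector_mult_add_rdistrib)
    also have "\<dots> = (if i = j then - 2 else 0) *s x"
      unfolding cl_generators rep_scale_vec by (simp add: rep_one)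
    finally show ?thesis unfolding scaleR_eq_scalar by simp
  qed
  show "linear (\<lambda>x. \<i> *s (x :: complex^'k))"
    by (rule linearI) (simp_all add: vec_eq_iff algebra_simps)
  show "(\<i> *s x) \<bullet> y = - (x \<bullet> (\<i> *s y))"
    unfolding inner_eq_Re_herm by (simp add: sum_negf[symmetric] mult_ac) 
  show "\<i> *s (\<i> *s x) = - x" by (simp add: vec_eq_iff)
  show "\<i> *s R j x = R j (\<i> *s x)"
    by (simp add: R_def vec_eq_iff matrix_vector_mult_def sum_distrib_left mult_ac)
qed

text \<open>Symmetrising the double sum over the components of \<open>v\<close> replaces each
  product of generators by half an anticommutator, so only the diagonal survives.\<close>

lemma rep_cl_vec_sq: "r (cl_vec v) *v (r (cl_vec v) *v x) = - (v \<bullet> v) *\<^sub>R x"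
proof -
  define X where "X = (\<Sum>i\<in>UNIV. \<Sum>j\<in>UNIV. (v $ i * v $ j) *\<^sub>R R i (R j x))"
  have e: "r (cl_vec v) *v (r (cl_vec v) *v x) = X"
    unfolding rep_cl_vec X_def by (simp add: rho_simps scaleR_sum_right)
  have "X = (\<Sum>i\<in>UNIV. \<Sum>j\<in>UNIV. (v $ i * v $ j) *\<^sub>R R j (R i x))"
    unfolding X_def by (subst sum.swap) (simp add: mult.commute)
  then have "X + X = (\<Sum>i\<in>UNIV. \<Sum>j\<in>UNIV. (v $ i * v $ j) *\<^sub>R (R i (R j x) + R j (R i x)))"
    by (simp add: X_def scaleR_add_right sum.distrib)
  also have "\<dots> = (\<Sum>i\<in>UNIV. \<Sum>j\<in>UNIV. (if i = j then - 2 else 0) *\<^sub>R ((v $ i * v $ j) *\<^sub>R x))"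
    unfolding rho_clifford by (simp add: mult.commute)
  also have "\<dots> = 2 *\<^sub>R (- (v \<bullet> v) *\<^sub>R x)"
    unfolding sum_delta_scaleR by (simp add: inner_vec_def scaleR_sum_left[symmetric] sum_distrib_left sum_negf)
  finally have "2 *\<^sub>R X = 2 *\<^sub>R (- (v \<bullet> v) *\<^sub>R x)" by (simp add: scaleR_2)
  then have "X = - (v \<bullet> v) *\<^sub>R x" by (metis scaleR_cancel_left zero_neq_numeral)
  then show ?thesis unfolding e .
qed

lemma rep_unit_norm: "norm v = 1 \<Longrightarrow> norm (r (cl_vec v) *v x) = norm x"
proof -
  assume v: "norm v = 1"
  have "(r (cl_vec v) *v x) \<bullet> (r (cl_vec v) *v x) = - (x \<bullet> (r (cl_vec v) *v (r (cl_vec v) *v x)))"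
    by (rule skew_matrix_inner[OF rep_skew])
  also have "\<dots> = x \<bullet> x" using v by (simp add: rep_cl_vec_sq dot_square_norm)
  finally show ?thesis by (simp add: norm_eq)
qed

text \<open>A unit vector acts as a skew operator with square -1, hence isometrically, and so do
  products of unit vectors and unit scalars. This makes the length of a spinor independent of the
  point of the fibre at which it is evaluated.\<close>

lemma rep_unitary: "a \<in> spinc_group \<Longrightarrow> norm (r a *v x) = norm x"
proof -
  have "norm (r h *v x) = norm x" if "h \<in> spin_group" for h x
    using that
  proof (induction arbitrary: x)
    case spin_one
    then show ?case by (simp add: rep_one)
  next
    case (spin_step a v w)
    then show ?case by (simp add: rep_mult matrix_vector_mul_assoc[symmetric] rep_unit_norm)
  qed
  then show "a \<in> spinc_group \<Longrightarrow> norm (r a *v x) = norm x"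
    unfolding spinc_group_def by (auto simp: rep_scale_vec norm_scalar)
qed

end

section \<open>\<open>Spin\<^sup>c\<close> manifolds\<close>

context riemannian_manifold
begin

lemma so_frames_chart:
  assumes "e \<in> so_frames A g x" "c \<in> A" "x \<in> cdom c"
  shows "gc c (cmap c x) (e i c) (e j c) = (if i = j then 1 else 0)"
proof -
  have "e i \<in> tangent_space A x" "e j \<in> tangent_space A x" "g x (e i) (e j) = (if i = j then 1 else 0)"
    using assms(1) unfolding so_frames_def by auto
  then show ?thesis using g_gc[OF _ _ assms(2,3)] by simp
qed

lemma onframe: "e \<in> so_frames A g x \<Longrightarrow> onframe A g x \<in> so_frames A g x"
  unfolding onframe_def by (auto simp: some_in_eq)

lemma frame_sum_chart:
  assumes e: "e \<in> so_frames A g x" and f: "f \<in> so_frames A g x" and c: "c \<in> A" "x \<in> cdom c"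
    and "\<And>v. linear (\<lambda>u. B u v)" "\<And>u. linear (B u)"
  shows "(\<Sum>i\<in>UNIV. B (f i c) (f i c)) = (\<Sum>i\<in>UNIV. B (e i c) (e i c))"
proof -
  have y: "cmap c x \<in> cmap c ` cdom c" using c by simp
  show ?thesis
    by (rule trace_frame_independent[where G="gc c (cmap c x)"])
      (intro linear_gc[OF c(1) y] so_frames_chart[OF e c] gc_sym[OF c(1) y] assms(5,6)
        orthonormal_frame_expansion[OF linear_gc'[OF c(1) y] so_frames_chart[OF e c]]
        orthonormal_frame_expansion[OF linear_gc'[OF c(1) y] so_frames_chart[OF f c]])+
qed

text \<open>Frame independence of the Hilbert-Schmidt norm: one index is exchanged at a time while
  the other argument is held fixed.\<close>

lemma frame_double_sum_chart:
  fixes T :: "real^'n \<Rightarrow> real^'n \<Rightarrow> real"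
  assumes e: "e \<in> so_frames A g x" and f: "f \<in> so_frames A g x" and c: "c \<in> A" "x \<in> cdom c"
    and T1: "\<And>v. linear (\<lambda>u. T u v)" and T2: "\<And>u. linear (T u)"
  shows "(\<Sum>i\<in>UNIV. \<Sum>j\<in>UNIV. (T (f i c) (f j c))\<^sup>2) = (\<Sum>i\<in>UNIV. \<Sum>j\<in>UNIV. (T (e i c) (e j c))\<^sup>2)"
proof -
  have l: "linear (\<lambda>u. L u * r)" "linear (\<lambda>u. r * L u)" if "linear L" for L :: "real^'n \<Rightarrow> real" and r
    by (rule linearI; simp add: linear_add[OF that] linear_cmul[OF that] algebra_simps)+
  have "(\<Sum>i\<in>UNIV. (T (f i c) v)\<^sup>2) = (\<Sum>i\<in>UNIV. (T (e i c) v)\<^sup>2)" for v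
    unfolding power2_eq_square
    by (rule frame_sum_chart[OF e f c, where B="\<lambda>p q. T p v * T q v"]) (intro l T1)+
  moreover have "(\<Sum>j\<in>UNIV. (T u (f j c))\<^sup>2) = (\<Sum>j\<in>UNIV. (T u (e j c))\<^sup>2)" for u
    unfolding power2_eq_square
    by (rule frame_sum_chart[OF e f c, where B="\<lambda>p q. T u p * T u q"]) (intro l T2)+
  ultimately show ?thesis
    using sum.swap[of "\<lambda>i j. (T (f i c) (e j c))\<^sup>2" UNIV UNIV] sum.swap[of "\<lambda>i j. (T (e i c) (e j c))\<^sup>2" UNIV UNIV]
    by simp
qed

text \<open>The description of \<open>endo_of\<close> is resolved by Riesz representation in the
  orthonormal frame. Since every vector is the sum of its frame components, the norm becomes the sum
  of the squared matrix entries of \<open>T\<close>.\<close>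

lemma endo_norm_sq_chart:
  assumes f: "onframe A g x \<in> so_frames A g x" and c: "c \<in> A" "x \<in> cdom c"
    and B: "\<And>X Y. X \<in> tangent_space A x \<Longrightarrow> Y \<in> tangent_space A x \<Longrightarrow> B X Y = T (X c) (Y c)"
    and T2: "\<And>u. linear (T u)"
  shows "endo_norm_sq A g x (endo_of A g x B)
    = (\<Sum>i\<in>UNIV. \<Sum>j\<in>UNIV. (T (onframe A g x i c) (onframe A g x j c))\<^sup>2)"
proof -
  define e where "e = onframe A g x"
  have e: "e \<in> so_frames A g x" using f by (simp add: e_def)
  have eT: "e i \<in> tangent_space A x" for i using e unfolding so_frames_def by auto
  have y: "cmap c x \<in> cmap c ` cdom c" using c by simp
  note lg' = linear_gc'[OF c(1) y]
  note ortho = so_frames_chart[OF e c]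
  have "g x (endo_of A g x B (e i)) (endo_of A g x B (e i)) = (\<Sum>j\<in>UNIV. (T (e i c) (e j c))\<^sup>2)" for i
  proof -
    \<comment> \<open>The Riesz vector of the functional \<open>T (e i c)\<close>.\<close>
    define v where "v = (\<lambda>d. \<Sum>j\<in>UNIV. T (e i c) (e j c) *\<^sub>R e j d)"
    have vT: "v \<in> tangent_space A x" unfolding v_def by (rule tangent_sum[OF eT])
    have gv: "gc c (cmap c x) (v c) w = (\<Sum>j\<in>UNIV. T (e i c) (e j c) * gc c (cmap c x) (e j c) w)" for w
      unfolding v_def by (simp add: linear_sum[OF lg'] linear_cmul[OF lg'])
    have key: "gc c (cmap c x) (v c) w = T (e i c) w" for w
    proof -
      have "T (e i c) w = T (e i c) (\<Sum>j\<in>UNIV. gc c (cmap c x) w (e j c) *\<^sub>R e j c)"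
        by (subst (1) orthonormal_frame_expansion[OF lg' ortho, of w]) (rule refl)
      also have "\<dots> = (\<Sum>j\<in>UNIV. T (e i c) (e j c) * gc c (cmap c x) (e j c) w)"
        by (simp add: linear_sum[OF T2] linear_cmul[OF T2] gc_sym[OF c(1) y, of w] mult.commute)
      finally show ?thesis unfolding gv by simp
    qed
    have "endo_of A g x B (e i) = v"
      unfolding endo_of_def
    proof (rule the_equality)
      show "v \<in> tangent_space A x \<and> (\<forall>Y\<in>tangent_space A x. g x v Y = B (e i) Y)"
        using vT by (auto simp: g_gc[OF vT _ c] B[OF eT] key)
      fix v' assume v': "v' \<in> tangent_space A x \<and> (\<forall>Y\<in>tangent_space A x. g x v' Y = B (e i) Y)"
      have "gc c (cmap c x) (v' c) w = gc c (cmap c x) (v c) w" for w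
      proof -
        have "g x v' (tvec_of A x c w) = T (e i c) w"
          using v' tvec_of_tangent[OF c] B[OF eT tvec_of_tangent[OF c]] by (simp add: tvec_of_self[OF c])
        then show ?thesis using g_gc[OF _ tvec_of_tangent[OF c] c, of v' w] v' by (simp add: tvec_of_self[OF c] key)
      qed
      then have "v' c = v c" by (rule gc_nondegenerate[OF c(1) y])
      then show "v' = v" using tangent_eqI[OF _ vT c] v' by blast
    qed
    then have "g x (endo_of A g x B (e i)) (endo_of A g x B (e i)) = T (e i c) (v c)"
      using g_gc[OF vT vT c] key by simp
    also have "\<dots> = (\<Sum>j\<in>UNIV. (T (e i c) (e j c))\<^sup>2)"
      unfolding v_def by (simp add: linear_sum[OF T2] linear_cmul[OF T2] power2_eq_square)
    finally show ?thesis .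
  qed
  then show ?thesis unfolding endo_norm_sq_def Let_def e_def[symmetric] by simp
qed

end

lemma sum_strict_upper_triangle:
  fixes h :: "'n::{finite,linorder} \<Rightarrow> 'n \<Rightarrow> real"
  assumes "\<And>i j. h i j = h j i" "\<And>i. h i i = 0"
  shows "(\<Sum>(i,j) | i < j. h i j) = (\<Sum>i\<in>UNIV. \<Sum>j\<in>UNIV. h i j) / 2"
proof -
  define L where "L = {(i::'n,j). i < j}"
  define G where "G = {(i::'n,j). j < i}"
  define D where "D = {(i::'n,j). i = j}"
  have "(\<Sum>i\<in>UNIV. \<Sum>j\<in>UNIV. h i j) = (\<Sum>p\<in>UNIV. h (fst p) (snd p))"
    by (simp add: sum.cartesian_product case_prod_beta UNIV_Times_UNIV[symmetric] del: UNIV_Times_UNIV)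
  also have "UNIV = L \<union> (G \<union> D)" by (auto simp: L_def G_def D_def)
  also have "(\<Sum>p\<in>L \<union> (G \<union> D). h (fst p) (snd p)) = (\<Sum>p\<in>L. h (fst p) (snd p)) + ((\<Sum>p\<in>G. h (fst p) (snd p)) + (\<Sum>p\<in>D. h (fst p) (snd p)))"
    by (subst sum.union_disjoint, (auto simp: L_def G_def D_def)[3], subst sum.union_disjoint) (auto simp: L_def G_def D_def)
  also have "(\<Sum>p\<in>D. h (fst p) (snd p)) = 0" by (rule sum.neutral) (auto simp: D_def assms(2))
  also have "(\<Sum>p\<in>G. h (fst p) (snd p)) = (\<Sum>p\<in>L. h (fst p) (snd p))"
    by (rule sum.reindex_bij_witness[of _ prod.swap prod.swap]) (auto simp: L_def G_def assms(1))
  finally show ?thesis by (simp add: L_def case_prod_beta)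
qed

locale spinc_manifold =
  fixes S :: "('m::{t2_space,second_countable_topology}, 'n::{finite,linorder},
      'p::{t2_space,second_countable_topology}, 'e::euclidean_space,
      'q::{t2_space,second_countable_topology}, 'f::euclidean_space, 'k::finite) spinc"
  assumes spinc: "riemannian_spinc_manifold S"
begin

sublocale riemannian_manifold "atlas S" "gmetric S"
  by unfold_locales (use spinc in \<open>auto simp: riemannian_spinc_manifold_def oriented_atlas_def\<close>)

lemma P_bundle: "principal_bundle (atlas S) (P_atlas S) (P_proj S) spinc_group cl_mult cl_one (P_act S)"
  and Q_bundle: "principal_bundle (atlas S) (Q_atlas S) (Q_proj S) (sphere 0 1) (*) 1 (Q_act S)"
  and theta_frame: "fst (theta S u) \<in> so_frames (atlas S) (gmetric S) (P_proj S u)"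
  and theta_proj: "Q_proj S (snd (theta S u)) = P_proj S u"
  and theta_smooth1: "c \<in> atlas S \<Longrightarrow> smooth_fun (P_atlas S) (P_proj S -` cdom c) (\<lambda>u. fst (theta S u) i c)"
  and theta_smooth2: "smooth_map (P_atlas S) (Q_atlas S) UNIV (\<lambda>u. snd (theta S u))"
  and connection: "connection_form (Q_atlas S) (Q_act S) (conn S)"
  using spinc unfolding riemannian_spinc_manifold_def spinc_structure_def by blast+

sublocale P: smooth_manifold "P_atlas S"
  by unfold_locales (use P_bundle in \<open>simp add: principal_bundle_def\<close>)

sublocale Q: smooth_manifold "Q_atlas S"
  by unfold_locales (use Q_bundle in \<open>simp add: principal_bundle_def\<close>)

sublocale spinor_representation "rep S"
  by unfold_locales (use spinc in \<open>auto simp: riemannian_spinc_manifold_def\<close>)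

lemma P_fibre: "P_proj S u = P_proj S u' \<longleftrightarrow> (\<exists>a\<in>spinc_group. u' = P_act S u a)"
  using P_bundle unfolding principal_bundle_def by blast

lemma P_section: "\<exists>U b. x \<in> U \<and> local_section (atlas S) (P_atlas S) (P_proj S) U b"
proof -
  have "\<forall>x. \<exists>U b \<tau>. x \<in> U \<and> local_section (atlas S) (P_atlas S) (P_proj S) U b \<and>
        smooth_fun (P_atlas S) (P_proj S -` U) \<tau> \<and>
        (\<forall>u\<in>P_proj S -` U. \<tau> u \<in> spinc_group \<and> u = P_act S (b (P_proj S u)) (\<tau> u))"
    using P_bundle unfolding principal_bundle_def by (elim conjE) assumption
  then show ?thesis by blast
qed

lemma P_nonempty: "\<exists>u. P_proj S u = x"
  using P_section[of x] unfolding local_section_def by blast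

text \<open>\<open>smooth_action\<close> supplies smooth extensions near each pair of a point and a
  group element. Fixing the group element gives local coordinate expressions of the translation, and
  continuity is derived from these first.\<close>

lemma smooth_right_translation:
  assumes a: "a \<in> spinc_group"
  shows "smooth_map (P_atlas S) (P_atlas S) UNIV (\<lambda>u. P_act S u a)"
proof -
  define r where "r u = P_act S u a" for u
  have act: "smooth_action (P_atlas S) spinc_group (P_act S)"
    using P_bundle unfolding principal_bundle_def by blast
  have loc: "\<exists>T f. cmap c u \<in> T \<and> smooth_on T f \<and> (\<forall>u'\<in>cdom c. cmap c u' \<in> T \<longrightarrow> r u' \<in> cdom d \<and> cmap d (r u') = f (cmap c u'))"
    if c: "c \<in> P_atlas S" and d: "d \<in> P_atlas S" and u: "u \<in> cdom c" "r u \<in> cdom d" for c d u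
  proof -
    obtain W F where W: "(cmap c u, a) \<in> W" "smooth_on W F"
      and F: "\<And>u' a'. u' \<in> cdom c \<Longrightarrow> a' \<in> spinc_group \<Longrightarrow> (cmap c u', a') \<in> W \<Longrightarrow>
          P_act S u' a' \<in> cdom d \<and> cmap d (P_act S u' a') = F (cmap c u', a')"
      using act c d u a unfolding smooth_action_def r_def by metis
    \<comment> \<open>The slice of \<open>W\<close> at the fixed group element.\<close>
    define T where "T = (\<lambda>z. (z, a)) -` W"
    have oT: "open T"
      unfolding T_def by (rule open_vimage[OF smooth_on_open[OF W(2)]]) (intro continuous_intros)
    have "smooth_on T (\<lambda>z. (z, 0) + (0, a))"
      by (intro smooth_on_add smooth_on_const oT smooth_on_linear[OF bounded_linear_Pair[OF bounded_linear_ident bounded_linear_zero]] smooth_on_ident)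
    then have "smooth_on T (\<lambda>z. (z, a))" by simp
    then have "smooth_on T (\<lambda>z. F (z, a))"
      by (rule smooth_on_compose[OF _ W(2)]) (auto simp: T_def)
    then show ?thesis
      by (intro exI[of _ T] exI[of _ "\<lambda>z. F (z, a)"]) (use W F a in \<open>auto simp: T_def r_def\<close>)
  qed
  have "continuous_on UNIV r"
  proof -
    \<comment> \<open>Continuity is local: every point turns out to lie in an open set on which the
      translation is continuous, read off in charts around the point and its image.\<close>
    define N where "N = {N. open N \<and> continuous_on N r}"
    have "continuous_on (\<Union>N) r" by (rule continuous_on_open_Union) (auto simp: N_def)
    moreover have "u \<in> \<Union>N" for u
    proof -
      define c where "c = chart_at (P_atlas S) u"
      define d where "d = chart_at (P_atlas S) (r u)"
      have c: "c \<in> P_atlas S" "u \<in> cdom c" and d: "d \<in> P_atlas S" "r u \<in> cdom d" using P.chart_at by (auto simp: c_def d_def)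
      obtain T f where T: "cmap c u \<in> T" "smooth_on T f"
        "\<And>u'. u' \<in> cdom c \<Longrightarrow> cmap c u' \<in> T \<Longrightarrow> r u' \<in> cdom d \<and> cmap d (r u') = f (cmap c u')"
        using loc[OF c(1) d(1) c(2) d(2)] by blast
      define M where "M = cmap c -` T \<inter> cdom c"
      have "open M"
        unfolding M_def using P.continuous_on_cmap[OF c(1)] P.open_cdom[OF c(1)] smooth_on_open[OF T(2)]
        by (simp add: continuous_on_open_vimage)
      moreover have "continuous_on M r"
      proof -
        have "continuous_on M (\<lambda>u. f (cmap c u))"
          by (rule continuous_on_compose2[OF smooth_on_continuous_on[OF T(2)] continuous_on_subset[OF P.continuous_on_cmap[OF c(1)]]])
            (auto simp: M_def)
        then have "continuous_on M (\<lambda>u. cinv d (f (cmap c u)))"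
        proof (rule continuous_on_compose2[OF homeomorphism_cont2[OF P.chart_homeo[OF d(1)]]])
          show "(\<lambda>u. f (cmap c u)) ` M \<subseteq> cmap d ` cdom d"
          proof (rule image_subsetI)
            fix u assume "u \<in> M"
            then have "r u \<in> cdom d" "cmap d (r u) = f (cmap c u)" using T(3) by (auto simp: M_def)
            then show "f (cmap c u) \<in> cmap d ` cdom d" by (metis imageI)
          qed
        qed
        moreover have "r u = cinv d (f (cmap c u))" if "u \<in> M" for u
          using T(3)[of u] P.cinv_cmap[OF d(1), of "r u"] that by (simp add: M_def)
        ultimately show ?thesis
          by (simp cong: continuous_on_cong)
      qed
      moreover have "u \<in> M" using c T by (simp add: M_def)
      ultimately show ?thesis unfolding N_def by blast
    qed
    ultimately show ?thesis by (metis UNIV_eq_I)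
  qed
  moreover have "smooth_on (cmap c ` (cdom c \<inter> UNIV \<inter> r -` cdom d)) (cmap d \<circ> r \<circ> cinv c)"
    if c: "c \<in> P_atlas S" and d: "d \<in> P_atlas S" for c d
  proof (rule smooth_on_local)
    fix y assume "y \<in> cmap c ` (cdom c \<inter> UNIV \<inter> r -` cdom d)"
    then obtain u where u: "u \<in> cdom c" "r u \<in> cdom d" "y = cmap c u" by auto
    obtain T f where T: "cmap c u \<in> T" "smooth_on T f"
      "\<And>u'. u' \<in> cdom c \<Longrightarrow> cmap c u' \<in> T \<Longrightarrow> r u' \<in> cdom d \<and> cmap d (r u') = f (cmap c u')"
      using loc[OF c d u(1,2)] by blast
    let ?T = "T \<inter> cmap c ` cdom c"
    have "smooth_on ?T f"
      by (rule smooth_on_subset[OF T(2)]) (use smooth_on_open[OF T(2)] P.open_chart_image'[OF c] in auto)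
    moreover have "(cmap d \<circ> r \<circ> cinv c) z = f z" if z: "z \<in> ?T" for z
    proof -
      obtain v where "v \<in> cdom c" "z = cmap c v" using z by blast
      then show ?thesis using T(3)[of v] z P.cinv_cmap[OF c] by simp
    qed
    ultimately have "smooth_on ?T (cmap d \<circ> r \<circ> cinv c)"
      by (simp only: smooth_on_cong[of ?T "cmap d \<circ> r \<circ> cinv c" f])
    moreover have "?T \<subseteq> cmap c ` (cdom c \<inter> UNIV \<inter> r -` cdom d)"
    proof
      fix z assume z: "z \<in> ?T"
      then obtain v where v: "v \<in> cdom c" "z = cmap c v" by blast
      then have "v \<in> cdom c \<inter> UNIV \<inter> r -` cdom d" using T(3)[of v] z by simp
      then show "z \<in> cmap c ` (cdom c \<inter> UNIV \<inter> r -` cdom d)" unfolding v(2) by (rule imageI)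
    qed
    moreover have "y \<in> ?T" using u T(1) by simp
    ultimately show "\<exists>T. y \<in> T \<and> T \<subseteq> cmap c ` (cdom c \<inter> UNIV \<inter> r -` cdom d) \<and> smooth_on T (cmap d \<circ> r \<circ> cinv c)"
      by (intro exI[of _ ?T] conjI)
  qed
  ultimately show ?thesis unfolding smooth_map_def r_def[symmetric] by simp
qed

text \<open>Any local section over the base point can be right-translated so as to hit
  \<open>u\<close>. This matters because \<open>herm\<close> evaluates spinors at one chosen point
  of the fibre; along a section through it, \<open>herm\<close> is the standard product of
  components.\<close>

lemma P_section_through:
  "\<exists>U b. P_proj S u \<in> U \<and> local_section (atlas S) (P_atlas S) (P_proj S) U b \<and> b (P_proj S u) = u"
proof -
  define x where "x = P_proj S u"
  obtain U b where b: "x \<in> U" "local_section (atlas S) (P_atlas S) (P_proj S) U b"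
    using P_section by blast
  have bs: "smooth_map (atlas S) (P_atlas S) U b" and bp: "\<And>z. z \<in> U \<Longrightarrow> P_proj S (b z) = z"
    using b(2) unfolding local_section_def by auto
  obtain a where a: "a \<in> spinc_group" "u = P_act S (b x) a"
    using P_fibre[of "b x" u] bp[OF b(1)] by (auto simp: x_def)
  have "smooth_map (atlas S) (P_atlas S) U (\<lambda>z. P_act S (b z) a)"
    by (rule smooth_map_compose[OF bs P.atlas P.atlas smooth_right_translation[OF a(1)]]) simp
  moreover have "P_proj S (P_act S (b z) a) = z" if "z \<in> U" for z
    using P_fibre[of "b z" "P_act S (b z) a"] a(1) bp[OF that] by auto
  ultimately have "local_section (atlas S) (P_atlas S) (P_proj S) U (\<lambda>z. P_act S (b z) a)"
    unfolding local_section_def by blast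
  then show ?thesis unfolding x_def[symmetric]
    by (intro exI[of _ U] exI[of _ "\<lambda>z. P_act S (b z) a"] conjI b(1)) (simp_all add: a(2)[symmetric])
qed

lemma cliff_act_frame:
  "cliff_act S x X \<Phi> u = (\<Sum>i\<in>UNIV. gmetric S x X (fst (theta S u) i) *\<^sub>R R i (\<Phi> u))"
  by (simp add: cliff_act_def rep_cl_vec)

lemma spinor_norm_fibre:
  assumes "\<Phi> \<in> spinor_fibre S x" "P_proj S u = x" "P_proj S u' = x"
  shows "norm (\<Phi> u) = norm (\<Phi> u')"
proof -
  obtain a where a: "a \<in> spinc_group" "u' = P_act S u a" using P_fibre[of u u'] assms by auto
  then have "rep S a *v \<Phi> u' = \<Phi> u" using assms unfolding spinor_fibre_def by blast
  then show ?thesis using rep_unitary[OF a(1)] by metis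
qed

lemma conn_imaginary: "v \<in> tangent_space (Q_atlas S) u \<Longrightarrow> Re (conn S u v) = 0"
  using connection unfolding connection_form_def by blast

end

section \<open>Eigenspinors\<close>

locale spinc_section = spinc_manifold S
  for S :: "('m::{t2_space,second_countable_topology}, 'n::{finite,linorder},
      'p::{t2_space,second_countable_topology}, 'e::euclidean_space,
      'q::{t2_space,second_countable_topology}, 'f::euclidean_space, 'k::finite) spinc" +
  fixes U :: "'m set" and b :: "'m \<Rightarrow> 'p" and c :: "('m, 'n) mchart" and d :: "('q, 'f) chart"
    and psi :: "'m \<Rightarrow> ('p, 'k) spinor" and nabla :: "('m \<Rightarrow> ('p, 'k) spinor) \<Rightarrow> 'm \<Rightarrow> ('m, 'n) mtvec \<Rightarrow> ('p, 'k) spinor"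
  assumes nabla: "spinor_connection S nabla"
    and psi: "spinor_field S psi"
    and section_b: "local_section (atlas S) (P_atlas S) (P_proj S) U b"
    and c: "c \<in> atlas S" and d: "d \<in> Q_atlas S"
begin

text \<open>\<open>E\<close>, \<open>sg\<close> and \<open>al = \<i> a\<close> are the coordinate expressions in the chart \<open>c\<close> of the frame, of \<open>\<sigma>\<close> in
  \<open>psi = [b,\<sigma>]\<close>, and of the pullback of the connection form by the section \<open>s\<close>.\<close>

definition e :: "'n \<Rightarrow> 'm \<Rightarrow> ('m, 'n) mtvec" where "e j x = fst (theta S (b x)) j"
definition s :: "'m \<Rightarrow> 'q" where "s x = snd (theta S (b x))"
definition V :: "((real, 'n) vec) set" where "V = cmap c ` (cdom c \<inter> U \<inter> s -` cdom d)"
definition E :: "'n \<Rightarrow> (real, 'n) vec \<Rightarrow> (real, 'n) vec" where "E j y = e j (cinv c y) c"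
definition sg :: "(real, 'n) vec \<Rightarrow> complex^'k" where "sg y = psi (cinv c y) (b (cinv c y))"
definition al :: "(real, 'n) vec \<Rightarrow> (real, 'n) vec \<Rightarrow> complex" where
  "al y v = conn S (s (cinv c y)) (pushforward (atlas S) (Q_atlas S) s (cinv c y) (tvec_of (atlas S) (cinv c y) c v))"
definition a :: "(real, 'n) vec \<Rightarrow> (real, 'n) vec \<Rightarrow> real" where "a y v = Im (al y v)"

lemma b_smooth: "smooth_map (atlas S) (P_atlas S) U b" and b_proj: "x \<in> U \<Longrightarrow> P_proj S (b x) = x"
  using section_b unfolding local_section_def by auto

lemma open_U: "open U"
  using b_smooth by (simp add: smooth_map_def)

lemma s_smooth: "smooth_map (atlas S) (Q_atlas S) U s"
  unfolding s_def by (rule smooth_map_compose[OF b_smooth P.atlas Q.atlas theta_smooth2]) simp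

lemma s_proj: "x \<in> U \<Longrightarrow> Q_proj S (s x) = x"
  by (simp add: s_def theta_proj b_proj)

lemma e_frame: "x \<in> U \<Longrightarrow> (\<lambda>j. e j x) \<in> so_frames (atlas S) (gmetric S) x"
  using theta_frame[of "b x"] by (simp add: e_def b_proj)

lemma e_tangent: "x \<in> U \<Longrightarrow> e j x \<in> tangent_space (atlas S) x"
  using e_frame unfolding so_frames_def by blast

lemma V_mem:
  assumes "y \<in> V"
  shows "cinv c y \<in> cdom c" "cinv c y \<in> U" "s (cinv c y) \<in> cdom d" "cmap c (cinv c y) = y" "y \<in> cmap c ` cdom c"
  using assms cinv_cmap[OF c] by (auto simp: V_def)

lemma open_V: "open V"
  unfolding V_def by (rule smooth_on_open[OF smooth_map_chart[OF s_smooth c d]])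

lemma e_smooth:
  assumes "c' \<in> atlas S"
  shows "smooth_fun (atlas S) (U \<inter> cdom c') (\<lambda>x. e j x c')"
  unfolding e_def
  by (rule smooth_fun_compose[OF smooth_map_subset[OF b_smooth _ _ P.atlas] P.atlas theta_smooth1[OF assms]])
    (use open_U open_cdom[OF assms] b_proj in auto)

lemma smooth_E: "smooth_on V (E j)"
  using smooth_on_subset[OF smooth_fun_chart[OF e_smooth[OF c] c] _ open_V]
  by (auto simp: V_def E_def[abs_def] o_def)

lemma ortho_E: "y \<in> V \<Longrightarrow> gc c y (E i y) (E j y) = (if i = j then 1 else 0)"
  using so_frames_chart[OF e_frame c, of "cinv c y" i j] V_mem[of y] by (simp add: E_def)

lemma smooth_sg: "smooth_on V sg"
proof -
  have "smooth_fun (atlas S) U (\<lambda>x. psi x (b x))"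
    using psi section_b unfolding spinor_field_def by blast
  from smooth_on_subset[OF smooth_fun_chart[OF this c] _ open_V] show ?thesis
    by (auto simp: V_def sg_def[abs_def] o_def)
qed

lemma conn_linear: "v \<in> tangent_space (Q_atlas S) u \<Longrightarrow> w \<in> tangent_space (Q_atlas S) u \<Longrightarrow>
    conn S u (\<lambda>c. r *\<^sub>R v c + t *\<^sub>R w c) = r *\<^sub>R conn S u v + t *\<^sub>R conn S u w"
  using connection unfolding connection_form_def by blast

lemma conn_smooth: "d' \<in> Q_atlas S \<Longrightarrow> smooth_fun (Q_atlas S) (cdom d') (\<lambda>u. conn S u (tvec_of (Q_atlas S) u d' w))"
  using connection unfolding connection_form_def by blast

lemmas pullback = Q.atlas s_smooth conn_linear conn_smooth c d

lemma smooth_al: "smooth_on V (\<lambda>y. al y v)"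
  unfolding V_def al_def by (rule smooth_pullback[OF pullback])

lemma linear_al: "y \<in> V \<Longrightarrow> linear (al y)"
  unfolding V_def al_def[abs_def] by (rule linear_pullback[OF pullback])

sublocale coords: spinor_coordinates R "\<lambda>x. \<i> *s x" V "gc c" "Gam c" E sg a
proof (rule spinor_coordinates.intro[OF clifford_module_axioms], rule spinor_coordinates_axioms.intro)
  have sub: "V \<subseteq> cmap c ` cdom c" using V_mem(5) by blast
  show "open V" by (rule open_V)
  show "smooth_on V (\<lambda>y. gc c y u v)" for u v by (rule smooth_on_subset[OF smooth_gc[OF c] sub open_V])
  show "linear (gc c y u)" if "y \<in> V" for y u by (rule linear_gc[OF c V_mem(5)[OF that]])
  show "gc c y u v = gc c y v u" if "y \<in> V" for y u v by (rule gc_sym[OF c V_mem(5)[OF that]])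
  show "smooth_on V (\<lambda>y. Gam c y u v)" for u v by (rule smooth_Gam[OF c open_V sub smooth_E ortho_E])
  show "linear (Gam c y u)" for y u by (rule linear_Gam)
  show "Gam c y u v = Gam c y v u" if "y \<in> V" for y u v by (rule Gam_sym[OF c V_mem(5)[OF that]])
  show "fderiv (\<lambda>y. gc c y u v) y w = gc c y (Gam c y w u) v + gc c y u (Gam c y w v)" if "y \<in> V" for y u v w
    by (rule Gam_compat[OF c V_mem(5)[OF that]])
  show "smooth_on V (E i)" for i by (rule smooth_E)
  show "gc c y (E i y) (E j y) = (if i = j then 1 else 0)" if "y \<in> V" for y i j by (rule ortho_E[OF that])
  show "v = (\<Sum>i\<in>UNIV. gc c y v (E i y) *\<^sub>R E i y)" if "y \<in> V" for y v
    by (rule orthonormal_frame_expansion[OF linear_gc'[OF c V_mem(5)[OF that]] ortho_E[OF that]])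
  show "smooth_on V sg" by (rule smooth_sg)
  show "smooth_on V (\<lambda>y. a y v)" for v unfolding a_def by (rule smooth_on_linear[OF bounded_linear_Im smooth_al])
  show "linear (a y)" if "y \<in> V" for y
    using linear_al[OF that] unfolding a_def[abs_def] by (auto simp: linear_iff)
qed

lemma cliff_act_b:
  assumes x: "x \<in> cdom c" "x \<in> U" and X: "X \<in> tangent_space (atlas S) x"
  shows "cliff_act S x X \<Phi> (b x) = (\<Sum>i\<in>UNIV. gc c (cmap c x) (X c) (e i x c) *\<^sub>R R i (\<Phi> (b x)))"
  unfolding cliff_act_frame e_def[symmetric] using g_gc[OF X e_tangent[OF x(2)] c x(1)] by simp

lemma cliff_act_e:
  assumes x: "x \<in> U"
  shows "cliff_act S x (e j x) \<Phi> (b x) = R j (\<Phi> (b x))"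
proof -
  have "gmetric S x (e j x) (e i x) = (if j = i then 1 else 0)" for i
    using e_frame[OF x] unfolding so_frames_def by blast
  then show ?thesis unfolding cliff_act_frame e_def[symmetric] by (simp add: sum_delta_scaleR)
qed

text \<open>The local formula that defines the spinor connection, evaluated along \<open>b\<close>,
  is the coordinate expression \<open>P\<close>. The Levi-Civita derivatives of the frame have to be
  genuine tangent vectors for their Clifford action to be computed in the chart.\<close>

lemma nabla_coords:
  assumes y: "y \<in> V" and X: "X \<in> tangent_space (atlas S) (cinv c y)"
  shows "nabla psi (cinv c y) X (b (cinv c y)) = coords.P y (X c)"
proof -
  let ?x = "cinv c y"
  note x = V_mem(1,2)[OF y]
  have sm: "smooth_fun (atlas S) U (\<lambda>x. psi x (b x))"
    using psi section_b unfolding spinor_field_def by blast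
  have lc: "levi_civita (atlas S) (gmetric S) ?x X (e j) \<in> tangent_space (atlas S) ?x" for j
  proof (rule levi_civita_tangent[OF open_U x(2) _ _ X])
    show "e j z \<in> tangent_space (atlas S) z" if "z \<in> U" for z by (rule e_tangent[OF that])
    fix c' assume c': "c' \<in> atlas S" "?x \<in> cdom c'"
    from smooth_fun_differentiable[OF e_smooth[OF c'(1)] c'] c'(2) x(2)
    show "(\<lambda>y. e j (cinv c' y) c') differentiable (at (cmap c' ?x))" by (simp add: o_def)
  qed
  have lcc: "levi_civita (atlas S) (gmetric S) ?x X (e j) c = fderiv (E j) y (X c) + Gam c y (X c) (E j y)" for j
    by (simp add: levi_civita_chart[OF c x(1)] V_mem(4)[OF y] E_def[abs_def])
  have dd: "dir_deriv (atlas S) ?x X (\<lambda>x. psi x (b x)) = fderiv sg y (X c)"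
    using dir_deriv_chart[OF X c x(1) smooth_fun_differentiable[OF sm c x]] V_mem(4)[OF y]
    by (simp add: o_def sg_def[abs_def])
  \<comment> \<open>The coefficients of the covariant derivatives of the frame are the connection
    forms; the 4 compensates the 1/4 that \<open>cl\<close> already contains.\<close>
  have cc: "(\<Sum>j\<in>UNIV. cliff_act S ?x (e j ?x) (cliff_act S ?x (levi_civita (atlas S) (gmetric S) ?x X (e j)) (psi ?x)) (b ?x))
    = 4 *\<^sub>R cl (coords.om y (X c)) (sg y)"
    unfolding cliff_act_e[OF x(2)] cliff_act_b[OF x lc] lcc V_mem(4)[OF y]
    by (simp add: cl_def coords.om_def E_def[symmetric] sg_def[symmetric] rho_simps)
  have T: "pushforward (atlas S) (Q_atlas S) s ?x X \<in> tangent_space (Q_atlas S) (s ?x)"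
    by (rule pushforward_tangent[OF s_smooth Q.atlas X x(2)])
  have "conn S (s ?x) (pushforward (atlas S) (Q_atlas S) s ?x X) = al y (X c)"
    by (simp add: al_def tvec_of_tangent_eq[OF X c x(1)])
  moreover have "Re (conn S (s ?x) (pushforward (atlas S) (Q_atlas S) s ?x X)) = 0" by (rule conn_imaginary[OF T])
  \<comment> \<open>A connection form has imaginary values, so it is recovered from its imaginary
    part \<open>a\<close>; half of it then acts as \<open>a / 2\<close> times
    \<open>J\<close>.\<close>
  ultimately have co: "conn S (s ?x) (pushforward (atlas S) (Q_atlas S) s ?x X) = \<i> * complex_of_real (a y (X c))"
    by (simp add: a_def complex_eq_iff)
  have "nabla psi ?x X (b ?x) = dir_deriv (atlas S) ?x X (\<lambda>x. psi x (b x)) +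
      (1/4) *\<^sub>R (\<Sum>j\<in>UNIV. cliff_act S ?x (e j ?x) (cliff_act S ?x (levi_civita (atlas S) (gmetric S) ?x X (e j)) (psi ?x)) (b ?x)) +
      (1/2 * conn S (s ?x) (pushforward (atlas S) (Q_atlas S) s ?x X)) *s psi ?x (b ?x)"
    using nabla psi X section_b x(2) unfolding spinor_connection_def Let_def e_def[abs_def] s_def[abs_def] by blast
  also have "(1/2 * conn S (s ?x) (pushforward (atlas S) (Q_atlas S) s ?x X)) *s psi ?x (b ?x) = (a y (X c) / 2) *\<^sub>R (\<i> *s sg y)"
    unfolding co scaleR_eq_scalar sg_def by (simp add: vec_eq_iff)
  finally show ?thesis unfolding dd cc coords.P_def coords.W_def by simp
qed

text \<open>The sum over \<open>onframe\<close> is a frame sum of the bilinear map \<open>B\<close>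
  and may be evaluated in the frame of the section, where Clifford multiplication by the frame
  vectors is \<open>R\<close>.\<close>

lemma dirac_coords:
  assumes y: "y \<in> V" and D: "dirac S nabla psi (cinv c y) = (\<lambda>u. complex_of_real lam *s psi (cinv c y) u)"
  shows "(\<Sum>j\<in>UNIV. R j (coords.P y (E j y))) = lam *\<^sub>R sg y"
proof -
  let ?x = "cinv c y"
  note x = V_mem(1,2)[OF y]
  define f where "f = onframe (atlas S) (gmetric S) ?x"
  have f: "f \<in> so_frames (atlas S) (gmetric S) ?x" unfolding f_def by (rule onframe[OF e_frame[OF x(2)]])
  have fT: "f i \<in> tangent_space (atlas S) ?x" for i using f unfolding so_frames_def by blast
  define B where "B p q = (\<Sum>k\<in>UNIV. gc c y p (E k y) *\<^sub>R R k (coords.P y q))" for p q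
  have "lam *\<^sub>R sg y = dirac S nabla psi ?x (b ?x)"
    unfolding D scaleR_eq_scalar sg_def ..
  also have "\<dots> = (\<Sum>i\<in>UNIV. B (f i c) (f i c))"
    unfolding dirac_def Let_def f_def[symmetric] cliff_act_b[OF x fT] nabla_coords[OF y fT] V_mem(4)[OF y] B_def E_def ..
  also have "\<dots> = (\<Sum>i\<in>UNIV. B (e i ?x c) (e i ?x c))"
  proof (rule frame_sum_chart[OF e_frame[OF x(2)] f c x(1), where B=B])
    show "linear (\<lambda>u. B u v)" for v
      unfolding B_def by (rule linearI)
        (simp_all add: linear_add[OF coords.linear_G'[OF y]] linear_cmul[OF coords.linear_G'[OF y]] scaleR_add_left sum.distrib scaleR_sum_right)
    show "linear (B u)" for u
      unfolding B_def by (rule linearI)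
        (simp_all add: linear_add[OF coords.linear_P[OF y]] linear_cmul[OF coords.linear_P[OF y]] rho_simps scaleR_add_right sum.distrib scaleR_sum_right mult.commute)
  qed
  also have "\<dots> = (\<Sum>i\<in>UNIV. R i (coords.P y (E i y)))"
    by (simp add: B_def E_def[symmetric] ortho_E[OF y] sum_delta_scaleR)
  finally show ?thesis by simp
qed

text \<open>Pulling the curvature equation back along \<open>s\<close> undoes the projection, and
  the pulled back form has differential \<open>da\<close> up to the factor \<i>.\<close>

lemma curvature_coords:
  assumes curv: "curvature_form S \<Omega>" and x: "x \<in> cdom c" "x \<in> U" and dx: "d = chart_at (Q_atlas S) (s x)"
    and X: "X \<in> tangent_space (atlas S) x" and Y: "Y \<in> tangent_space (atlas S) x"
  shows "\<Omega> x X Y = coords.da (cmap c x) (X c) (Y c)"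
proof -
  have sx: "s x \<in> cdom d" using Q.chart_at dx by simp
  have y: "cmap c x \<in> V" using x sx by (auto simp: V_def)
  have Qp: "smooth_map (Q_atlas S) (atlas S) UNIV (Q_proj S)"
    using Q_bundle unfolding principal_bundle_def by blast
  have ps: "pushforward (Q_atlas S) (atlas S) (Q_proj S) (s x) (pushforward (atlas S) (Q_atlas S) s x Z) = Z"
    if "Z \<in> tangent_space (atlas S) x" for Z
    by (rule pushforward_section[OF s_smooth Q.atlas Qp _ that x(2)]) (rule s_proj)
  note pt = pushforward_tangent[OF s_smooth Q.atlas _ x(2)]
  have "\<i> * complex_of_real (\<Omega> x X Y) = ext_deriv (Q_atlas S) (conn S) (s x)
      (pushforward (atlas S) (Q_atlas S) s x X) (pushforward (atlas S) (Q_atlas S) s x Y)"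
    using curv pt[OF X] pt[OF Y] unfolding curvature_form_def by (simp add: ps[OF X] ps[OF Y] s_proj[OF x(2)])
  also have "\<dots> = fderiv (\<lambda>y. al y (Y c)) (cmap c x) (X c) - fderiv (\<lambda>y. al y (X c)) (cmap c x) (Y c)"
    unfolding al_def by (rule ext_deriv_pullback[OF pullback x dx X Y])
  finally have "\<Omega> x X Y = Im (fderiv (\<lambda>y. al y (Y c)) (cmap c x) (X c)) - Im (fderiv (\<lambda>y. al y (X c)) (cmap c x) (Y c))"
    by (metis Im_i_times Re_complex_of_real minus_complex.simps(2))
  moreover have "fderiv (\<lambda>y. a y v) (cmap c x) u = Im (fderiv (\<lambda>y. al y v) (cmap c x) u)" for u v
    unfolding a_def by (rule fderiv_linear[OF bounded_linear_Im smooth_on_differentiable[OF smooth_al y]])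
  ultimately show ?thesis by (simp add: coords.da_def)
qed

text \<open>The assumptions on \<open>c\<close>, \<open>d\<close> and \<open>b x\<close> match the
  choices made inside \<open>scalar_curvature\<close>, \<open>ext_deriv\<close> and
  \<open>herm\<close>, so that all terms are expressed in the same coordinates at
  \<open>x\<close>.\<close>

lemma pointwise_estimate:
  assumes curv: "curvature_form S \<Omega>" and x: "x \<in> U" and cx: "c = chart_at (atlas S) x" and dx: "d = chart_at (Q_atlas S) (s x)"
    and bx: "b x = (SOME u. P_proj S u = x)" and nz: "psi x (b x) \<noteq> 0"
    and D: "\<And>z. dirac S nabla psi z = (\<lambda>u. complex_of_real lam *s psi z u)"
    and max: "\<And>z. z \<in> U \<Longrightarrow> norm (psi z (b z)) \<le> norm (psi x (b x))"
  shows "1/4 * scalar_curvature (atlas S) (gmetric S) x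
       - (2 * sqrt (real (CARD('n) div 2))) / 4 * two_form_norm (atlas S) (gmetric S) \<Omega> x
       + endo_norm_sq (atlas S) (gmetric S) x (ell_endo S nabla psi x)
       + endo_norm_sq (atlas S) (gmetric S) x (q_endo S nabla psi x) \<le> lam\<^sup>2"
proof -
  have xc: "x \<in> cdom c" using chart_at cx by simp
  have sx: "s x \<in> cdom d" using Q.chart_at dx by simp
  define y where "y = cmap c x"
  have y: "y \<in> V" using x xc sx by (auto simp: V_def y_def)
  have cy: "cinv c y = x" by (simp add: y_def cinv_cmap[OF c xc])
  have sgy: "sg y = psi x (b x)" by (simp add: sg_def cy)
  define N where "N = sg y \<bullet> sg y"
  have N: "N > 0" using nz by (simp add: N_def sgy)
  define f where "f = onframe (atlas S) (gmetric S) x"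
  have f: "f \<in> so_frames (atlas S) (gmetric S) x" unfolding f_def by (rule onframe[OF e_frame[OF x]])
  have fT: "f i \<in> tangent_space (atlas S) x" for i using f unfolding so_frames_def by blast
  have Ey: "E i y = e i x c" for i by (simp add: E_def cy)

  have "sg z \<bullet> sg z \<le> sg y \<bullet> sg y" if "z \<in> V" for z
    using max[OF V_mem(2)[OF that]] by (simp add: sg_def cy dot_square_norm)
  then have bochner: "(\<Sum>j\<in>UNIV. coords.P y (E j y) \<bullet> coords.P y (E j y))
      + 1/4 * (\<Sum>i\<in>UNIV. \<Sum>j\<in>UNIV. gc c y (coords.Riem y (E i y) (E j y) (E j y)) (E i y)) * N
      + 1/4 * (\<Sum>i\<in>UNIV. \<Sum>j\<in>UNIV. coords.da y (E i y) (E j y) * (R i (R j (\<i> *s sg y)) \<bullet> sg y))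
    \<le> lam\<^sup>2 * N"
    unfolding N_def by (intro coords.Bochner[OF dirac_coords y] D) auto

  have Riem: "coords.Riem = Rie c"
    by (intro ext) (simp add: coords.Riem_def Rie_def)
  have scal: "scalar_curvature (atlas S) (gmetric S) x = (\<Sum>i\<in>UNIV. \<Sum>j\<in>UNIV. gc c y (coords.Riem y (E i y) (E j y) (E j y)) (E i y))"
    unfolding Riem
    by (rule scalar_curvature_frame[OF open_V _ y[unfolded y_def] smooth_E ortho_E cx y_def]) (use V_mem(5) in blast)

  have Om: "\<Omega> x X Y = coords.da y (X c) (Y c)"
    if "X \<in> tangent_space (atlas S) x" "Y \<in> tangent_space (atlas S) x" for X Y
    unfolding y_def by (rule curvature_coords[OF curv xc x dx that])
  have da1: "linear (\<lambda>u. coords.da y u v)" and da2: "linear (coords.da y u)" for u v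
  proof -
    note dif = smooth_on_differentiable[OF coords.smooth_a y]
    have 1: "linear (\<lambda>v. fderiv (\<lambda>y. a y v) y u)" for u
      by (rule linear_fderiv_field[where P=a, OF open_V y coords.linear_a dif])
    have 2: "linear (fderiv (\<lambda>y. a y v) y)" for v by (rule linear_frechet_derivative[OF dif])
    show "linear (\<lambda>u. coords.da y u v)" "linear (coords.da y u)"
      unfolding coords.da_def[abs_def] by (intro linear_compose_sub 1 2)+
  qed
  have norm_Om: "two_form_norm (atlas S) (gmetric S) \<Omega> x = sqrt ((\<Sum>i\<in>UNIV. \<Sum>j\<in>UNIV. (coords.da y (E i y) (E j y))\<^sup>2) / 2)"
  proof -
    have "(\<Sum>(i,j) | i < j. (\<Omega> x (f i) (f j))\<^sup>2) = (\<Sum>i\<in>UNIV. \<Sum>j\<in>UNIV. (\<Omega> x (f i) (f j))\<^sup>2) / 2"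
      by (rule sum_strict_upper_triangle) (simp_all add: Om[OF fT fT] coords.da_def power2_commute)
    also have "(\<Sum>i\<in>UNIV. \<Sum>j\<in>UNIV. (\<Omega> x (f i) (f j))\<^sup>2) = (\<Sum>i\<in>UNIV. \<Sum>j\<in>UNIV. (coords.da y (f i c) (f j c))\<^sup>2)"
      by (simp add: Om[OF fT fT])
    also have "\<dots> = (\<Sum>i\<in>UNIV. \<Sum>j\<in>UNIV. (coords.da y (E i y) (E j y))\<^sup>2)"
      unfolding Ey by (rule frame_double_sum_chart[OF e_frame[OF x] f c xc da1 da2])
    finally show ?thesis unfolding two_form_norm_def Let_def f_def[symmetric] by simp
  qed
  \<comment> \<open>The factor in front of the norm of \<Omega> is c_n; the 1/4 of the Bochner
    inequality turns it into the coefficient of the claim.\<close>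
  have "\<bar>\<Sum>i\<in>UNIV. \<Sum>j\<in>UNIV. coords.da y (E i y) (E j y) * (R i (R j (\<i> *s sg y)) \<bullet> sg y)\<bar>
      \<le> 2 * sqrt (real (CARD('n) div 2)) * two_form_norm (atlas S) (gmetric S) \<Omega> x * N"
    unfolding norm_Om N_def by (rule two_form_estimate)
  then have omega: "- (2 * sqrt (real (CARD('n) div 2)) * two_form_norm (atlas S) (gmetric S) \<Omega> x * N)
      \<le> (\<Sum>i\<in>UNIV. \<Sum>j\<in>UNIV. coords.da y (E i y) (E j y) * (R i (R j (\<i> *s sg y)) \<bullet> sg y))"
    by linarith

  \<comment> \<open>\<open>T\<close> applied to X and Y is the real part of the product of X acting
    on the derivative along Y with the spinor, divided by its squared length. The form of \<ell> is
    its symmetric part and that of q minus its skew part.\<close>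
  define T where "T p q = (\<Sum>k\<in>UNIV. gc c y p (E k y) * (R k (coords.P y q) \<bullet> sg y)) / N" for p q
  have T1: "linear (\<lambda>u. T u v)" for v
    unfolding T_def by (rule linearI)
      (simp_all add: linear_add[OF coords.linear_G'[OF y]] linear_cmul[OF coords.linear_G'[OF y]] distrib_right sum.distrib add_divide_distrib sum_distrib_left mult.assoc)
  have T2: "linear (T u)" for u
    unfolding T_def by (rule linearI)
      (simp_all add: linear_add[OF coords.linear_P[OF y]] linear_cmul[OF coords.linear_P[OF y]] rho_simps inner_add_left distrib_left sum.distrib add_divide_distrib sum_distrib_left mult_ac)
  have herm: "Re (herm S x \<Phi> \<Psi>) = \<Phi> (b x) \<bullet> \<Psi> (b x)" for \<Phi> \<Psi>
    unfolding herm_def Let_def bx[symmetric] by (simp add: inner_eq_Re_herm)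
  have cT: "cliff_act S x X (nabla psi x Y) (b x) \<bullet> ((1 / N) *\<^sub>R sg y) = T (X c) (Y c)"
    if "X \<in> tangent_space (atlas S) x" "Y \<in> tangent_space (atlas S) x" for X Y
    using nabla_coords[OF y, unfolded cy, OF that(2)]
    by (simp add: cliff_act_b[OF xc x that(1)] T_def y_def[symmetric] Ey inner_sum_left)
  have NN: "Re (herm S x (psi x) (psi x)) = N" by (simp add: herm N_def sgy)
  have fr: "onframe (atlas S) (gmetric S) x \<in> so_frames (atlas S) (gmetric S) x" using f by (simp add: f_def)
  have ell: "endo_norm_sq (atlas S) (gmetric S) x (ell_endo S nabla psi x)
      = (\<Sum>i\<in>UNIV. \<Sum>j\<in>UNIV. ((T (f i c) (f j c) + T (f j c) (f i c)) / 2)\<^sup>2)"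
    unfolding ell_endo_def f_def
  proof (rule endo_norm_sq_chart[where T="\<lambda>u v. (T u v + T v u) / 2", OF fr c xc])
    show "linear (\<lambda>v. (T u v + T v u) / 2)" for u
      by (rule linearI) (simp_all add: linear_add[OF T1] linear_add[OF T2] linear_cmul[OF T1] linear_cmul[OF T2] field_simps)
    fix X Y assume XY: "X \<in> tangent_space (atlas S) x" "Y \<in> tangent_space (atlas S) x"
    show "1/2 * Re (herm S x (\<lambda>u. cliff_act S x X (nabla psi x Y) u + cliff_act S x Y (nabla psi x X) u)
       (\<lambda>u. (1 / Re (herm S x (psi x) (psi x))) *\<^sub>R psi x u)) = (T (X c) (Y c) + T (Y c) (X c)) / 2"
      unfolding NN unfolding herm sgy[symmetric] inner_add_left cT[OF XY] cT[OF XY(2,1)] by simp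
  qed
  have q: "endo_norm_sq (atlas S) (gmetric S) x (q_endo S nabla psi x)
      = (\<Sum>i\<in>UNIV. \<Sum>j\<in>UNIV. ((T (f j c) (f i c) - T (f i c) (f j c)) / 2)\<^sup>2)"
    unfolding q_endo_def f_def
  proof (rule endo_norm_sq_chart[where T="\<lambda>u v. (T v u - T u v) / 2", OF fr c xc])
    show "linear (\<lambda>v. (T v u - T u v) / 2)" for u
      by (rule linearI) (simp_all add: linear_add[OF T1] linear_add[OF T2] linear_cmul[OF T1] linear_cmul[OF T2] field_simps)
    fix X Y assume XY: "X \<in> tangent_space (atlas S) x" "Y \<in> tangent_space (atlas S) x"
    show "1/2 * Re (herm S x (\<lambda>u. cliff_act S x Y (nabla psi x X) u - cliff_act S x X (nabla psi x Y) u)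
       (\<lambda>u. (1 / Re (herm S x (psi x) (psi x))) *\<^sub>R psi x u)) = (T (Y c) (X c) - T (X c) (Y c)) / 2"
      unfolding NN unfolding herm sgy[symmetric] inner_diff_left cT[OF XY] cT[OF XY(2,1)] by simp
  qed
  define M where "M = endo_norm_sq (atlas S) (gmetric S) x (ell_endo S nabla psi x)
    + endo_norm_sq (atlas S) (gmetric S) x (q_endo S nabla psi x)"
  have "M = (\<Sum>i\<in>UNIV. \<Sum>j\<in>UNIV. (T (f i c) (f j c))\<^sup>2)"
  proof -
    have "M = (\<Sum>i\<in>UNIV. \<Sum>j\<in>UNIV. ((T (f i c) (f j c) + T (f j c) (f i c)) / 2)\<^sup>2 + ((T (f j c) (f i c) - T (f i c) (f j c)) / 2)\<^sup>2)"
      unfolding M_def ell q by (simp add: sum.distrib)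
    \<comment> \<open>The mixed products of \<open>T\<close> and its transpose cancel between the
      symmetric and the skew part.\<close>
    also have "\<dots> = (\<Sum>i\<in>UNIV. \<Sum>j\<in>UNIV. (T (f i c) (f j c))\<^sup>2 / 2 + (T (f j c) (f i c))\<^sup>2 / 2)"
      by (intro sum.cong refl) (simp add: power2_eq_square field_simps)
    also have "\<dots> = (\<Sum>i\<in>UNIV. \<Sum>j\<in>UNIV. (T (f i c) (f j c))\<^sup>2)"
      using sum.swap[of "\<lambda>i j. (T (f i c) (f j c))\<^sup>2" UNIV UNIV]
      by (simp add: sum.distrib sum_divide_distrib[symmetric])
    finally show ?thesis .
  qed
  also have "\<dots> = (\<Sum>i\<in>UNIV. \<Sum>j\<in>UNIV. (T (E i y) (E j y))\<^sup>2)"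
    unfolding Ey by (rule frame_double_sum_chart[OF e_frame[OF x] f c xc T1 T2])
  also have "\<dots> = (\<Sum>i\<in>UNIV. \<Sum>j\<in>UNIV. (R i (coords.P y (E j y)) \<bullet> sg y / N)\<^sup>2)"
  proof -
    have "T (E i y) q = R i (coords.P y q) \<bullet> sg y / N" for i q
      unfolding T_def ortho_E[OF y] by (simp add: if_distrib[of "\<lambda>t. t * _"] cong: if_cong)
    then show ?thesis by simp
  qed
  finally have MN: "M * N \<le> (\<Sum>j\<in>UNIV. coords.P y (E j y) \<bullet> coords.P y (E j y))"
    using energy_momentum_bound[of "sg y" "\<lambda>j. coords.P y (E j y)"] N by (simp add: N_def)
  have "(1/4 * scalar_curvature (atlas S) (gmetric S) x
       - (2 * sqrt (real (CARD('n) div 2))) / 4 * two_form_norm (atlas S) (gmetric S) \<Omega> x + M) * N \<le> lam\<^sup>2 * N"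
    using bochner omega MN unfolding scal[symmetric] by (simp add: algebra_simps)
  then have "1/4 * scalar_curvature (atlas S) (gmetric S) x
       - (2 * sqrt (real (CARD('n) div 2))) / 4 * two_form_norm (atlas S) (gmetric S) \<Omega> x + M \<le> lam\<^sup>2"
    using N by (rule mult_right_le_imp_le)
  then show ?thesis by (simp add: M_def)
qed

end

section \<open>Choice of the maximum point and conclusion\<close>

theorem theorem1p1:
  fixes S :: "('m::{t2_space,second_countable_topology}, 'n::{finite,linorder},
      'p::{t2_space,second_countable_topology}, 'e::euclidean_space,
      'q::{t2_space,second_countable_topology}, 'f::euclidean_space, 'k::finite) spinc"
    and \<Omega> :: "'m \<Rightarrow> ('m, 'n) mtvec \<Rightarrow> ('m, 'n) mtvec \<Rightarrow> real"
    and nabla :: "('m \<Rightarrow> ('p, 'k) spinor) \<Rightarrow> 'm \<Rightarrow> ('m, 'n) mtvec \<Rightarrow> ('p, 'k) spinor"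
    and \<psi> :: "'m \<Rightarrow> ('p, 'k) spinor"
    and lam :: real
  assumes "compact (UNIV :: 'm set)" and "connected (UNIV :: 'm set)"
    and "CARD('n) \<ge> 2"
    and "riemannian_spinc_manifold S"
    and "curvature_form S \<Omega>"
    and "spinor_connection S nabla"
    and "spinor_field S \<psi>" and "\<exists>x. \<psi> x \<noteq> (\<lambda>u. 0)"
    and "\<forall>x. dirac S nabla \<psi> x = (\<lambda>u. complex_of_real lam *s \<psi> x u)"
  shows "ereal (lam\<^sup>2) \<ge> (INF x\<in>{x. \<psi> x \<noteq> (\<lambda>u. 0)}. ereal (
       1/4 * scalar_curvature (atlas S) (gmetric S) x
       - (2 * sqrt (real (CARD('n) div 2))) / 4 * two_form_norm (atlas S) (gmetric S) \<Omega> x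
       + endo_norm_sq (atlas S) (gmetric S) x (ell_endo S nabla \<psi> x)
       + endo_norm_sq (atlas S) (gmetric S) x (q_endo S nabla \<psi> x)))"
proof -
  interpret spinc_manifold S by unfold_locales fact
  have fibre: "\<psi> x \<in> spinor_fibre S x" for x
    using assms(7) unfolding spinor_field_def by blast
  define pt where "pt x = (SOME u. P_proj S u = x)" for x
  have pt: "P_proj S (pt x) = x" for x
    unfolding pt_def using P_nonempty by (rule someI_ex)
  \<comment> \<open>The length of the spinor as a function on the manifold; by unitarity any other
    point of the fibre gives the same value.\<close>
  define h where "h x = norm (\<psi> x (pt x))" for x
  have h: "norm (\<psi> x u) = h x" if "P_proj S u = x" for x u
    unfolding h_def by (rule spinor_norm_fibre[OF fibre that pt])
  \<comment> \<open>\<open>pt\<close> is an arbitrary choice and need not be continuous; near each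
    point \<open>h\<close> is instead computed along a local section, where the spinor field is
    smooth.\<close>
  have "continuous_on UNIV h"
  proof -
    define F where "F = {U. open U \<and> continuous_on U h}"
    have "continuous_on (\<Union>F) h" by (rule continuous_on_open_Union) (auto simp: F_def)
    moreover have "x \<in> \<Union>F" for x
    proof -
      obtain U b where b: "x \<in> U" "local_section (atlas S) (P_atlas S) (P_proj S) U b"
        using P_section by blast
      have "smooth_fun (atlas S) U (\<lambda>x. \<psi> x (b x))"
        using assms(7) b(2) unfolding spinor_field_def by blast
      from continuous_on_norm[OF smooth_fun_continuous_on[OF this]] this
      have "open U" "continuous_on U (\<lambda>x. norm (\<psi> x (b x)))"
        by (simp_all add: smooth_fun_def)
      moreover have "norm (\<psi> z (b z)) = h z" if "z \<in> U" for z
        using h b(2) that unfolding local_section_def by blast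
      ultimately have "U \<in> F" unfolding F_def by (simp cong: continuous_on_cong)
      then show ?thesis using b(1) by blast
    qed
    ultimately show ?thesis by (metis UNIV_eq_I)
  qed
  then obtain x where x: "\<And>z. h z \<le> h x"
    using continuous_attains_sup[OF assms(1), of h] by blast
  \<comment> \<open>The section passes through the very point of the fibre over \<open>x\<close> at
    which \<open>herm\<close> evaluates.\<close>
  obtain U b where b: "x \<in> U" "local_section (atlas S) (P_atlas S) (P_proj S) U b" "b x = pt x"
    using P_section_through[of "pt x"] unfolding pt by blast
  have bp: "P_proj S (b z) = z" if "z \<in> U" for z
    using b(2) that unfolding local_section_def by blast
  have "\<psi> x (pt x) \<noteq> 0"
  proof -
    \<comment> \<open>A spinor field that is not identically zero has a positive maximal length, so
      \<open>x\<close> belongs to the set over which the infimum is taken.\<close>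
    obtain z u where zu: "\<psi> z u \<noteq> 0" using assms(8) by (metis ext)
    then have "P_proj S u = z" using fibre[of z] unfolding spinor_fibre_def by blast
    then have "0 < h z" using h[of u z] zu by (metis zero_less_norm_iff)
    then have "0 < h x" using x[of z] by linarith
    then show ?thesis by (simp add: h_def)
  qed
  then have nz: "\<psi> x (b x) \<noteq> 0" by (simp add: b(3))
  define d where "d = chart_at (Q_atlas S) (snd (theta S (b x)))"
  interpret spinc_section S U b "chart_at (atlas S) x" d \<psi> nabla
    by unfold_locales (use assms b chart_at Q.chart_at in \<open>auto simp: d_def\<close>)
  have le: "1/4 * scalar_curvature (atlas S) (gmetric S) x
       - (2 * sqrt (real (CARD('n) div 2))) / 4 * two_form_norm (atlas S) (gmetric S) \<Omega> x
       + endo_norm_sq (atlas S) (gmetric S) x (ell_endo S nabla \<psi> x)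
       + endo_norm_sq (atlas S) (gmetric S) x (q_endo S nabla \<psi> x) \<le> lam\<^sup>2"
  proof (rule pointwise_estimate[OF assms(5) b(1) refl])
    show "d = chart_at (Q_atlas S) (s x)" by (simp add: d_def s_def)
    show "b x = (SOME u. P_proj S u = x)" by (simp add: b(3) pt_def)
    show "\<psi> x (b x) \<noteq> 0" by (rule nz)
    show "dirac S nabla \<psi> z = (\<lambda>u. complex_of_real lam *s \<psi> z u)" for z using assms(9) by blast
    show "norm (\<psi> z (b z)) \<le> norm (\<psi> x (b x))" if "z \<in> U" for z
      using x[of z] h[OF bp[OF that]] h[OF bp[OF b(1)]] by simp
  qed
  have mem: "x \<in> {x. \<psi> x \<noteq> (\<lambda>u. 0)}" using nz by auto
  show ?thesis
    by (rule INF_lower2[OF mem]) (simp only: ereal_less_eq le)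
qed

end
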